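(* For $n>1$, the moduli space of homogeneous tensors on $\mathbb{R}H(n)$ with fixed scalar curvature consists of two connected components.
   Context: Fix the hyperbolic metric $g$ of a given (constant negative) scalar curvature on $\mathbb{R}H(n)$, with Levi-Civita connection $\nabla$ and curvature $R$. A homogeneous tensor is a $(1,2)$-tensor $S$ such that $\widetilde\nabla=\nabla-S$ satisfies the Ambrose–Singer equations $\widetilde\nabla g=0$, $\widetilde\nabla R=0$, $\widetilde\nabla S=0$. Two homogeneous tensors are isomorphic if some isometry of $(\mathbb{R}H(n),g)$ carries one to the other. The moduli space is the set of homogeneous tensors modulo isomorphism. Its topology comes from regarding homogeneous tensors as elements of the finite-dimensional vector space $\mathbb{R}^n\otimes\Lambda^2\mathbb{R}^n$: fixing a point $p$, a homogeneous tensor $S$ is determined by its value $S_p\in T_p^*\otimes\mathfrak{so}(T_p)\cong\mathbb{R}^n\otimes\Lambda^2\mathbb{R}^n$, and the moduli space carries the corresponding quotient topology (quotient by isomorphism, i.e. by the action of $O(T_p)$ on the values $S_p$). *)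

theory Defs
  imports "HOL-Analysis.Analysis"
begin

section \<open>Smooth maps\<close>

text \<open>Meant for open \<open>M\<close> in a Euclidean space; the values of the map outside \<open>M\<close> are irrelevant.\<close>

fun Ck_on :: "nat \<Rightarrow> 'a::real_normed_vector set \<Rightarrow> ('a \<Rightarrow> 'b::real_normed_vector) \<Rightarrow> bool" where
  "Ck_on 0 M f \<longleftrightarrow> continuous_on M f"
| "Ck_on (Suc k) M f \<longleftrightarrow> (\<forall>x\<in>M. f differentiable (at x)) \<and>
     (\<forall>v. Ck_on k M (\<lambda>x. frechet_derivative f (at x) v))"

definition smooth_on :: "'a::real_normed_vector set \<Rightarrow> ('a \<Rightarrow> 'b::real_normed_vector) \<Rightarrow> bool" where
  "smooth_on M f \<longleftrightarrow> (\<forall>k. Ck_on k M f)"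

section \<open>Connections and tensor fields in a global chart\<close>

text \<open>
  A manifold here is an open \<open>M \<subseteq> \<real>\<^sup>n\<close>, and all its tangent spaces are \<open>\<real>\<^sup>n\<close>. A linear connection
  is given by its Christoffel map \<open>\<Gamma>\<close>, that is \<open>\<nabla>\<^sub>X Y = D\<^sub>X Y + \<Gamma>(X, Y)\<close>. A (1,2)-tensor field has
  the same type, so that the connection \<open>\<nabla> - S\<close> has Christoffel map \<open>\<Gamma> - S\<close>. All the operators
  below are tensorial in their vector arguments, hence it suffices to evaluate them on the constant
  coordinate fields, which commute.
\<close>

type_synonym 'n bilinear_field = "real^'n \<Rightarrow> ((real^'n) \<Rightarrow>\<^sub>L (real^'n) \<Rightarrow>\<^sub>L (real^'n))"
type_synonym 'n metric_field = "real^'n \<Rightarrow> real^'n \<Rightarrow> real^'n \<Rightarrow> real"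
type_synonym 'n curvature_field = "real^'n \<Rightarrow> real^'n \<Rightarrow> real^'n \<Rightarrow> real^'n \<Rightarrow> real^'n"

abbreviation bil :: "'n::finite bilinear_field \<Rightarrow> real^'n \<Rightarrow> real^'n \<Rightarrow> real^'n \<Rightarrow> real^'n" where
  "bil T x u v \<equiv> blinfun_apply (blinfun_apply (T x) u) v"

definition dir_deriv :: "real^'n \<Rightarrow> (real^'n \<Rightarrow> 'b::real_normed_vector) \<Rightarrow> real^'n \<Rightarrow> 'b" where
  "dir_deriv u f x = frechet_derivative f (at x) u"

text \<open>Covariant derivatives \<open>(\<nabla>\<^sub>u g)(v, w)\<close>, \<open>(\<nabla>\<^sub>u S)(v, w)\<close> and \<open>(\<nabla>\<^sub>u R)(v, w)z\<close>.\<close>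

definition nabla_metric ::
    "'n::finite bilinear_field \<Rightarrow> 'n metric_field \<Rightarrow> real^'n \<Rightarrow> real^'n \<Rightarrow> real^'n \<Rightarrow> real^'n \<Rightarrow> real" where
  "nabla_metric \<Gamma> g x u v w =
     dir_deriv u (\<lambda>y. g y v w) x - g x (bil \<Gamma> x u v) w - g x v (bil \<Gamma> x u w)"

definition nabla_bilinear ::
    "'n::finite bilinear_field \<Rightarrow> 'n bilinear_field \<Rightarrow> real^'n \<Rightarrow> real^'n \<Rightarrow> real^'n \<Rightarrow> real^'n \<Rightarrow> real^'n" where
  "nabla_bilinear \<Gamma> S x u v w =
     dir_deriv u (\<lambda>y. bil S y v w) x + bil \<Gamma> x u (bil S x v w)
       - bil S x (bil \<Gamma> x u v) w - bil S x v (bil \<Gamma> x u w)"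

definition nabla_curvature ::
    "'n::finite bilinear_field \<Rightarrow> 'n curvature_field \<Rightarrow>
     real^'n \<Rightarrow> real^'n \<Rightarrow> real^'n \<Rightarrow> real^'n \<Rightarrow> real^'n \<Rightarrow> real^'n" where
  "nabla_curvature \<Gamma> R x u v w z =
     dir_deriv u (\<lambda>y. R y v w z) x + bil \<Gamma> x u (R x v w z)
       - R x (bil \<Gamma> x u v) w z - R x v (bil \<Gamma> x u w) z - R x v w (bil \<Gamma> x u z)"

text \<open>The curvature \<open>R(u, v)w = \<nabla>\<^sub>u \<nabla>\<^sub>v w - \<nabla>\<^sub>v \<nabla>\<^sub>u w\<close> on constant fields.\<close>

definition curvature :: "'n::finite bilinear_field \<Rightarrow> 'n curvature_field" where
  "curvature \<Gamma> x u v w =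
     dir_deriv u (\<lambda>y. bil \<Gamma> y v w) x - dir_deriv v (\<lambda>y. bil \<Gamma> y u w) x
       + bil \<Gamma> x u (bil \<Gamma> x v w) - bil \<Gamma> x v (bil \<Gamma> x u w)"

text \<open>
  The torsion-free metric connection of \<open>g\<close> on \<open>M\<close>. A field on \<open>M\<close> is extended by \<open>0\<close> outside
  \<open>M\<close>, so that it is a unique function. Smoothness of \<open>\<Gamma>\<close> need not be required: the other conditions
  determine \<open>\<Gamma>\<close> pointwise by the Koszul formula. (Existence and uniqueness for the metric used here
  are proved below.)
\<close>

definition is_levi_civita :: "(real^'n) set \<Rightarrow> 'n::finite metric_field \<Rightarrow> 'n bilinear_field \<Rightarrow> bool" where
  "is_levi_civita M g \<Gamma> \<longleftrightarrow>
     (\<forall>x\<in>M. \<forall>u v. bil \<Gamma> x u v = bil \<Gamma> x v u) \<and>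
     (\<forall>x\<in>M. \<forall>u v w. nabla_metric \<Gamma> g x u v w = 0) \<and>
     (\<forall>x. x \<notin> M \<longrightarrow> \<Gamma> x = 0)"

definition levi_civita :: "(real^'n) set \<Rightarrow> 'n::finite metric_field \<Rightarrow> 'n bilinear_field" where
  "levi_civita M g = (THE \<Gamma>. is_levi_civita M g \<Gamma>)"

definition ricci :: "'n::finite bilinear_field \<Rightarrow> real^'n \<Rightarrow> real^'n \<Rightarrow> real^'n \<Rightarrow> real" where
  "ricci \<Gamma> x v w = (\<Sum>i\<in>UNIV. curvature \<Gamma> x (axis i 1) v w $ i)"

definition scalar_curvature :: "(real^'n) set \<Rightarrow> 'n::finite metric_field \<Rightarrow> real^'n \<Rightarrow> real" where
  "scalar_curvature M g x =
     (\<Sum>i\<in>UNIV. \<Sum>j\<in>UNIV. matrix_inv (\<chi> i j. g x (axis i 1) (axis j 1)) $ i $ j *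
        ricci (levi_civita M g) x (axis i 1) (axis j 1))"

section \<open>Homogeneous tensors and isomorphism\<close>

definition homogeneous_tensor :: "(real^'n) set \<Rightarrow> 'n::finite metric_field \<Rightarrow> 'n bilinear_field \<Rightarrow> bool" where
  "homogeneous_tensor M g S \<longleftrightarrow>
     smooth_on M S \<and> (\<forall>x. x \<notin> M \<longrightarrow> S x = 0) \<and>
     (let \<Gamma> = levi_civita M g; \<Gamma>' = (\<lambda>x. \<Gamma> x - S x)
      in \<forall>x\<in>M. \<forall>u v w z.
           nabla_metric \<Gamma>' g x u v w = 0 \<and>
           nabla_curvature \<Gamma>' (curvature \<Gamma>) x u v w z = 0 \<and>
           nabla_bilinear \<Gamma>' S x u v w = 0)"

definition riemannian_isometry :: "(real^'n) set \<Rightarrow> 'n::finite metric_field \<Rightarrow> (real^'n \<Rightarrow> real^'n) \<Rightarrow> bool" where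
  "riemannian_isometry M g f \<longleftrightarrow>
     bij_betw f M M \<and> smooth_on M f \<and> smooth_on M (inv_into M f) \<and>
     (\<forall>x\<in>M. \<forall>u v. g (f x) (dir_deriv u f x) (dir_deriv v f x) = g x u v)"

definition carries :: "(real^'n) set \<Rightarrow> (real^'n \<Rightarrow> real^'n) \<Rightarrow> 'n::finite bilinear_field \<Rightarrow> 'n bilinear_field \<Rightarrow> bool" where
  "carries M f S S' \<longleftrightarrow>
     (\<forall>x\<in>M. \<forall>u v. bil S' (f x) (dir_deriv u f x) (dir_deriv v f x) = dir_deriv (bil S x u v) f x)"

definition isomorphism_rel ::
    "(real^'n) set \<Rightarrow> 'n::finite metric_field \<Rightarrow> ('n bilinear_field \<times> 'n bilinear_field) set" where
  "isomorphism_rel M g =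
     {(S, S'). homogeneous_tensor M g S \<and> homogeneous_tensor M g S' \<and>
        (\<exists>f. riemannian_isometry M g f \<and> carries M f S S')}"

section \<open>The moduli space\<close>

definition quotient_topology :: "'a topology \<Rightarrow> ('a \<Rightarrow> 'b) \<Rightarrow> 'b topology" where
  "quotient_topology X q =
     topology (\<lambda>U. U \<subseteq> q ` topspace X \<and> openin X {x \<in> topspace X. q x \<in> U})"

lemma openin_quotient_topology:
  "openin (quotient_topology X q) U \<longleftrightarrow>
     U \<subseteq> q ` topspace X \<and> openin X {x \<in> topspace X. q x \<in> U}"
proof -
  have "istopology (\<lambda>U. U \<subseteq> q ` topspace X \<and> openin X {x \<in> topspace X. q x \<in> U})"
    unfolding istopology_def
  proof (intro conjI allI impI)
    fix S T
    assume "S \<subseteq> q ` topspace X \<and> openin X {x \<in> topspace X. q x \<in> S}"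
      and "T \<subseteq> q ` topspace X \<and> openin X {x \<in> topspace X. q x \<in> T}"
    moreover have "{x \<in> topspace X. q x \<in> S \<inter> T} =
        {x \<in> topspace X. q x \<in> S} \<inter> {x \<in> topspace X. q x \<in> T}" by blast
    ultimately show "S \<inter> T \<subseteq> q ` topspace X" "openin X {x \<in> topspace X. q x \<in> S \<inter> T}"
      by auto
  next
    fix K
    assume K: "\<forall>U\<in>K. U \<subseteq> q ` topspace X \<and> openin X {x \<in> topspace X. q x \<in> U}"
    then show "\<Union>K \<subseteq> q ` topspace X" by blast
    have "{x \<in> topspace X. q x \<in> \<Union>K} = (\<Union>U\<in>K. {x \<in> topspace X. q x \<in> U})" by blast
    then show "openin X {x \<in> topspace X. q x \<in> \<Union>K}" using K by auto
  qed
  then show ?thesis by (simp add: quotient_topology_def)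
qed

lemma quotient_map_quotient_topology: "quotient_map X (quotient_topology X q) q"
proof -
  have "{x \<in> topspace X. q x \<in> q ` topspace X} = topspace X" by blast
  then have "openin (quotient_topology X q) (q ` topspace X)"
    by (simp add: openin_quotient_topology)
  moreover have "topspace (quotient_topology X q) \<subseteq> q ` topspace X"
    using openin_topspace[of "quotient_topology X q"] unfolding openin_quotient_topology by blast
  ultimately have "topspace (quotient_topology X q) = q ` topspace X"
    using openin_subset by blast
  then show ?thesis
    by (auto simp: quotient_map_def openin_quotient_topology)
qed

text \<open>
  Homogeneous tensors with the topology induced by \<open>S \<mapsto> S\<^sub>p\<close> from the finite-dimensional space of
  bilinear maps on \<open>\<real>\<^sup>n = T\<^sub>p\<close> (its norm topology), and then the quotient by isomorphism; the points
  of the moduli space are the isomorphism classes.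
\<close>

definition homogeneous_tensor_topology ::
    "(real^'n) set \<Rightarrow> 'n::finite metric_field \<Rightarrow> real^'n \<Rightarrow> 'n bilinear_field topology" where
  "homogeneous_tensor_topology M g p =
     pullback_topology {S. homogeneous_tensor M g S} (\<lambda>S. S p) euclidean"

definition moduli_space ::
    "(real^'n) set \<Rightarrow> 'n::finite metric_field \<Rightarrow> real^'n \<Rightarrow> 'n bilinear_field set topology" where
  "moduli_space M g p =
     quotient_topology (homogeneous_tensor_topology M g p) (\<lambda>S. isomorphism_rel M g `` {S})"

section \<open>Real hyperbolic space\<close>

text \<open>
  The Poincare ball with the metric of constant sectional curvature \<open>k = s / (n (n - 1))\<close>, hence of
  scalar curvature \<open>s\<close> (proved below).
\<close>

definition RH :: "(real^'n::finite) set" where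
  "RH = ball 0 1"

definition hyperbolic_metric :: "real \<Rightarrow> 'n::finite metric_field" where
  "hyperbolic_metric s x u v =
     - (real CARD('n) * (real CARD('n) - 1) / s) * (4 / (1 - (norm x)\<^sup>2)\<^sup>2) * (u \<bullet> v)"

subsection \<open>Its Levi-Civita connection and scalar curvature\<close>

definition ball_christoffel :: "real^'n \<Rightarrow> real^'n \<Rightarrow> real^'n \<Rightarrow> real^'n::finite" where
  "ball_christoffel x u v =
     (2 / (1 - x \<bullet> x)) *\<^sub>R ((x \<bullet> u) *\<^sub>R v + (x \<bullet> v) *\<^sub>R u - (u \<bullet> v) *\<^sub>R x)"

definition ball_connection :: "'n::finite bilinear_field" where
  "ball_connection x = (if x \<in> RH then Blinfun (\<lambda>u. Blinfun (ball_christoffel x u)) else 0)"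

lemma RH_pos: "x \<in> RH \<Longrightarrow> 0 < 1 - x \<bullet> x"
  by (simp add: RH_def norm_eq_sqrt_inner)

lemma open_RH: "open RH"
  by (simp add: RH_def)

lemma bil_ball_connection:
  assumes "x \<in> RH"
  shows "bil ball_connection x u v = ball_christoffel x u v"
proof -
  have 1: "bounded_linear (ball_christoffel x u)" for u
    by (rule linear_conv_bounded_linear[THEN iffD1], rule linearI)
       (simp_all add: ball_christoffel_def algebra_simps inner_right_distrib)
  have 2: "bounded_linear (\<lambda>u. Blinfun (ball_christoffel x u))"
    by (rule linear_conv_bounded_linear[THEN iffD1], rule linearI; rule blinfun_eqI)
       (simp_all add: bounded_linear_Blinfun_apply[OF 1] plus_blinfun.rep_eq scaleR_blinfun.rep_eq,
        simp_all add: ball_christoffel_def algebra_simps inner_left_distrib)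
  show ?thesis
    using assms by (simp add: ball_connection_def bounded_linear_Blinfun_apply[OF 1]
        bounded_linear_Blinfun_apply[OF 2])
qed

lemma dir_deriv_eqI: "(f has_derivative f') (at x) \<Longrightarrow> dir_deriv u f x = f' u"
  by (simp add: dir_deriv_def frechet_derivative_at[symmetric])

lemma has_derivative_conformal_factor:
  fixes x :: "real^'n::finite"
  assumes "x \<in> RH"
  shows "((\<lambda>y. 2 / (1 - y \<bullet> y)) has_derivative (\<lambda>h. (2 / (1 - x \<bullet> x))\<^sup>2 * (x \<bullet> h))) (at x)"
proof -
  have nz: "1 - x \<bullet> x \<noteq> 0" using RH_pos[OF assms] by simp
  have 1: "((\<lambda>y. 1 - y \<bullet> y) has_derivative (\<lambda>h. - (2 * (x \<bullet> h)))) (at x)"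
    by (auto intro!: derivative_eq_intros simp: inner_commute)
  show ?thesis
    using has_derivative_divide[OF has_derivative_const 1 nz, of 2]
    by (rule back_subst) (simp add: fun_eq_iff power2_eq_square divide_inverse mult_ac)
qed

lemma dir_deriv_hyperbolic_metric:
  fixes x :: "real^'n::finite"
  assumes "x \<in> RH"
  shows "dir_deriv u (\<lambda>y. hyperbolic_metric s y v w) x =
    hyperbolic_metric s x v w * (2 * (2 / (1 - x \<bullet> x)) * (x \<bullet> u))"
proof -
  define K where "K = - (real CARD('n) * (real CARD('n) - 1) / s) * (v \<bullet> w)"
  have g: "hyperbolic_metric s y v w = K * (2 / (1 - y \<bullet> y))\<^sup>2" for y :: "real^'n"
    by (simp add: hyperbolic_metric_def K_def power2_norm_eq_inner power_divide)
  have "((\<lambda>y. K * (2 / (1 - y \<bullet> y))\<^sup>2) has_derivative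
      (\<lambda>h. K * (2 * ((2 / (1 - x \<bullet> x))\<^sup>2 * (x \<bullet> h)) * (2 / (1 - x \<bullet> x))))) (at x)"
    by (rule has_derivative_mult_right, rule has_derivative_eq_rhs[OF
          has_derivative_power[OF has_derivative_conformal_factor[OF assms], of 2]])
       (simp add: fun_eq_iff)
  from dir_deriv_eqI[OF this] show ?thesis
    unfolding g by (simp only: power2_eq_square mult_ac)
qed

lemma is_levi_civita_ball_connection:
  "is_levi_civita RH (hyperbolic_metric s) (ball_connection :: 'n::finite bilinear_field)"
  unfolding is_levi_civita_def
proof (intro conjI ballI allI impI)
  fix x u v w :: "real^'n"
  assume x: "x \<in> RH"
  show "bil ball_connection x u v = bil ball_connection x v u"
    by (simp add: bil_ball_connection[OF x] ball_christoffel_def inner_commute algebra_simps)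
  define c where "c = - (real CARD('n) * (real CARD('n) - 1) / s) * (4 / (1 - (norm x)\<^sup>2)\<^sup>2)"
  have g: "hyperbolic_metric s x u v = c * (u \<bullet> v)" for u v
    by (simp add: hyperbolic_metric_def c_def)
  define t where "t = 2 / (1 - x \<bullet> x)"
  show "nabla_metric ball_connection (hyperbolic_metric s) x u v w = 0"
    unfolding nabla_metric_def dir_deriv_hyperbolic_metric[OF x] bil_ball_connection[OF x]
      ball_christoffel_def t_def[symmetric] g
    by (simp add: inner_add_left inner_add_right inner_diff_left inner_diff_right
        inner_commute algebra_simps)
next
  fix x :: "real^'n"
  assume "x \<notin> RH"
  then show "ball_connection x = 0" by (simp add: ball_connection_def)
qed

lemma is_levi_civita_unique:
  fixes \<Gamma> \<Gamma>' :: "'n::finite bilinear_field"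
  assumes "is_levi_civita RH (hyperbolic_metric s) \<Gamma>" "is_levi_civita RH (hyperbolic_metric s) \<Gamma>'"
    and n: "CARD('n) > 1" and s: "s < 0"
  shows "\<Gamma> = \<Gamma>'"
proof
  fix x
  show "\<Gamma> x = \<Gamma>' x"
  proof (cases "x \<in> RH")
    case False
    then show ?thesis using assms(1,2) by (simp add: is_levi_civita_def)
  next
    case x: True
    define c where "c = - (real CARD('n) * (real CARD('n) - 1) / s) * (4 / (1 - (norm x)\<^sup>2)\<^sup>2)"
    have c: "c \<noteq> 0"
      using n s RH_pos[OF x] by (simp add: c_def power2_norm_eq_inner)
    have g: "hyperbolic_metric s x u v = c * (u \<bullet> v)" for u v
      by (simp add: hyperbolic_metric_def c_def)
    define A where "A u v = bil \<Gamma> x u v - bil \<Gamma>' x u v" for u v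
    have sym: "A u v = A v u" for u v
      using assms(1,2) x unfolding is_levi_civita_def A_def by metis
    have "c * (A u v \<bullet> w + v \<bullet> A u w) = 0" for u v w
    proof -
      have "nabla_metric \<Gamma> (hyperbolic_metric s) x u v w = 0"
        "nabla_metric \<Gamma>' (hyperbolic_metric s) x u v w = 0"
        using assms(1,2) x by (auto simp: is_levi_civita_def)
      then show ?thesis
        by (simp add: nabla_metric_def g A_def inner_simps algebra_simps)
    qed
    then have skew: "A u v \<bullet> w = - (A u w \<bullet> v)" for u v w
      using c by (metis add.inverse_unique add.commute inner_commute mult_eq_0_iff)
    have "A u v \<bullet> w = 0" for u v w
    proof -
      have "A u v \<bullet> w = - (A w u \<bullet> v)" "A w u \<bullet> v = - (A v w \<bullet> u)" "A v w \<bullet> u = - (A u v \<bullet> w)"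
        by (subst skew, subst sym, rule refl)+
      then show ?thesis by linarith
    qed
    then have "A u v = 0" for u v
      using inner_eq_zero_iff by blast
    then show ?thesis
      by (auto intro!: blinfun_eqI simp: A_def)
  qed
qed

lemma levi_civita_RH:
  assumes "CARD('n) > 1" "s < 0"
  shows "levi_civita RH (hyperbolic_metric s) = (ball_connection :: 'n::finite bilinear_field)"
  unfolding levi_civita_def
  using is_levi_civita_ball_connection is_levi_civita_unique assms by (intro the_equality) blast+

lemma dir_deriv_ball_connection:
  fixes x :: "real^'n::finite"
  assumes x: "x \<in> RH"
  shows "dir_deriv w (\<lambda>y. bil ball_connection y u v) x =
    (4 * (x \<bullet> w) / (1 - x \<bullet> x)\<^sup>2) *\<^sub>R ((x \<bullet> u) *\<^sub>R v + (x \<bullet> v) *\<^sub>R u - (u \<bullet> v) *\<^sub>R x) +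
    (2 / (1 - x \<bullet> x)) *\<^sub>R ((w \<bullet> u) *\<^sub>R v + (w \<bullet> v) *\<^sub>R u - (u \<bullet> v) *\<^sub>R w)"
proof -
  have 1: "((\<lambda>y. 2 / (1 - y \<bullet> y)) has_derivative (\<lambda>h. 4 * (x \<bullet> h) / (1 - x \<bullet> x)\<^sup>2)) (at x)"
    using has_derivative_conformal_factor[OF x] by (simp add: power_divide)
  have 2: "((\<lambda>y. (y \<bullet> u) *\<^sub>R v + (y \<bullet> v) *\<^sub>R u - (u \<bullet> v) *\<^sub>R y) has_derivative
      (\<lambda>h. (h \<bullet> u) *\<^sub>R v + (h \<bullet> v) *\<^sub>R u - (u \<bullet> v) *\<^sub>R h)) (at x)"
    by (auto intro!: derivative_eq_intros)
  have "((\<lambda>y. ball_christoffel y u v) has_derivative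
      (\<lambda>w. (2 / (1 - x \<bullet> x)) *\<^sub>R ((w \<bullet> u) *\<^sub>R v + (w \<bullet> v) *\<^sub>R u - (u \<bullet> v) *\<^sub>R w) +
        (4 * (x \<bullet> w) / (1 - x \<bullet> x)\<^sup>2) *\<^sub>R ((x \<bullet> u) *\<^sub>R v + (x \<bullet> v) *\<^sub>R u - (u \<bullet> v) *\<^sub>R x))) (at x)"
    unfolding ball_christoffel_def by (rule has_derivative_scaleR[OF 1 2])
  then have "((\<lambda>y. bil ball_connection y u v) has_derivative
      (\<lambda>w. (2 / (1 - x \<bullet> x)) *\<^sub>R ((w \<bullet> u) *\<^sub>R v + (w \<bullet> v) *\<^sub>R u - (u \<bullet> v) *\<^sub>R w) +
        (4 * (x \<bullet> w) / (1 - x \<bullet> x)\<^sup>2) *\<^sub>R ((x \<bullet> u) *\<^sub>R v + (x \<bullet> v) *\<^sub>R u - (u \<bullet> v) *\<^sub>R x))) (at x)"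
    by (rule has_derivative_transform_within_open[OF _ open_RH x]) (simp add: bil_ball_connection)
  from dir_deriv_eqI[OF this] show ?thesis by simp
qed

lemma curvature_ball_connection:
  fixes x :: "real^'n::finite"
  assumes x: "x \<in> RH"
  shows "curvature ball_connection x u v w =
    - (4 / (1 - x \<bullet> x)\<^sup>2) *\<^sub>R ((v \<bullet> w) *\<^sub>R u - (u \<bullet> w) *\<^sub>R v)"
proof -
  have nz: "1 - x \<bullet> x \<noteq> 0" using RH_pos[OF x] by simp
  define t where "t = 2 / (1 - x \<bullet> x)"
  have t1: "t * (1 - x \<bullet> x) = 2" using nz by (simp add: t_def field_simps)
  have t2: "t * (x \<bullet> x) = t - 2" using t1 by (simp add: algebra_simps)
  have e1: "4 * a / (1 - x \<bullet> x)\<^sup>2 = t * t * a" for a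
    by (simp add: t_def power2_eq_square)
  have e2: "4 / (1 - x \<bullet> x)\<^sup>2 = t * t"
    by (simp add: t_def power2_eq_square)
  show ?thesis
  proof (rule vec_eq_iff[THEN iffD2], rule allI)
    fix i
    show "curvature ball_connection x u v w $ i =
      (- (4 / (1 - x \<bullet> x)\<^sup>2) *\<^sub>R ((v \<bullet> w) *\<^sub>R u - (u \<bullet> w) *\<^sub>R v)) $ i"
      unfolding curvature_def dir_deriv_ball_connection[OF x] bil_ball_connection[OF x]
        ball_christoffel_def e1 e2 t_def[symmetric]
      apply (simp add: inner_simps inner_commute)
      using t2 by algebra
  qed
qed

lemma scalar_curvature_RH:
  assumes n: "CARD('n) > 1" and s: "s < 0" and x: "x \<in> (RH :: (real^'n::finite) set)"
  shows "scalar_curvature RH (hyperbolic_metric s) x = s"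
proof -
  have nz: "1 - x \<bullet> x \<noteq> 0" using RH_pos[OF x] by simp
  let ?n = "real CARD('n)"
  define t where "t = 4 / (1 - x \<bullet> x)\<^sup>2"
  have t: "t \<noteq> 0" using nz by (simp add: t_def field_simps)
  define c where "c = - (?n * (?n - 1) / s) * t"
  have c: "c \<noteq> 0" using n s t by (simp add: c_def)
  have ric: "ricci ball_connection x v w = - t * (?n - 1) * (v \<bullet> w)" for v w
  proof -
    have "ricci ball_connection x v w =
        (\<Sum>i\<in>UNIV. - t * ((v \<bullet> w) - w $ i * v $ i))"
      unfolding ricci_def curvature_ball_connection[OF x] t_def[symmetric]
      by (rule sum.cong) (simp_all add: inner_axis inner_commute)
    also have "\<dots> = - t * (\<Sum>i\<in>UNIV. (v \<bullet> w) - w $ i * v $ i)"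
      by (simp only: sum_distrib_left)
    also have "(\<Sum>i\<in>UNIV. (v \<bullet> w) - w $ i * v $ i) = ?n * (v \<bullet> w) - w \<bullet> v"
      by (simp add: sum_subtractf inner_vec_def)
    finally show ?thesis by (simp add: algebra_simps inner_commute)
  qed
  have G: "(\<chi> i j. hyperbolic_metric s x (axis i 1) (axis j 1)) = (mat c :: real^'n^'n)"
    by (simp add: mat_def vec_eq_iff hyperbolic_metric_def c_def t_def power2_norm_eq_inner
        inner_axis_axis)
  have inv: "matrix_inv (mat c :: real^'n^'n) = mat (inverse c)"
  proof -
    have mat: "(mat a :: real^'n^'n) ** mat b = mat (a * b)" for a b
    proof -
      have "(\<Sum>k\<in>UNIV. (if i = k then a else 0) * (if k = j then b else 0)) =
          (\<Sum>k\<in>UNIV. if i = k then a * (if k = j then b else 0) else 0)" for i j :: 'n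
        by (rule sum.cong) auto
      then show ?thesis
        by (simp add: matrix_matrix_mult_def mat_def vec_eq_iff)
    qed
    have "matrix_inv (mat c :: real^'n^'n) ** mat c = mat 1"
      unfolding matrix_inv_def
      by (rule someI2[where a = "mat (inverse c)"]) (use c in \<open>auto simp: mat\<close>)
    moreover have "(mat c :: real^'n^'n) ** mat (inverse c) = mat 1"
      using c by (simp add: mat)
    ultimately show ?thesis by (metis matrix_mul_assoc matrix_mul_lid matrix_mul_rid)
  qed
  have "scalar_curvature RH (hyperbolic_metric s) x =
      (\<Sum>i\<in>(UNIV::'n set). \<Sum>j\<in>(UNIV::'n set).
        if i = j then inverse c * (- t * (?n - 1)) else 0)"
    unfolding scalar_curvature_def levi_civita_RH[OF n s] G inv ric
    by (intro sum.cong refl) (simp add: inner_axis_axis mat_def)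
  also have "\<dots> = ?n * (inverse c * (- t * (?n - 1)))"
    by simp
  also have "\<dots> = s"
    using n s t by (simp add: c_def field_simps)
  finally show ?thesis .
qed

end

(*
  Rescaled to an orthonormal frame at a point, a homogeneous tensor S becomes a linear map T from
  R^n to so(n), and the Ambrose-Singer equations say that T is parallel for D + Om T. Symmetry of
  second derivatives (the Ricci identity) then makes the pairs (Y, K - T Y), with K in the
  stabilizer of T, a subalgebra G of so(n,1) which projects onto R^n. Extremizing the invariant form
  on the orthogonal complement of the isotropy algebra gives a homogeneous geodesic, that is, an
  element (X, A) of G with A X = 0 and X nonzero; where that form vanishes identically, the trace
  vector of the resulting simply transitive solvable algebra serves as X. The element (X, A) is
  normal, so G is graded by the eigenvalues -1, 0, 1 of (X, 0). If both extreme eigenspaces are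
  nonzero, the stabilizer is all of so(n); otherwise G fixes a point at infinity. Accordingly the
  trace of T is 0 or has norm n - 1, which splits the moduli space into two open pieces. Tensors of
  the first kind are contracted to 0 by scaling. Those of the second kind are deformed in two steps
  to wedge xi, where xi is the unit field pointing to a boundary point b, and these are joined by
  moving b in the sphere.
*)

theory Submission
  imports Defs
begin

section \<open>Linear algebra: so(n), normal operators, symmetric forms\<close>

section \<open>Skew-symmetric matrices\<close>

text \<open>The obstacle is that the algebra G need not be invariant under the Cartan involution (Y,
  A) -> (- Y, A) of so(n,1). The geodesic element (X, A) compensates for this. Because A X = 0, its
  parts (X, 0) and (0, A) commute; they act symmetrically and skew-symmetrically for the positive
  definite product 2 Y \<bullet> Z + A \<bullet> B. An invariant subspace of a normal operator is
  invariant under the adjoint, so (X, 0) normalizes G whether or not it lies in G. The constant n -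
  1 comes from the model tensor \<open>wedge \<xi>\<close>, whose trace is (n - 1) \<xi>; the rest
  of T is forced to be traceless. All deformations rest on one principle: T may be replaced by a
  field T' that is parallel for the connection of T, provided that T - T' takes values in the
  stabilizer of T'. The second kind takes two steps because T \<xi> need not stabilize T, but it
  does stabilize what is left once the part of T transverse to \<xi> has been replaced by
  \<open>wedge \<xi>\<close>. The equation for R adds nothing to metricity, since R is built from
  the metric alone.\<close>

definition skew :: "real^'n^'n \<Rightarrow> bool" where
  "skew A \<longleftrightarrow> transpose A = - A"

definition wedge :: "real^'n \<Rightarrow> real^'n \<Rightarrow> real^'n^'n" where
  "wedge Y Z = (\<chi> i j. Y $ i * Z $ j - Z $ i * Y $ j)"

definition comm :: "real^'n^'n \<Rightarrow> real^'n^'n \<Rightarrow> real^'n^'n" where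
  "comm A B = A ** B - B ** A"

lemma wedge_apply: "wedge Y Z *v v = (Z \<bullet> v) *\<^sub>R Y - (Y \<bullet> v) *\<^sub>R Z" for v :: "real^'n::finite"
  by (simp add: vec_eq_iff wedge_def matrix_vector_mult_def inner_vec_def left_diff_distrib right_diff_distrib
      sum_subtractf sum_distrib_left sum_distrib_right mult_ac)

lemma mat_uminus_apply: "(- A) *v v = - (A *v v)" for A :: "real^'n^'n"
  by (simp add: vec_eq_iff matrix_vector_mult_def sum_negf)

lemma mat_apply_uminus: "A *v (- v) = - (A *v v)" for A :: "real^'n^'n"
  by (simp add: vec_eq_iff matrix_vector_mult_def sum_negf)

lemma comm_apply: "comm A B *v v = A *v (B *v v) - B *v (A *v v)"
  by (simp add: comm_def algebra_simps matrix_vector_mul_assoc)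

lemma mat_sum_apply: "(\<Sum>i\<in>I. f i) *v v = (\<Sum>i\<in>I. f i *v v)" for f :: "'i \<Rightarrow> real^'n^'n"
  by (induction I rule: infinite_finite_induct) (simp_all add: algebra_simps)

lemma mat_apply_sum: "A *v (\<Sum>i\<in>I. f i) = (\<Sum>i\<in>I. A *v f i)" for A :: "real^'n^'n"
  by (induction I rule: infinite_finite_induct) (simp_all add: algebra_simps)

lemmas mat_simps = wedge_apply mat_uminus_apply mat_apply_uminus comm_apply
  scaleR_matrix_vector_assoc[symmetric]

lemma mat_eqI: "(\<And>v. A *v v = B *v v) \<Longrightarrow> A = B" for A B :: "real^'n^'n"
  by (simp add: matrix_eq)

lemma skew_inner: "skew A \<Longrightarrow> (A *v u) \<bullet> v = - (u \<bullet> (A *v v))" for A :: "real^'n::finite^'n"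
  by (metis dot_lmul_matrix mat_uminus_apply skew_def transpose_matrix_vector inner_minus_left
      minus_minus)

lemma skew_inner_self: "skew A \<Longrightarrow> (A *v u) \<bullet> u = 0" for A :: "real^'n::finite^'n"
  using skew_inner[of A u u] by (simp add: inner_commute)

lemma skewI:
  fixes A :: "real^'n::finite^'n"
  assumes "\<And>u v. (A *v u) \<bullet> v = - (u \<bullet> (A *v v))"
  shows "skew A"
proof -
  have "transpose A *v v = (- A) *v v" for v
  proof (rule vector_eq_rdot[THEN iffD1], rule allI)
    fix u
    show "(transpose A *v v) \<bullet> u = ((- A) *v v) \<bullet> u"
      using assms[of v u] by (simp add: dot_lmul_matrix mat_uminus_apply)
  qed
  then show ?thesis by (auto simp: skew_def intro: mat_eqI)
qed

lemma skew_wedge [simp]: "skew (wedge Y Z)"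
  by (simp add: skew_def wedge_def transpose_def vec_eq_iff)

lemma skew_comm: "skew A \<Longrightarrow> skew B \<Longrightarrow> skew (comm A B)" for A B :: "real^'n::finite^'n"
  by (rule skewI) (simp add: comm_apply inner_diff_left inner_diff_right skew_inner)

lemma skew_add: "skew A \<Longrightarrow> skew B \<Longrightarrow> skew (A + B)"
  and skew_diff: "skew A \<Longrightarrow> skew B \<Longrightarrow> skew (A - B)"
  and skew_uminus: "skew A \<Longrightarrow> skew (- A)"
  and skew_scaleR: "skew A \<Longrightarrow> skew (c *\<^sub>R A)"
  and skew_0 [simp]: "skew 0"
  for A B :: "real^'n::finite^'n"
  by (rule skewI, simp add: mat_simps algebra_simps inner_simps skew_inner)+

lemma linear_wedge: "linear (wedge Y)" "linear (\<lambda>Y. wedge Y Z)" for Y Z :: "real^'n::finite"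
  by (rule linearI; rule mat_eqI; simp add: mat_simps algebra_simps inner_simps)+

lemma comm_wedge:
  fixes A :: "real^'n::finite^'n"
  assumes "skew A"
  shows "comm A (wedge Y Z) = wedge (A *v Y) Z + wedge Y (A *v Z)"
  by (rule mat_eqI) (simp add: mat_simps algebra_simps inner_simps skew_inner[OF assms])

lemma inner_matrix_columns:
  "A \<bullet> B = (\<Sum>i\<in>UNIV. (A *v axis i 1) \<bullet> (B *v axis i 1))" for A B :: "real^'n::finite^'n"
  unfolding inner_vec_def matrix_vector_mult_basis column_def
  by (simp, rule sum.swap)

lemma axis_expansion: "(\<Sum>i\<in>UNIV. (v $ i) *\<^sub>R axis i 1) = v" for v :: "real^'n::finite"
  using basis_expansion[of v] by (simp add: scalar_mult_eq_scaleR)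

lemma linear_axis_expansion:
  "linear f \<Longrightarrow> f v = (\<Sum>i\<in>UNIV. (v $ i) *\<^sub>R f (axis i 1))" for v :: "real^'n::finite"
  by (subst axis_expansion[of v, symmetric]) (simp add: linear_sum linear_scale)

lemma inner_axis_sum:
  "(\<Sum>i\<in>UNIV. (u \<bullet> axis i 1) *\<^sub>R axis i 1) = u" for u :: "real^'n::finite"
  by (simp add: inner_axis axis_expansion)

text \<open>The Frobenius product counts each pair of opposite entries twice, hence the factor 2.
  The same factor reappears in \<open>form\<close>.\<close>

lemma inner_wedge_skew:
  fixes C :: "real^'n::finite^'n"
  assumes "skew C"
  shows "wedge X Y \<bullet> C = 2 * (X \<bullet> (C *v Y))"
proof -
  have "wedge X Y \<bullet> C =
      (\<Sum>i\<in>UNIV. Y $ i *\<^sub>R (X \<bullet> (C *v axis i 1)) - X $ i *\<^sub>R (Y \<bullet> (C *v axis i 1)))"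
    unfolding inner_matrix_columns by (simp add: wedge_apply inner_axis inner_diff_left)
  also have "\<dots> = X \<bullet> (C *v Y) - Y \<bullet> (C *v X)"
    by (simp add: sum_subtractf linear_axis_expansion[of "\<lambda>Y. C *v Y" Y]
        linear_axis_expansion[of "\<lambda>Y. C *v Y" X] inner_sum_right)
  finally show ?thesis using skew_inner[OF assms, of Y X] by (simp add: inner_commute)
qed

lemma inner_matrix_mul:
  fixes A B C :: "real^'n::finite^'n"
  shows "(A ** B) \<bullet> C = B \<bullet> (transpose A ** C)" "(A ** B) \<bullet> C = A \<bullet> (C ** transpose B)"
proof -
  have 1: "(A ** B) \<bullet> C = (\<Sum>i\<in>UNIV. \<Sum>j\<in>UNIV. \<Sum>k\<in>UNIV. A $ i $ k * B $ k $ j * C $ i $ j)"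
    by (simp add: inner_vec_def matrix_matrix_mult_def sum_distrib_right)
  have "B \<bullet> (transpose A ** C) = (\<Sum>k\<in>UNIV. \<Sum>j\<in>UNIV. \<Sum>i\<in>UNIV. A $ i $ k * B $ k $ j * C $ i $ j)"
    by (simp add: inner_vec_def matrix_matrix_mult_def transpose_def sum_distrib_left mult_ac)
  also have "\<dots> = (\<Sum>j\<in>UNIV. \<Sum>k\<in>UNIV. \<Sum>i\<in>UNIV. A $ i $ k * B $ k $ j * C $ i $ j)"
    by (rule sum.swap)
  also have "\<dots> = (\<Sum>j\<in>UNIV. \<Sum>i\<in>UNIV. \<Sum>k\<in>UNIV. A $ i $ k * B $ k $ j * C $ i $ j)"
    by (rule sum.cong[OF refl], rule sum.swap)
  also have "\<dots> = (A ** B) \<bullet> C" unfolding 1 by (rule sum.swap)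
  finally show "(A ** B) \<bullet> C = B \<bullet> (transpose A ** C)" by simp
  have "A \<bullet> (C ** transpose B) = (\<Sum>i\<in>UNIV. \<Sum>k\<in>UNIV. \<Sum>j\<in>UNIV. A $ i $ k * B $ k $ j * C $ i $ j)"
    by (simp add: inner_vec_def matrix_matrix_mult_def transpose_def sum_distrib_left mult_ac)
  also have "\<dots> = (A ** B) \<bullet> C" unfolding 1 by (rule sum.cong[OF refl], rule sum.swap)
  finally show "(A ** B) \<bullet> C = A \<bullet> (C ** transpose B)" by simp
qed

lemma mat_mul_uminus: "A ** (- B) = - (A ** B)" "(- A) ** B = - (A ** B)" for A B :: "real^'n::finite^'n"
  by (rule mat_eqI; simp add: mat_simps matrix_vector_mul_assoc[symmetric])+

text \<open>Infinitesimal version of the invariance of the Frobenius product under conjugation by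
  orthogonal matrices.\<close>

lemma inner_comm:
  fixes A B C :: "real^'n::finite^'n"
  assumes "skew A"
  shows "comm A B \<bullet> C = - (B \<bullet> comm A C)"
proof -
  have "(A ** B) \<bullet> C = - (B \<bullet> (A ** C))"
    using inner_matrix_mul(1)[of A B C] assms by (simp add: skew_def mat_mul_uminus)
  moreover have "(B ** A) \<bullet> C = - (B \<bullet> (C ** A))"
    using inner_matrix_mul(2)[of B A C] assms by (simp add: skew_def mat_mul_uminus)
  ultimately show ?thesis by (simp add: comm_def inner_diff_left inner_diff_right)
qed

section \<open>Normal operators\<close>

lemma orthonormal_expansion:
  fixes G :: "'a::euclidean_space set"
  assumes G: "subspace G"
  obtains B where "finite B" "B \<subseteq> G" "span B = G" "\<forall>x. (\<Sum>b\<in>B. (x \<bullet> b) *\<^sub>R b) \<in> G"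
    "\<forall>x. \<forall>y\<in>G. (x - (\<Sum>b\<in>B. (x \<bullet> b) *\<^sub>R b)) \<bullet> y = 0"
proof -
  obtain B where B: "B \<subseteq> G" "pairwise orthogonal B" "\<And>x. x \<in> B \<Longrightarrow> norm x = 1"
    "independent B" "span B = G"
    using orthonormal_basis_subspace[OF G] by metis
  have fin: "finite B" using B(4) independent_imp_finite by blast
  define P where "P x = (\<Sum>b\<in>B. (x \<bullet> b) *\<^sub>R b)" for x
  have PG: "P x \<in> G" for x
    unfolding P_def using B(5) by (intro subspace_sum[OF G] subspace_scale[OF G]) (use B(1) in auto)
  have orth: "b \<bullet> c = (if b = c then 1 else 0)" if "b \<in> B" "c \<in> B" for b c
    using B(2,3) that by (auto simp: pairwise_def orthogonal_def norm_eq_1)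
  have Pb: "P x \<bullet> b = x \<bullet> b" if b: "b \<in> B" for x b
  proof -
    have "P x \<bullet> b = (\<Sum>c\<in>B. if c = b then x \<bullet> b else 0)"
      unfolding P_def inner_sum_left by (rule sum.cong) (use orth b in auto)
    then show ?thesis using b fin by simp
  qed
  have res: "(x - P x) \<bullet> y = 0" if "y \<in> G" for x y
  proof -
    have "y \<in> span B" using that B(5) by simp
    then show ?thesis
      by (induction rule: span_induct_alt) (simp_all add: inner_add_right inner_diff_left Pb)
  qed
  show ?thesis
    using that[OF fin B(1) B(5)] PG res unfolding P_def by blast
qed

text \<open>The compression of \<open>M\<close> to \<open>G\<close> is the transpose of
  \<open>N\<close> on \<open>G\<close>, so both have the same Hilbert-Schmidt norm. By normality the
  vectors \<open>M b\<close>, for \<open>b\<close> in the basis, have that same total norm, which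
  leaves nothing for their components outside \<open>G\<close>.\<close>

lemma normal_operator_invariant_subspace:
  fixes N M :: "'a::euclidean_space \<Rightarrow> 'a"
  assumes G: "subspace G" and N: "\<And>g. g \<in> G \<Longrightarrow> N g \<in> G"
    and adj: "\<And>g h. g \<in> G \<Longrightarrow> h \<in> G \<Longrightarrow> N g \<bullet> h = g \<bullet> M h"
    and normal: "\<And>g. g \<in> G \<Longrightarrow> norm (N g) = norm (M g)"
    and M: "linear M" and g: "g \<in> G"
  shows "M g \<in> G"
proof -
  obtain B where B: "finite B" "B \<subseteq> G" "span B = G" "\<forall>x. (\<Sum>b\<in>B. (x \<bullet> b) *\<^sub>R b) \<in> G"
    "\<forall>x. \<forall>y\<in>G. (x - (\<Sum>b\<in>B. (x \<bullet> b) *\<^sub>R b)) \<bullet> y = 0"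
    using orthonormal_expansion[OF G] by blast
  define P where "P x = (\<Sum>b\<in>B. (x \<bullet> b) *\<^sub>R b)" for x
  have PG: "P x \<in> G" and res: "y \<in> G \<Longrightarrow> (x - P x) \<bullet> y = 0" for x y
    using B(4,5) by (auto simp: P_def)
  have Pb: "P x \<bullet> b = x \<bullet> b" if "b \<in> B" for x b
    using res[of b x] B(2) that by (auto simp: inner_diff_left)
  have nP: "(norm (P x))\<^sup>2 = (\<Sum>b\<in>B. (x \<bullet> b)\<^sup>2)" for x
  proof -
    have "(norm (P x))\<^sup>2 = P x \<bullet> (\<Sum>b\<in>B. (x \<bullet> b) *\<^sub>R b)"
      by (simp add: power2_norm_eq_inner P_def)
    also have "\<dots> = (\<Sum>b\<in>B. (x \<bullet> b)\<^sup>2)"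
      by (simp add: inner_sum_right Pb power2_eq_square)
    finally show ?thesis .
  qed
  have Pyth: "(norm x)\<^sup>2 = (norm (P x))\<^sup>2 + (norm (x - P x))\<^sup>2" for x
    using res[OF PG[of x], of x]
    by (simp add: power2_norm_eq_inner inner_diff_left inner_diff_right inner_commute)
  have PN: "P (N b) = N b" if "b \<in> G" for b
  proof -
    have "(N b - P (N b)) \<bullet> (N b - P (N b)) = 0"
      using res subspace_diff[OF G N[OF that] PG] by blast
    then show ?thesis by simp
  qed
  have "(\<Sum>b\<in>B. (norm (M b - P (M b)))\<^sup>2) = (\<Sum>b\<in>B. (norm (M b))\<^sup>2) - (\<Sum>b\<in>B. (norm (P (M b)))\<^sup>2)"
    unfolding sum_subtractf[symmetric]
    by (rule sum.cong[OF refl]) (metis Pyth add_diff_cancel_left')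
  also have "(\<Sum>b\<in>B. (norm (M b))\<^sup>2) = (\<Sum>b\<in>B. (norm (P (N b)))\<^sup>2)"
    by (rule sum.cong) (use normal PN B(2) in auto)
  also have "\<dots> = (\<Sum>b\<in>B. \<Sum>c\<in>B. (N b \<bullet> c)\<^sup>2)" by (simp only: nP)
  also have "\<dots> = (\<Sum>b\<in>B. \<Sum>c\<in>B. (M c \<bullet> b)\<^sup>2)"
    by (intro sum.cong refl arg_cong[where f = "\<lambda>x. x\<^sup>2"]) (metis adj B(2) inner_commute subsetD)
  also have "\<dots> = (\<Sum>c\<in>B. \<Sum>b\<in>B. (M c \<bullet> b)\<^sup>2)" by (rule sum.swap)
  also have "\<dots> = (\<Sum>b\<in>B. (norm (P (M b)))\<^sup>2)" by (simp only: nP)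
  finally have "(\<Sum>b\<in>B. (norm (M b - P (M b)))\<^sup>2) = 0" by simp
  then have "\<forall>b\<in>B. M b = P (M b)" using B(1) by (simp add: sum_nonneg_eq_0_iff)
  then have MB: "M b \<in> G" if "b \<in> B" for b using that PG by metis
  have "g \<in> span B" using g B(3) by simp
  then show ?thesis
    by (induction rule: span_induct_alt)
       (simp_all add: linear_0[OF M] subspace_0[OF G] linear_add[OF M] linear_scale[OF M]
          subspace_add[OF G] subspace_scale[OF G] MB)
qed

text \<open>A maximum point of the quadratic form on the unit sphere is an eigenvector. Up to a
  change of sign the form is positive somewhere, so the maximum, which is the eigenvalue, is
  nonzero.\<close>

lemma bilinear_form_eigenvector:
  fixes q :: "'a::euclidean_space \<Rightarrow> 'a \<Rightarrow> real"
  assumes q: "bilinear q" and sym: "\<And>x y. q x y = q y x" and nz: "q y y \<noteq> 0"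
  obtains x m where "x \<noteq> 0" "m \<noteq> 0" "\<And>z. q x z = m * (x \<bullet> z)"
proof -
  have pos: "\<exists>x m. x \<noteq> 0 \<and> m \<noteq> 0 \<and> (\<forall>z. f x z = m * (x \<bullet> z))"
    if f: "bilinear f" and symf: "\<And>x y. f x y = f y x" and y: "f y y > 0" for f :: "'a \<Rightarrow> 'a \<Rightarrow> real" and y
  proof -
    have y0: "y \<noteq> 0" using y f by (auto simp: bilinear_lzero)
    have "continuous_on (sphere 0 1) (\<lambda>x. f x x)"
      using f by (intro bounded_bilinear.continuous_on[of f] continuous_on_id)
        (simp add: bilinear_conv_bounded_bilinear)
    moreover have "sgn y \<in> sphere 0 1" using y0 by (simp add: norm_sgn)
    ultimately obtain x where x: "x \<in> sphere 0 1" "\<And>z. z \<in> sphere 0 1 \<Longrightarrow> f z z \<le> f x x"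
      using continuous_attains_sup[of "sphere 0 1" "\<lambda>x. f x x"] by auto
    define m where "m = f x x"
    have xx: "x \<bullet> x = 1" using x(1) by (simp add: norm_eq_1)
    have le: "f z z \<le> m * (z \<bullet> z)" for z
    proof (cases "z = 0")
      case True then show ?thesis using f by (simp add: bilinear_lzero)
    next
      case False
      have "f (sgn z) (sgn z) \<le> m" unfolding m_def using False by (intro x(2)) (simp add: norm_sgn)
      then have "inverse (norm z) * (inverse (norm z) * f z z) \<le> m"
        using f by (simp add: sgn_div_norm bilinear_lmul bilinear_rmul)
      then show ?thesis using False
        by (simp add: field_simps power2_norm_eq_inner[symmetric] power2_eq_square)
    qed
    have "0 < m * (y \<bullet> y)" using le[of y] y by simp
    then have m: "m > 0" using inner_ge_zero[of y] by (auto simp: zero_less_mult_iff)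
    have "f x z = m * (x \<bullet> z)" for z
    proof -
      define c where "c = m * (x \<bullet> z) - f x z"
      define r where "r = m * (z \<bullet> z) - f z z"
      have r: "r \<ge> 0" using le[of z] by (simp add: r_def)
      \<comment> \<open>A test step in direction \<open>z\<close>. With this value the maximality
        bound becomes 0 \<le> - t^2 (r + 2), so \<open>t\<close> and hence \<open>c\<close> vanish;
        the 1 keeps the denominator positive.\<close>
      define t where "t = - c / (r + 1)"
      have tr: "t * (r + 1) = - c" using r by (simp add: t_def)
      have "f (x + t *\<^sub>R z) (x + t *\<^sub>R z) = m + 2 * t * f x z + t * t * f z z"
        using f by (simp add: bilinear_ladd bilinear_radd bilinear_lmul bilinear_rmul m_def symf[of z x]
            algebra_simps)
      moreover have "(x + t *\<^sub>R z) \<bullet> (x + t *\<^sub>R z) = 1 + 2 * t * (x \<bullet> z) + t * t * (z \<bullet> z)"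
        by (simp add: inner_simps xx inner_commute[of z x] algebra_simps)
      ultimately have "0 \<le> 2 * t * c + t * t * r"
        using le[of "x + t *\<^sub>R z"] by (simp add: c_def r_def algebra_simps)
      also have "\<dots> = - (t * t) * (r + 2)"
        using tr by algebra
      finally have "t * t * (r + 2) \<le> 0" by simp
      then have "t = 0" using r by (metis add_nonneg_pos less_le_not_le mult_pos_pos not_square_less_zero
          mult_eq_0_iff not_less_iff_gr_or_eq zero_less_numeral)
      then show ?thesis using tr by (simp add: c_def)
    qed
    then show ?thesis using m x(1) by (intro exI[of _ x] exI[of _ m]) auto
  qed
  show ?thesis
  proof (cases "q y y > 0")
    case True
    then show ?thesis using pos[OF q sym] that by metis
  next
    case False
    have "bilinear (\<lambda>x y. - q x y)"
      using q by (auto simp: bilinear_def linear_iff)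
    moreover have "- q y y > 0" using False nz by simp
    ultimately obtain x m where "x \<noteq> 0" "m \<noteq> 0" "\<forall>z. - q x z = m * (x \<bullet> z)"
      using pos[of "\<lambda>x y. - q x y" y] sym by auto
    then show ?thesis using that[of x "- m"] by (metis minus_minus minus_mult_left neg_equal_0_iff_equal)
  qed
qed

section \<open>Lie algebra: subalgebras of so(n,1) that project onto the vector part\<close>

section \<open>Infinitesimal models over hyperbolic space\<close>

definition stab :: "(real^'n \<Rightarrow> real^'n^'n) \<Rightarrow> (real^'n^'n) set" where
  "stab T = {A. skew A \<and> (\<forall>v. comm A (T v) = T (A *v v))}"

text \<open>Minus the curvature of the connection with torsion defined by \<open>T\<close> over a
  space of sectional curvature -1, written in an orthonormal frame. The summand
  \<open>wedge u v\<close> is the contribution of the hyperbolic metric.\<close>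

definition rt :: "(real^'n \<Rightarrow> real^'n^'n) \<Rightarrow> real^'n \<Rightarrow> real^'n \<Rightarrow> real^'n^'n" where
  "rt T u v = comm (T u) (T v) + wedge u v - T (T u *v v - T v *v u)"

lemma comm_add_left: "comm (A + B) C = comm A C + comm B C"
  and comm_add_right: "comm A (B + C) = comm A B + comm A C"
  and comm_diff_left: "comm (A - B) C = comm A C - comm B C"
  and comm_diff_right: "comm A (B - C) = comm A B - comm A C"
  and comm_scaleR_left: "comm (r *\<^sub>R A) C = r *\<^sub>R comm A C"
  and comm_scaleR_right: "comm A (r *\<^sub>R C) = r *\<^sub>R comm A C"
  and comm_uminus_left: "comm (- A) C = - comm A C"
  and comm_uminus_right: "comm A (- C) = - comm A C"
  and comm_0 [simp]: "comm 0 C = 0" "comm A 0 = 0"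
  for A B C :: "real^'n::finite^'n"
  by (rule mat_eqI; simp add: mat_simps algebra_simps)+

lemma comm_swap: "comm A B = - comm B A" for A B :: "real^'n::finite^'n"
  by (simp add: comm_def)

lemma comm_jacobi: "comm (comm A B) C = comm A (comm B C) - comm B (comm A C)"
  for A B C :: "real^'n::finite^'n"
  by (rule mat_eqI) (simp add: mat_simps algebra_simps)

lemma subspace_stab:
  fixes T :: "real^'n::finite \<Rightarrow> real^'n^'n"
  assumes "linear T" shows "subspace (stab T)"
  using assms
  by (auto simp: subspace_def stab_def skew_add skew_scaleR comm_add_left comm_scaleR_left
      linear_0 linear_add linear_scale matrix_vector_mult_add_rdistrib
      scaleR_matrix_vector_assoc[symmetric])

lemma comm_mem_stab:
  fixes T :: "real^'n::finite \<Rightarrow> real^'n^'n"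
  assumes "linear T" "A \<in> stab T" "B \<in> stab T" shows "comm A B \<in> stab T"
  using assms by (auto simp: stab_def skew_comm comm_jacobi comm_apply linear_diff)

locale hyperbolic_model =
  fixes T :: "real^'n::finite \<Rightarrow> real^'n^'n"
  assumes linear_T: "linear T" and skew_T: "skew (T v)" and rt_mem_stab: "rt T u v \<in> stab T"
begin

lemmas subspace_stab' = subspace_stab[OF linear_T]

text \<open>
  The pair \<open>(Y, A)\<close> stands for the block matrix of \<open>so(n,1)\<close> with vector part \<open>Y\<close> and
  orthogonal part \<open>A\<close>.
\<close>

definition G :: "((real^'n) \<times> (real^'n^'n)) set" where
  "G = {(Y, A). A + T Y \<in> stab T}"

lemma mem_G: "(Y, A) \<in> G \<longleftrightarrow> A + T Y \<in> stab T"
  by (simp add: G_def)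

lemma skew_G: "(Y, A) \<in> G \<Longrightarrow> skew A"
  using skew_diff[of "A + T Y" "T Y"] skew_T by (auto simp: mem_G stab_def)

lemma mem_G_0: "(0, A) \<in> G \<longleftrightarrow> A \<in> stab T"
  using linear_T by (simp add: mem_G linear_0)

lemma subspace_G: "subspace G"
proof (rule subspaceI)
  show "0 \<in> G" using subspace_stab' by (simp add: zero_prod_def mem_G_0 subspace_0)
next
  fix E F assume "E \<in> G" "F \<in> G"
  then have "snd E + T (fst E) + (snd F + T (fst F)) \<in> stab T"
    using subspace_stab' by (cases E; cases F) (simp add: mem_G subspace_add)
  then show "E + F \<in> G"
    using linear_T by (cases E; cases F) (simp add: mem_G linear_add add_ac)
next
  fix c E assume "E \<in> G"
  moreover have "c *\<^sub>R A + T (c *\<^sub>R Y) = c *\<^sub>R (A + T Y)" for A Y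
    using linear_T by (simp add: linear_scale scaleR_add_right)
  ultimately show "c *\<^sub>R E \<in> G"
    using subspace_stab' by (cases E) (simp add: mem_G subspace_scale)
qed

text \<open>The bracket is the commutator of the block matrices. Its correction by \<open>T\<close>
  turns into the commutator of two stabilizer elements plus \<open>rt T Y Z\<close>, and both lie in
  \<open>stab T\<close>.\<close>

lemma bracket_mem_G:
  assumes "(Y, A) \<in> G" "(Z, B) \<in> G"
  shows "(A *v Z - B *v Y, comm A B + wedge Y Z) \<in> G"
proof -
  have K: "A + T Y \<in> stab T" and L: "B + T Z \<in> stab T" using assms by (auto simp: mem_G)
  have 1: "comm A (T Z) + comm (T Y) (T Z) = T (A *v Z) + T (T Y *v Z)"
    using K linear_T by (auto simp: stab_def comm_add_left[symmetric] matrix_vector_mult_add_rdistrib linear_add)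
  have 2: "comm B (T Y) + comm (T Z) (T Y) = T (B *v Y) + T (T Z *v Y)"
    using L linear_T by (auto simp: stab_def comm_add_left[symmetric] matrix_vector_mult_add_rdistrib linear_add)
  have "comm A B + wedge Y Z + T (A *v Z - B *v Y) = comm (A + T Y) (B + T Z) + rt T Y Z"
  proof -
    have 1: "comm A (T Z) = T (A *v Z) + T (T Y *v Z) - comm (T Y) (T Z)"
      using 1 by (simp add: eq_diff_eq)
    have "comm B (T Y) = T (B *v Y) + T (T Z *v Y) + comm (T Y) (T Z)"
      using 2 comm_swap[of "T Z" "T Y"] by (simp add: algebra_simps)
    then have 2: "comm (T Y) B = - T (B *v Y) - T (T Z *v Y) - comm (T Y) (T Z)"
      using comm_swap[of "T Y" B] by simp
    show ?thesis
      unfolding rt_def linear_diff[OF linear_T] comm_add_left comm_add_right 1 2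
      by (simp add: algebra_simps)
  qed
  then show ?thesis
    unfolding mem_G using comm_mem_stab[OF linear_T K L] rt_mem_stab subspace_stab'
    by (simp add: subspace_add)
qed

text \<open>On skew orthogonal parts this is the trace form tr (E F) of the block matrices: positive
  on vectors, negative on rotations.\<close>

definition form :: "(real^'n) \<times> (real^'n^'n) \<Rightarrow> (real^'n) \<times> (real^'n^'n) \<Rightarrow> real" where
  "form E F = 2 * (fst E \<bullet> fst F) - snd E \<bullet> snd F"

lemma form_invariant:
  assumes "skew A" "skew B" "skew C"
  shows "form (A *v Z - B *v Y, comm A B + wedge Y Z) (W, C)
    = - form (Z, B) (A *v W - C *v Y, comm A C + wedge Y W)"
proof -
  have "Z \<bullet> (C *v Y) = - (Y \<bullet> (C *v Z))"
    using skew_inner[OF assms(3), of Y Z] by (simp add: inner_commute)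
  then show ?thesis
    using inner_comm[of A B C] inner_wedge_skew[of C Y Z] inner_wedge_skew[of B Y W] assms
    by (simp add: form_def inner_simps skew_inner inner_commute[of B] algebra_simps)
qed

lemma form_commute: "form E F = form F E"
  by (simp add: form_def inner_commute)

text \<open>
  \<open>T'\<close> is the part of \<open>T\<close> orthogonal to the stabilizer, so that the pairs \<open>(Y, - T' Y)\<close> form the
  orthogonal complement of the isotropy algebra with respect to the invariant form.
\<close>

lemma reductive_complement:
  obtains T' where "linear T'" "\<And>Y. skew (T' Y)" "\<And>Y. (Y, - T' Y) \<in> G"
    "\<And>Y K. K \<in> stab T \<Longrightarrow> T' Y \<bullet> K = 0"
proof -
  obtain B where B: "finite B" "B \<subseteq> stab T" "span B = stab T"
    "\<forall>x. (\<Sum>b\<in>B. (x \<bullet> b) *\<^sub>R b) \<in> stab T"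
    "\<forall>x. \<forall>y\<in>stab T. (x - (\<Sum>b\<in>B. (x \<bullet> b) *\<^sub>R b)) \<bullet> y = 0"
    using orthonormal_expansion[OF subspace_stab'] by blast
  define T' where "T' Y = T Y - (\<Sum>b\<in>B. (T Y \<bullet> b) *\<^sub>R b)" for Y
  have "linear T'"
    using linear_T unfolding T'_def
    by (intro linearI) (simp_all add: linear_add linear_scale inner_add_left sum.distrib
        scaleR_add_left scaleR_add_right scaleR_diff_right scaleR_sum_right)
  moreover have G: "(Y, - T' Y) \<in> G" for Y
    using B(4) by (simp add: mem_G T'_def)
  moreover have "skew (T' Y)" for Y
    using skew_uminus[OF skew_G[OF G]] by simp
  moreover have "T' Y \<bullet> K = 0" if "K \<in> stab T" for Y K
    using B(5) that by (simp add: T'_def)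
  ultimately show ?thesis using that by blast
qed

end

section \<open>Homogeneous geodesics\<close>

lemma sum3_swap12:
  "(\<Sum>i\<in>A. \<Sum>j\<in>A. \<Sum>k\<in>A. f i j k) = (\<Sum>i\<in>A. \<Sum>j\<in>A. \<Sum>k\<in>A. f j i k)"
  by (rule sum.swap)

lemma sum3_swap23:
  "(\<Sum>i\<in>A. \<Sum>j\<in>A. \<Sum>k\<in>A. f i j k) = (\<Sum>i\<in>A. \<Sum>j\<in>A. \<Sum>k\<in>A. f i k j)"
  by (rule sum.cong[OF refl], rule sum.swap)

lemma trace_commute:
  fixes f g :: "real^'n::finite \<Rightarrow> real^'n"
  assumes "linear f" "linear g"
  shows "(\<Sum>i\<in>UNIV. f (g (axis i 1)) \<bullet> axis i 1) = (\<Sum>i\<in>UNIV. g (f (axis i 1)) \<bullet> axis i 1)"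
proof -
  have 1: "f' (g' (axis i 1)) \<bullet> axis i 1 = (\<Sum>j\<in>UNIV. g' (axis i 1) $ j * f' (axis j 1) $ i)"
    if "linear f'" for f' g' :: "real^'n \<Rightarrow> real^'n" and i
    by (subst linear_axis_expansion[OF that]) (simp add: inner_sum_left inner_axis)
  show ?thesis
    unfolding 1[OF assms(1)] 1[OF assms(2)] by (subst sum.swap) (simp add: mult.commute)
qed

text \<open>
  This is the case of a solvable group acting simply transitively. If it is unimodular, then the
  traces of its structure equations bound \<open>n (n - 1)\<close> by \<open>n\<close>.
\<close>

lemma null_complement:
  fixes T :: "real^'n::finite \<Rightarrow> real^'n^'n"
  assumes T: "linear T" and sk: "\<And>Y. skew (T Y)"
    and cl: "\<And>Y Z. comm (T Y) (T Z) + wedge Y Z = T (T Y *v Z - T Z *v Y)"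
    and iso: "\<And>Y Z. T Y \<bullet> T Z = 2 * (Y \<bullet> Z)"
    and n: "CARD('n) > 1"
  shows "\<exists>X. X \<noteq> 0 \<and> T X *v X = 0"
proof -
  define br where "br Y Z = T Y *v Z - T Z *v Y" for Y Z
  define \<tau> where "\<tau> = (\<Sum>i\<in>UNIV. T (axis i 1) *v axis i 1)"
  have clv: "T (br Y Z) *v v = T Y *v (T Z *v v) - T Z *v (T Y *v v) + (Z \<bullet> v) *\<^sub>R Y - (Y \<bullet> v) *\<^sub>R Z"
    for Y Z v
    using arg_cong[OF cl[of Y Z], of "\<lambda>M. M *v v"]
    by (simp add: br_def mat_simps algebra_simps)
  have lin_br: "linear (br Y)" for Y
    using T by (intro linearI)
      (simp_all add: br_def linear_add linear_scale algebra_simps mat_simps)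
  have jacobi: "br Y (br Z v) - br Z (br Y v) = br (br Y Z) v" for Y Z v
  proof -
    have "br Y (br Z v) = T Y *v (T Z *v v) - T Y *v (T v *v Z) - T (br Z v) *v Y"
      "br Z (br Y v) = T Z *v (T Y *v v) - T Z *v (T v *v Y) - T (br Y v) *v Z"
      "br (br Y Z) v = T (br Y Z) *v v - (T v *v (T Y *v Z) - T v *v (T Z *v Y))"
      by (simp_all add: br_def algebra_simps)
    then show ?thesis by (simp add: clv inner_commute)
  qed
  \<comment> \<open>By \<open>jacobi\<close> a bracket acts as a commutator of operators, so its
    trace is 0; and the trace of \<open>br W\<close> is \<open>W \<bullet> \<tau>\<close>.\<close>
  have tr: "br Y Z \<bullet> \<tau> = 0" for Y Z
  proof -
    have "(\<Sum>i\<in>UNIV. br (br Y Z) (axis i 1) \<bullet> axis i 1) = 0"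
      unfolding jacobi[symmetric] inner_diff_left sum_subtractf
      using trace_commute[OF lin_br lin_br, of Y Z] by simp
    moreover have "br W (axis i 1) \<bullet> axis i 1 = W \<bullet> (T (axis i 1) *v axis i 1)" for W i
      using sk by (simp add: br_def inner_diff_left skew_inner_self skew_inner)
    ultimately show ?thesis by (simp add: \<tau>_def inner_sum_right)
  qed
  have "\<tau> \<noteq> 0"
  proof
    assume \<tau>0: "\<tau> = 0"
    define S where "S i j k = (T (axis i 1) *v axis j 1) $ k" for i j k
    let ?n = "real CARD('n)"
    define P where "P = (\<Sum>i\<in>UNIV. \<Sum>j\<in>UNIV. \<Sum>k\<in>UNIV. S i j k * S j i k)"
    define N where "N = (\<Sum>i\<in>UNIV. \<Sum>j\<in>UNIV. \<Sum>k\<in>UNIV. S i j k * S i j k)"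
    have S: "S i j k = (T (axis i 1) *v axis j 1) \<bullet> axis k 1" for i j k
      by (simp add: S_def inner_axis)
    have skS: "S i j k = - S i k j" for i j k
      unfolding S using skew_inner[OF sk] by (metis inner_commute)
    have trS: "(\<Sum>i\<in>UNIV. S i i k) = 0" for k
      using arg_cong[OF \<tau>0, of "\<lambda>x. x $ k"] by (simp add: \<tau>_def S_def)
    have inS: "(T (axis i 1) *v axis j 1) \<bullet> (T (axis i' 1) *v axis j' 1) = (\<Sum>k\<in>UNIV. S i j k * S i' j' k)"
      for i j i' j'
      by (simp add: inner_vec_def S_def)
    have N: "N = 2 * ?n"
    proof -
      have "N = (\<Sum>i\<in>UNIV. T (axis i 1) \<bullet> T (axis i 1))"
        by (simp only: N_def inner_matrix_columns inS)
      then show ?thesis by (simp add: iso inner_axis_axis)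
    qed
    \<comment> \<open>As \<open>S\<close> is skew in its last two indices, the cyclic sum is a
      multiple of its totally skew part. The squared norm expands to 3 N - 6 P.\<close>
    have "0 \<le> (\<Sum>i\<in>UNIV. \<Sum>j\<in>UNIV. \<Sum>k\<in>UNIV. (S i j k + S j k i + S k i j)\<^sup>2)"
      by (intro sum_nonneg) auto
    also have "\<dots> = (\<Sum>i\<in>UNIV. \<Sum>j\<in>UNIV. \<Sum>k\<in>UNIV. S i j k * S i j k) +
        (\<Sum>i\<in>UNIV. \<Sum>j\<in>UNIV. \<Sum>k\<in>UNIV. S j k i * S j k i) +
        (\<Sum>i\<in>UNIV. \<Sum>j\<in>UNIV. \<Sum>k\<in>UNIV. S k i j * S k i j) +
        2 * ((\<Sum>i\<in>UNIV. \<Sum>j\<in>UNIV. \<Sum>k\<in>UNIV. S i j k * S j k i) +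
        (\<Sum>i\<in>UNIV. \<Sum>j\<in>UNIV. \<Sum>k\<in>UNIV. S j k i * S k i j) +
        (\<Sum>i\<in>UNIV. \<Sum>j\<in>UNIV. \<Sum>k\<in>UNIV. S k i j * S i j k))"
      by (simp add: sum.distrib[symmetric] sum_distrib_left power2_eq_square algebra_simps)
    also have "(\<Sum>i\<in>UNIV. \<Sum>j\<in>UNIV. \<Sum>k\<in>UNIV. S j k i * S j k i) = N"
      unfolding N_def by (subst sum3_swap23, subst sum3_swap12) (rule refl)
    also have "(\<Sum>i\<in>UNIV. \<Sum>j\<in>UNIV. \<Sum>k\<in>UNIV. S k i j * S k i j) = N"
      unfolding N_def by (subst sum3_swap12, subst sum3_swap23) (rule refl)
    also have "(\<Sum>i\<in>UNIV. \<Sum>j\<in>UNIV. \<Sum>k\<in>UNIV. S j k i * S k i j) =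
        (\<Sum>i\<in>UNIV. \<Sum>j\<in>UNIV. \<Sum>k\<in>UNIV. S i j k * S j k i)"
      by (subst sum3_swap23, subst sum3_swap12) (rule refl)
    also have "(\<Sum>i\<in>UNIV. \<Sum>j\<in>UNIV. \<Sum>k\<in>UNIV. S k i j * S i j k) =
        (\<Sum>i\<in>UNIV. \<Sum>j\<in>UNIV. \<Sum>k\<in>UNIV. S i j k * S j k i)"
      by (subst sum3_swap12, subst sum3_swap23) (rule refl)
    also have "(\<Sum>i\<in>UNIV. \<Sum>j\<in>UNIV. \<Sum>k\<in>UNIV. S i j k * S j k i) = - P"
      unfolding P_def sum_negf[symmetric] by (intro sum.cong refl) (metis skS mult_minus_right)
    finally have PN: "2 * P \<le> N" by (simp add: N_def)
    \<comment> \<open>The double trace of the structure equation \<open>clv\<close>, as for a scalar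
      curvature. The wedge contributes n^2 - n, and the product of the two traces drops out because
      \<tau> = 0.\<close>
    have PnP: "P + ?n * ?n - ?n = 2 * P"
    proof -
      have pt: "(\<Sum>k\<in>UNIV. S i j k * S j i k) - (\<Sum>k\<in>UNIV. S i i k * S j j k) + 1 - (if i = j then 1 else 0)
          = (\<Sum>k\<in>UNIV. S i j k * S k j i) - (\<Sum>k\<in>UNIV. S j i k * S k j i)" for i j
      proof -
        have e: "T w *v v = (\<Sum>k\<in>UNIV. (w $ k) *\<^sub>R (T (axis k 1) *v v))" for w v
          by (subst linear_axis_expansion[OF T]) (simp add: mat_sum_apply mat_simps)
        have "(T (br (axis i 1) (axis j 1)) *v axis j 1) \<bullet> axis i 1 =
            (\<Sum>k\<in>UNIV. S i j k * S k j i) - (\<Sum>k\<in>UNIV. S j i k * S k j i)"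
          by (subst e) (simp add: inner_sum_left S_def br_def inner_axis sum_subtractf[symmetric] algebra_simps)
        moreover have "(T (br (axis i 1) (axis j 1)) *v axis j 1) \<bullet> axis i 1 =
            (T (axis i 1) *v axis j 1) \<bullet> (T (axis j 1) *v axis i 1)
             - (T (axis i 1) *v axis i 1) \<bullet> (T (axis j 1) *v axis j 1) + 1 - (if i = j then 1 else 0)"
          unfolding clv inner_add_left inner_diff_left
            skew_inner[OF sk, of "axis i 1" "T (axis j 1) *v axis j 1"]
            skew_inner[OF sk, of "axis j 1" "T (axis i 1) *v axis j 1"]
          by (auto simp: inner_axis_axis inner_commute)
        ultimately show ?thesis unfolding inS by simp
      qed
      have A: "(\<Sum>i\<in>UNIV. \<Sum>j\<in>UNIV. \<Sum>k\<in>UNIV. S i i k * S j j k) = 0"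
      proof -
        have "(\<Sum>i\<in>UNIV. \<Sum>j\<in>UNIV. \<Sum>k\<in>UNIV. S i i k * S j j k) =
            (\<Sum>i\<in>UNIV. \<Sum>k\<in>UNIV. S i i k * (\<Sum>j\<in>UNIV. S j j k))"
          by (subst sum3_swap23) (simp add: sum_distrib_left)
        then show ?thesis by (simp add: trS)
      qed
      have B: "(\<Sum>i\<in>UNIV. \<Sum>j\<in>UNIV. \<Sum>k\<in>UNIV. S i j k * S k j i) = P"
      proof -
        have "(\<Sum>i\<in>UNIV. \<Sum>j\<in>UNIV. \<Sum>k\<in>UNIV. S i j k * S k j i) =
            (\<Sum>i\<in>UNIV. \<Sum>j\<in>UNIV. \<Sum>k\<in>UNIV. S i k j * S k i j)"
          by (intro sum.cong refl) (metis skS minus_mult_minus)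
        also have "\<dots> = P" unfolding P_def by (rule sum3_swap23)
        finally show ?thesis .
      qed
      have C: "(\<Sum>i\<in>UNIV. \<Sum>j\<in>UNIV. \<Sum>k\<in>UNIV. S j i k * S k j i) = - P"
      proof -
        have "(\<Sum>i\<in>UNIV. \<Sum>j\<in>UNIV. \<Sum>k\<in>UNIV. S j i k * S k j i) =
            - (\<Sum>i\<in>UNIV. \<Sum>j\<in>UNIV. \<Sum>k\<in>UNIV. S j k i * S k j i)"
          unfolding sum_negf[symmetric] by (intro sum.cong refl) (metis skS mult_minus_left)
        also have "(\<Sum>i\<in>UNIV. \<Sum>j\<in>UNIV. \<Sum>k\<in>UNIV. S j k i * S k j i) = P"
          unfolding P_def by (subst sum3_swap12, subst sum3_swap23) (rule refl)
        finally show ?thesis .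
      qed
      have "(\<Sum>i\<in>UNIV. \<Sum>j\<in>UNIV. (\<Sum>k\<in>UNIV. S i j k * S j i k) - (\<Sum>k\<in>UNIV. S i i k * S j j k) + 1 - (if i = j then 1 else 0))
          = P + ?n * ?n - ?n"
        by (simp add: sum_subtractf sum.distrib A P_def)
      moreover have "(\<Sum>i\<in>UNIV. \<Sum>j\<in>UNIV. (\<Sum>k\<in>UNIV. S i j k * S k j i) - (\<Sum>k\<in>UNIV. S j i k * S k j i)) = 2 * P"
        by (simp add: sum_subtractf B C)
      ultimately show ?thesis unfolding pt by simp
    qed
    \<comment> \<open>Now P = n (n - 1), N = 2 n and 2 P \<le> N leave only n = 2. There skewness
      and vanishing trace annihilate every component, against N = 4.\<close>
    have "?n * (?n - 1) \<le> ?n * 1" using PN N PnP by (simp add: algebra_simps)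
    then have "?n - 1 \<le> 1" using n by (subst (asm) mult_le_cancel_left_pos) auto
    then have "CARD('n) = 2" using n by linarith
    then obtain a b :: 'n where ab: "UNIV = {a, b}" "a \<noteq> b" by (auto simp: card_2_iff)
    have "S i j k = 0" for i j k
    proof -
      have d: "S i j j = 0" for i j using skS[of i j j] by simp
      have "S a a b = 0" using trS[of b] ab(2) unfolding ab(1) by (simp add: d)
      moreover have "S b b a = 0" using trS[of a] ab(2) unfolding ab(1) by (simp add: d)
      moreover have "i \<in> {a, b}" "j \<in> {a, b}" "k \<in> {a, b}" using ab by auto
      ultimately show ?thesis using d skS by (metis insertE neg_equal_0_iff_equal singletonD)
    qed
    then have "N = 0" by (simp add: N_def)
    then show False using N n by simp
  qed
  \<comment> \<open>Since the values of \<open>T\<close> are skew, pairing this vector with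
    \<open>Y\<close> gives \<open>br Y \<tau> \<bullet> \<tau>\<close>.\<close>
  moreover have "T \<tau> *v \<tau> = 0"
  proof -
    have "(T \<tau> *v \<tau>) \<bullet> Y = 0" for Y
      using tr[of Y \<tau>] skew_inner_self[OF sk, of Y \<tau>] skew_inner[OF sk, of \<tau> \<tau> Y]
      by (simp add: br_def inner_diff_right inner_commute)
    then show ?thesis using inner_eq_zero_iff by blast
  qed
  ultimately show ?thesis by blast
qed

context hyperbolic_model
begin

lemma homogeneous_geodesic:
  assumes n: "CARD('n) > 1"
  obtains X A where "(X, A) \<in> G" "norm X = 1" "A *v X = 0"
proof -
  obtain T' where T': "linear T'" "\<And>Y. skew (T' Y)" "\<And>Y. (Y, - T' Y) \<in> G"
    "\<And>Y K. K \<in> stab T \<Longrightarrow> T' Y \<bullet> K = 0"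
    using reductive_complement by metis
  define q where "q Y Z = 2 * (Y \<bullet> Z) - T' Y \<bullet> T' Z" for Y Z
  have q: "bilinear q"
    using T'(1) unfolding q_def bilinear_def
    by (auto intro!: linearI simp: linear_add linear_scale inner_simps algebra_simps)
  have qs: "q Y Z = q Z Y" for Y Z by (simp add: q_def inner_commute)
  have stab: "C + T' Z \<in> stab T" if "(Z, C) \<in> G" for Z C
    using subspace_diff[OF subspace_G that T'(3)[of Z]] by (simp add: mem_G_0)
  have form: "form (X, - T' X) (Z, C) = q X Z" if "(Z, C) \<in> G" for X Z C
    using T'(4)[OF stab[OF that], of X] by (simp add: form_def q_def inner_add_right)
  have "\<exists>X A. (X, A) \<in> G \<and> X \<noteq> 0 \<and> A *v X = 0"
  proof (cases "\<exists>y. q y y \<noteq> 0")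
    case True
    then obtain X m where X: "X \<noteq> 0" "m \<noteq> 0" "\<And>Z. q X Z = m * (X \<bullet> Z)"
      using bilinear_form_eigenvector[OF q qs] by metis
    \<comment> \<open>Invariance makes \<open>?E\<close> orthogonal to its bracket with the lift of
      \<open>Y\<close>. The eigenvector property turns this into Euclidean orthogonality of
      \<open>X\<close> to the vector part, and by skewness only the term with
      \<open>T' X *v X\<close> survives.\<close>
    have "(T' X *v X) \<bullet> Y = 0" for Y
    proof -
      let ?E = "(X, - T' X)"
      let ?F = "((- T' Y) *v X - (- T' X) *v Y, comm (- T' Y) (- T' X) + wedge Y X)"
      have "?F \<in> G" by (intro bracket_mem_G T'(3))
      moreover have "form ?F ?E = - form ?E ?F"
        using T'(2) by (intro form_invariant skew_uminus)
      ultimately have "q X ((- T' Y) *v X - (- T' X) *v Y) = 0"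
        using form form_commute[of ?F ?E] by simp
      then have "X \<bullet> ((- T' Y) *v X - (- T' X) *v Y) = 0" using X by simp
      then show ?thesis
        using skew_inner_self[OF T'(2), of Y X] skew_inner[OF T'(2), of X X Y]
        by (simp add: mat_simps inner_simps inner_commute)
    qed
    then have "T' X *v X = 0" using inner_eq_zero_iff by blast
    then show ?thesis using X(1) T'(3)[of X] by (intro exI[of _ X] exI[of _ "- T' X"]) (simp add: mat_simps)
  next
    case False
    then have q0: "q y y = 0" for y by blast
    have "q (Y + Z) (Y + Z) = q Y Y + q Z Z + 2 * q Y Z" for Y Z
      using q by (simp add: bilinear_ladd bilinear_radd qs[of Z Y])
    then have q00: "q Y Z = 0" for Y Z using q0[of "Y + Z"] q0[of Y] q0[of Z] by simp
    have "\<exists>X. X \<noteq> 0 \<and> T' X *v X = 0"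
    proof (rule null_complement[OF T'(1,2) _ _ n])
      show "T' Y \<bullet> T' Z = 2 * (Y \<bullet> Z)" for Y Z using q00[of Y Z] by (simp add: q_def)
      fix Y Z
      define W where "W = (- T' Y) *v Z - (- T' Z) *v Y"
      define C where "C = comm (- T' Y) (- T' Z) + wedge Y Z"
      \<comment> \<open>The isotropy part of a bracket of two lifts. Invariance moves the bracket
        onto \<open>(0, K)\<close>, which stays in \<open>G\<close>, where pairing with a lift is
        \<open>q\<close> and so vanishes. As the form is definite on rotations,
        \<open>K = 0\<close>, and the lifts form a subalgebra.\<close>
      define K where "K = C + T' W"
      have WC: "(W, C) \<in> G" unfolding W_def C_def by (intro bracket_mem_G T'(3))
      then have K: "K \<in> stab T" unfolding K_def by (rule stab)
      have "form (W, C) (0, K) = - form (Z, - T' Z) ((- T' Y) *v 0 - K *v Y, comm (- T' Y) K + wedge Y 0)"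
        unfolding W_def C_def using T'(2) K by (intro form_invariant skew_uminus) (auto simp: stab_def)
      also have "\<dots> = 0"
        using bracket_mem_G[OF T'(3)[of Y], of 0 K] K by (subst form) (simp_all add: q00 mem_G_0)
      finally have "C \<bullet> K = 0" by (simp add: form_def)
      then have "K \<bullet> K = 0" using T'(4)[OF K, of W] by (simp add: K_def inner_add_left)
      then have "K = 0" by simp
      moreover have "T' W = - T' (T' Y *v Z - T' Z *v Y)"
        by (simp add: W_def mat_simps linear_diff[OF T'(1)] linear_add[OF T'(1)] linear_neg[OF T'(1)])
      ultimately show "comm (T' Y) (T' Z) + wedge Y Z = T' (T' Y *v Z - T' Z *v Y)"
        by (simp add: K_def C_def comm_uminus_left comm_uminus_right)
    qed
    then obtain X where "X \<noteq> 0" "T' X *v X = 0" by blast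
    then show ?thesis using T'(3)[of X] by (intro exI[of _ X] exI[of _ "- T' X"]) (simp add: mat_simps)
  qed
  then obtain X A where "(X, A) \<in> G" "X \<noteq> 0" "A *v X = 0" by blast
  then have "(inverse (norm X)) *\<^sub>R (X, A) \<in> G" "norm (inverse (norm X) *\<^sub>R X) = 1"
    "(inverse (norm X) *\<^sub>R A) *v (inverse (norm X) *\<^sub>R X) = 0"
    using subspace_scale[OF subspace_G] by (auto simp: mat_simps matrix_vector_mult_scaleR)
  then show ?thesis using that by simp
qed

end

section \<open>The dichotomy\<close>

context hyperbolic_model
begin

lemma mem_G_add: "(Y, A) \<in> G \<Longrightarrow> (Z, B) \<in> G \<Longrightarrow> (Y + Z, A + B) \<in> G"
  using subspace_add[OF subspace_G, of "(Y, A)" "(Z, B)"] by simp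

lemma mem_G_scale: "(Y, A) \<in> G \<Longrightarrow> (c *\<^sub>R Y, c *\<^sub>R A) \<in> G"
  using subspace_scale[OF subspace_G, of "(Y, A)" c] by simp

lemma dichotomy:
  assumes n: "CARD('n) > 1"
  shows "(\<forall>Y Z. wedge Y Z \<in> stab T) \<or>
    (\<exists>\<xi>. norm \<xi> = 1 \<and> (\<forall>Y. T Y *v \<xi> = (Y \<bullet> \<xi>) *\<^sub>R \<xi> - Y) \<and>
       (\<forall>w. w \<bullet> \<xi> = 0 \<longrightarrow> T w - wedge \<xi> w \<in> stab T))"
proof -
  obtain X A where XA: "(X, A) \<in> G" "norm X = 1" "A *v X = 0"
    using homogeneous_geodesic[OF n] .
  have XX: "X \<bullet> X = 1" using XA(2) by (simp add: norm_eq_1)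
  note skA = skew_G[OF XA(1)]
  have TG: "(Y, - T Y) \<in> G" for Y by (simp add: mem_G subspace_0[OF subspace_stab'])
  text \<open>
    Since \<open>A X = 0\<close>, the element \<open>(X, A)\<close> acts as a normal operator, so \<open>G\<close> is also invariant under
    its adjoint, which is the action of \<open>(X, - A)\<close>, and hence under that of \<open>(X, 0)\<close>.
  \<close>
  have adX: "(- (B *v X), wedge X Y) \<in> G" if YB: "(Y, B) \<in> G" for Y B
  proof -
    \<comment> \<open>The vector part is stored twice so that the standard inner product becomes 2 Y
      \<bullet> Z + B \<bullet> C. For it the actions of (X, A) and (X, - A), here \<open>N\<close>
      and \<open>M\<close>, are adjoint on \<open>G'\<close>.\<close>
    define N where "N = (\<lambda>(Y, Y', B). (A *v Y - B *v X, A *v Y' - B *v X, comm A B + wedge X Y))"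
    define M where "M = (\<lambda>(Y, Y', B). (- (A *v Y) - B *v X, - (A *v Y') - B *v X, - comm A B + wedge X Y))"
    define G' where "G' = {(Y, Y', B). Y = Y' \<and> (Y, B) \<in> G}"
    have adj: "N g \<bullet> h = g \<bullet> M h" if gh: "g \<in> G'" "h \<in> G'" for g h
    proof -
      obtain Y B Z C where gh': "g = (Y, Y, B)" "h = (Z, Z, C)" "(Y, B) \<in> G" "(Z, C) \<in> G"
        using gh by (auto simp: G'_def)
      note sk = skew_G[OF gh'(3)] skew_G[OF gh'(4)]
      have "B \<bullet> wedge X Z = - 2 * ((B *v X) \<bullet> Z)"
        using inner_wedge_skew[OF sk(1), of X Z] skew_inner[OF sk(1), of X Z] by (simp add: inner_commute)
      moreover have "wedge X Y \<bullet> C = - 2 * (Y \<bullet> (C *v X))"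
        using inner_wedge_skew[OF sk(2), of X Y] skew_inner[OF sk(2), of X Y] by (simp add: inner_commute)
      ultimately show ?thesis
        unfolding gh' N_def M_def
        using skew_inner[OF skA, of Y Z] inner_comm[OF skA, of B C]
        by (simp add: inner_simps)
    qed
    have normal: "norm (N g) = norm (M g)" if g: "g \<in> G'" for g
    proof -
      obtain Y B where g': "g = (Y, Y, B)" "(Y, B) \<in> G" using g by (auto simp: G'_def)
      note sk = skew_G[OF g'(2)]
      have "wedge X Y \<bullet> comm A B = 2 * (X \<bullet> (A *v (B *v Y))) - 2 * (X \<bullet> (B *v (A *v Y)))"
        by (simp add: inner_wedge_skew skew_comm skA sk comm_apply inner_simps)
      moreover have "X \<bullet> (A *v (B *v Y)) = 0"
        using skew_inner[OF skA, of X "B *v Y"] XA(3) by simp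
      moreover have "X \<bullet> (B *v (A *v Y)) = - ((B *v X) \<bullet> (A *v Y))"
        using skew_inner[OF sk, of X "A *v Y"] by simp
      ultimately have "wedge X Y \<bullet> comm A B = 2 * ((B *v X) \<bullet> (A *v Y))" by simp
      then have "N g \<bullet> N g = M g \<bullet> M g"
        unfolding g' N_def M_def
        by (simp add: inner_simps inner_commute)
      then show ?thesis by (simp add: norm_eq_sqrt_inner)
    qed
    have G': "subspace G'"
      by (auto simp: subspace_def G'_def zero_prod_def mem_G_0 subspace_0[OF subspace_stab']
          mem_G_add mem_G_scale)
    have NG: "N g \<in> G'" if "g \<in> G'" for g
      using that bracket_mem_G[OF XA(1)] by (auto simp: G'_def N_def)
    have M: "linear M"
      unfolding M_def
      by (intro linearI) (auto simp: algebra_simps mat_simps comm_add_right comm_scaleR_right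
          linear_add[OF linear_wedge(1)] linear_scale[OF linear_wedge(1)])
    have "(Y, Y, B) \<in> G'" using YB by (simp add: G'_def)
    then have "N (Y, Y, B) \<in> G'" "M (Y, Y, B) \<in> G'"
      using NG normal_operator_invariant_subspace[OF G' NG adj normal M] by blast+
    then have "(1/2) *\<^sub>R (N (Y, Y, B) + M (Y, Y, B)) \<in> G'"
      using G' by (intro subspace_scale subspace_add)
    moreover have "(1/2::real) *\<^sub>R (- (2::real) *\<^sub>R v) = - v" for v :: "real^'n" by simp
    ultimately show ?thesis
      by (simp add: N_def M_def G'_def scaleR_2[symmetric])
  qed
  \<comment> \<open>For c = 1 and c = - 1 these are the vector parts of the elements of
    \<open>G\<close> on which (X, 0) acts with eigenvalue c.\<close>
  define U where "U c = {w. w \<bullet> X = 0 \<and> (w, c *\<^sub>R wedge X w) \<in> G}" for c :: real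
  \<comment> \<open>If D is the action of (X, 0), then D^2 + c D is twice the projection to the
    eigenvalue c, because it vanishes for the eigenvalues 0 and - c.\<close>
  have U_proj: "Y - (X \<bullet> Y) *\<^sub>R X - c *\<^sub>R (B *v X) \<in> U c" if YB: "(Y, B) \<in> G" and c: "c * c = 1" for Y B c
  proof -
    let ?w = "Y - (X \<bullet> Y) *\<^sub>R X - c *\<^sub>R (B *v X)"
    note 1 = adX[OF YB] and 2 = adX[OF adX[OF YB]]
    have "(- (wedge X Y *v X), wedge X (- (B *v X))) + c *\<^sub>R (- (B *v X), wedge X Y) \<in> G"
      using 1 2 subspace_G by (intro subspace_add subspace_scale) auto
    moreover have "- (wedge X Y *v X) + c *\<^sub>R (- (B *v X)) = ?w"
      by (simp add: wedge_apply XX inner_commute)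
    moreover have "wedge X (- (B *v X)) + c *\<^sub>R wedge X Y = c *\<^sub>R wedge X ?w"
      by (rule mat_eqI) (simp add: mat_simps algebra_simps inner_simps c mult.assoc[symmetric])
    moreover have "?w \<bullet> X = 0"
      using skew_inner_self[OF skew_G[OF YB], of X] by (simp add: inner_simps XX inner_commute)
    ultimately show ?thesis by (simp add: U_def)
  qed
  have subU: "subspace (U c)" for c
  proof (rule subspaceI)
    show "0 \<in> U c"
      using linear_wedge(1)[of X] by (simp add: U_def linear_0 mem_G_0 subspace_0[OF subspace_stab'])
    show "v + w \<in> U c" if "v \<in> U c" "w \<in> U c" for v w
      using that linear_wedge(1)[of X] mem_G_add[of v "c *\<^sub>R wedge X v" w "c *\<^sub>R wedge X w"]
      by (simp add: U_def linear_add scaleR_add_right inner_add_left)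
    show "r *\<^sub>R w \<in> U c" if "w \<in> U c" for r w
      using that linear_wedge(1)[of X] mem_G_scale[of w "c *\<^sub>R wedge X w" r]
      by (simp add: U_def linear_scale mult.commute)
  qed
  text \<open>If \<open>U (- c)\<close> vanishes, then \<open>- c X\<close> is the fixed point at infinity.\<close>
  have one: ?thesis if U0: "U (- c) = {0}" and c: "c * c = 1" for c
  proof (intro disjI2 exI[of _ "- (c *\<^sub>R X)"] conjI allI impI)
    have BX: "c *\<^sub>R (B *v X) = (X \<bullet> Y) *\<^sub>R X - Y" if "(Y, B) \<in> G" for Y B
      using U_proj[OF that, of "- c"] U0 c by (simp add: algebra_simps)
    have "\<bar>c\<bar> = 1" using c by (metis abs_mult_self_eq abs_one abs_square_eq_1 power2_eq_square)
    then show "norm (- (c *\<^sub>R X)) = 1" using XA(2) by simp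
    show "T Y *v (- (c *\<^sub>R X)) = (Y \<bullet> (- (c *\<^sub>R X))) *\<^sub>R (- (c *\<^sub>R X)) - Y" for Y
      using BX[OF TG, of Y] c by (simp add: mat_simps mat_apply_uminus inner_commute algebra_simps mult.assoc[symmetric])
    fix w assume "w \<bullet> (- (c *\<^sub>R X)) = 0"
    then have wX: "X \<bullet> w = 0" using \<open>\<bar>c\<bar> = 1\<close> by (auto simp: inner_commute)
    have "w - (X \<bullet> w) *\<^sub>R X - c *\<^sub>R ((- T w) *v X) = 2 *\<^sub>R w"
      using BX[OF TG, of w] wX by (simp add: scaleR_2)
    then have "2 *\<^sub>R w \<in> U c" using U_proj[OF TG c, of w] by simp
    then have "w \<in> U c" using subspace_scale[OF subU, of "2 *\<^sub>R w" c "1/2"] by simp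
    then have "(w, c *\<^sub>R wedge X w) \<in> G" by (simp add: U_def)
    then have "c *\<^sub>R wedge X w + T w \<in> stab T" by (simp add: mem_G)
    moreover have "T w - wedge (- (c *\<^sub>R X)) w = c *\<^sub>R wedge X w + T w"
      by (rule mat_eqI) (simp add: mat_simps algebra_simps)
    ultimately show "T w - wedge (- (c *\<^sub>R X)) w \<in> stab T" by (simp only:)
  qed
  have incl: "U (- c) \<subseteq> U c" if ne: "U c \<noteq> {0}" and c: "c * c = 1" for c
  proof
    fix w' assume w': "w' \<in> U (- c)"
    obtain w where w: "w \<in> U c" "w \<noteq> 0" using ne subspace_0[OF subU] by blast
    have wX: "w \<bullet> X = 0" "w' \<bullet> X = 0" "X \<bullet> w = 0" "X \<bullet> w' = 0"
      using w w' by (auto simp: U_def inner_commute)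
    have wG: "(w, c *\<^sub>R wedge X w) \<in> G" "(w', - c *\<^sub>R wedge X w') \<in> G"
      using w w' by (auto simp: U_def)
    let ?Z = "(2 * c * (w \<bullet> w')) *\<^sub>R X" and ?C = "2 *\<^sub>R wedge w w'"
    have "(c *\<^sub>R wedge X w) *v w' - (- c *\<^sub>R wedge X w') *v w = ?Z"
      by (simp add: mat_simps wX inner_commute[of w' w] vec_eq_iff algebra_simps)
    moreover have "comm (c *\<^sub>R wedge X w) (- c *\<^sub>R wedge X w') + wedge w w' = ?C"
    proof -
      have "comm (wedge X w) (wedge X w') = - wedge w w'"
        by (rule mat_eqI) (simp add: mat_simps wX XX inner_simps inner_commute[of w' w])
      then show ?thesis using c by (simp add: comm_scaleR_left comm_scaleR_right comm_uminus_right scaleR_2)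
    qed
    ultimately have ZC: "(?Z, ?C) \<in> G" using bracket_mem_G[OF wG] by simp
    let ?u = "2 *\<^sub>R ((2 * (w \<bullet> w')) *\<^sub>R w - (w \<bullet> w) *\<^sub>R w')"
    have "?C *v w - (c *\<^sub>R wedge X w) *v ?Z = 2 *\<^sub>R (wedge w w' *v w) + (c * c) *\<^sub>R (2 * (w \<bullet> w')) *\<^sub>R w"
      by (simp add: mat_simps wX XX mult.commute mult.left_commute)
    also have "\<dots> = ?u" using c by (simp add: mat_simps wX inner_commute[of w' w] vec_eq_iff algebra_simps)
    finally have "?C *v w - (c *\<^sub>R wedge X w) *v ?Z = ?u" .
    moreover have "comm ?C (c *\<^sub>R wedge X w) + wedge ?Z w = c *\<^sub>R wedge X ?u"
    proof -
      have "comm (wedge w w') (wedge X w) = wedge X ((w \<bullet> w') *\<^sub>R w - (w \<bullet> w) *\<^sub>R w')"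
        by (simp add: comm_wedge mat_simps wX linear_0[OF linear_wedge(2)] inner_commute[of w' w])
      moreover have "wedge ?Z w = (2 * c) *\<^sub>R wedge X ((w \<bullet> w') *\<^sub>R w)"
        by (simp add: linear_scale[OF linear_wedge(1)] linear_scale[OF linear_wedge(2)] mult_ac)
      moreover have "?u = 2 *\<^sub>R (((w \<bullet> w') *\<^sub>R w - (w \<bullet> w) *\<^sub>R w') + (w \<bullet> w') *\<^sub>R w)"
        by (simp add: vec_eq_iff algebra_simps)
      ultimately show ?thesis
        using linear_wedge(1)[of X]
        by (simp only: comm_scaleR_left comm_scaleR_right linear_scale linear_add scaleR_add_right
            scaleR_scaleR mult.commute mult.left_commute)
    qed
    ultimately have "(?u, c *\<^sub>R wedge X ?u) \<in> G" using bracket_mem_G[OF ZC wG(1)] by simp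
    moreover have "?u \<bullet> X = 0" by (simp add: inner_simps wX)
    ultimately have u: "?u \<in> U c" by (simp add: U_def)
    have "(1 / (w \<bullet> w)) *\<^sub>R ((2 * (w \<bullet> w')) *\<^sub>R w - (1/2) *\<^sub>R ?u) \<in> U c"
      by (rule subspace_scale[OF subU subspace_diff[OF subU subspace_scale[OF subU w(1)]
            subspace_scale[OF subU u]]])
    then show "w' \<in> U c" using w(2) by simp
  qed
  show ?thesis
  proof (cases "U 1 = {0} \<or> U (- 1) = {0}")
    case True
    then show ?thesis using one[of 1] one[of "- 1"] by auto
  next
    case False
    then have UU: "U 1 = U (- 1)" using incl[of 1] incl[of "- 1"] by auto
    \<comment> \<open>The two projections of the lift of \<open>w\<close> add up to 2 w and lie in
      the same space. Afterwards \<open>w\<close> has lifts of both degrees, whose difference is a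
      pure rotation in \<open>stab T\<close>.\<close>
    have U_all: "w \<in> U 1" "w \<in> U (- 1)" if "w \<bullet> X = 0" for w
    proof -
      have "w - (X \<bullet> w) *\<^sub>R X - c *\<^sub>R ((- T w) *v X) \<in> U 1" if c: "c = 1 \<or> c = -1" for c
      proof -
        have "c * c = 1" "U c = U 1" using c UU by auto
        then show ?thesis using U_proj[OF TG, of c w] by (simp only:)
      qed
      from subspace_add[OF subU this[of 1] this[of "- 1"]]
      have "2 *\<^sub>R w \<in> U 1" using that by (simp add: inner_commute scaleR_2)
      then show "w \<in> U 1" using subspace_scale[OF subU, of "2 *\<^sub>R w" 1 "1/2"] by simp
      then show "w \<in> U (- 1)" using UU by simp
    qed
    have 1: "wedge X w \<in> stab T" if "w \<bullet> X = 0" for w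
    proof -
      have "(1/2) *\<^sub>R ((w, 1 *\<^sub>R wedge X w) - (w, - 1 *\<^sub>R wedge X w)) \<in> G"
        using U_all[OF that] subspace_G by (intro subspace_scale subspace_diff) (auto simp: U_def)
      moreover have "(1/2) *\<^sub>R ((w, 1 *\<^sub>R wedge X w) - (w, - 1 *\<^sub>R wedge X w)) = (0, wedge X w)"
        by (simp add: scaleR_2[symmetric])
      ultimately show ?thesis by (simp add: mem_G_0)
    qed
    have 2: "wedge w w' \<in> stab T" if "w \<bullet> X = 0" "w' \<bullet> X = 0" for w w'
    proof -
      have "comm (wedge X w') (wedge X w) \<in> stab T"
        using that 1 by (intro comm_mem_stab[OF linear_T])
      moreover have "X \<bullet> w = 0" "X \<bullet> w' = 0" using that by (simp_all add: inner_commute)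
      then have "comm (wedge X w') (wedge X w) = wedge w w'"
        using that by (intro mat_eqI) (simp add: mat_simps XX inner_simps inner_commute[of w' w])
      ultimately show ?thesis by simp
    qed
    have "wedge Y Z \<in> stab T" for Y Z
    proof -
      define y z where "y = Y - (X \<bullet> Y) *\<^sub>R X" and "z = Z - (X \<bullet> Z) *\<^sub>R X"
      have yz: "y \<bullet> X = 0" "z \<bullet> X = 0" by (simp_all add: y_def z_def inner_simps XX inner_commute)
      have "wedge Y Z = wedge y z + (X \<bullet> Y) *\<^sub>R wedge X z - (X \<bullet> Z) *\<^sub>R wedge X y"
        by (rule mat_eqI) (simp add: mat_simps y_def z_def algebra_simps inner_simps)
      then show ?thesis
        using 1 2 yz subspace_stab' by (simp add: subspace_add subspace_diff subspace_scale)
    qed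
    then show ?thesis by blast
  qed
qed

end

section \<open>The trace of an infinitesimal model\<close>

definition act :: "real^'n^'n \<Rightarrow> (real^'n \<Rightarrow> real^'n^'n) \<Rightarrow> real^'n \<Rightarrow> real^'n^'n" where
  "act A T v = comm A (T v) - T (A *v v)"

definition mtr :: "(real^'n::finite \<Rightarrow> real^'n^'n) \<Rightarrow> real^'n" where
  "mtr T = (\<Sum>i\<in>UNIV. T (axis i 1) *v axis i 1)"

lemma stab_iff_act: "A \<in> stab T \<longleftrightarrow> skew A \<and> (\<forall>v. act A T v = 0)"
  by (auto simp: stab_def act_def)

lemma mat_axis: "(A *v axis i 1) $ j = A $ j $ i" for A :: "real^'n::finite^'n"
  by (simp add: matrix_vector_mult_basis column_def)

lemma skew_component:
  fixes A :: "real^'n::finite^'n"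
  assumes "skew A" shows "A $ j $ i = - A $ i $ j"
proof -
  have "transpose A $ i $ j = (- A) $ i $ j" using assms by (simp only: skew_def)
  then show ?thesis by (simp add: transpose_def)
qed

text \<open>\<open>mtr\<close> contracts two slots with the Euclidean product, which
  \<open>A\<close> preserves infinitesimally; so it is equivariant.\<close>

lemma mtr_act:
  fixes T :: "real^'n::finite \<Rightarrow> real^'n^'n"
  assumes T: "linear T" and A: "skew A"
  shows "mtr (act A T) = A *v mtr T"
proof -
  have 1: "T (axis i 1) *v (A *v axis i 1) = (\<Sum>j\<in>UNIV. (A $ j $ i) *\<^sub>R (T (axis i 1) *v axis j 1))" for i
    by (subst linear_axis_expansion[of "\<lambda>v. T (axis i 1) *v v"]) (simp_all add: mat_axis)
  have 2: "T (A *v axis i 1) *v axis i 1 = (\<Sum>j\<in>UNIV. (A $ j $ i) *\<^sub>R (T (axis j 1) *v axis i 1))" for i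
    by (subst linear_axis_expansion[OF T]) (simp_all add: mat_axis mat_sum_apply mat_simps)
  have "(\<Sum>i\<in>UNIV. T (A *v axis i 1) *v axis i 1) =
      (\<Sum>i\<in>UNIV. \<Sum>j\<in>UNIV. (A $ i $ j) *\<^sub>R (T (axis i 1) *v axis j 1))"
    unfolding 2 by (rule sum.swap)
  also have "\<dots> = - (\<Sum>i\<in>UNIV. T (axis i 1) *v (A *v axis i 1))"
    unfolding 1 sum_negf[symmetric] by (intro sum.cong refl) (subst skew_component[OF A], simp)
  finally show ?thesis
    by (simp add: mtr_def act_def mat_simps matrix_vector_mult_diff_rdistrib sum_subtractf mat_apply_sum)
qed

lemma stab_mtr:
  fixes T :: "real^'n::finite \<Rightarrow> real^'n^'n"
  assumes "linear T" "A \<in> stab T"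
  shows "A *v mtr T = 0"
proof -
  have "act A T = (\<lambda>v. 0)" "skew A" using assms(2) by (auto simp: stab_iff_act)
  then show ?thesis using mtr_act[OF assms(1), of A] by (simp add: mtr_def)
qed

lemma skew_wedge_expansion:
  fixes A :: "real^'n::finite^'n"
  assumes "skew A"
  shows "A = (1/2) *\<^sub>R (\<Sum>i\<in>UNIV. wedge (A *v axis i 1) (axis i 1))"
proof (rule mat_eqI)
  fix v
  have "(\<Sum>i\<in>UNIV. (axis i 1 \<bullet> v) *\<^sub>R (A *v axis i 1)) = A *v v"
    by (subst (2) inner_axis_sum[of v, symmetric]) (simp add: mat_apply_sum inner_commute algebra_simps)
  moreover have "(\<Sum>i\<in>UNIV. ((A *v axis i 1) \<bullet> v) *\<^sub>R axis i 1) = - (A *v v)"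
  proof -
    have "(A *v axis i 1) \<bullet> v = - ((A *v v) \<bullet> axis i 1)" for i
      using skew_inner[OF assms, of "axis i 1" v] by (simp add: inner_commute)
    then show ?thesis using inner_axis_sum[of "A *v v"] by (simp add: sum_negf)
  qed
  ultimately show "A *v v = ((1/2) *\<^sub>R (\<Sum>i\<in>UNIV. wedge (A *v axis i 1) (axis i 1))) *v v"
    by (simp add: mat_simps mat_sum_apply sum_subtractf scaleR_2[symmetric])
qed

lemma skew_mem_stab:
  fixes T :: "real^'n::finite \<Rightarrow> real^'n^'n"
  assumes "linear T" "\<And>Y Z. wedge Y Z \<in> stab T" "skew A"
  shows "A \<in> stab T"
  by (subst skew_wedge_expansion[OF assms(3)])
    (intro subspace_scale subspace_sum subspace_stab assms)

text \<open>Applying the stabilizer condition to \<xi> shows that T \<xi> maps A \<xi> to (\<xi>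
  \<bullet> \<xi>) A \<xi>. A skew matrix has no nonzero real eigenvalue, so A \<xi> = 0.\<close>

lemma stab_kills_direction:
  fixes T :: "real^'n::finite \<Rightarrow> real^'n^'n"
  assumes sk: "\<And>v. skew (T v)" and dir: "\<And>Y. T Y *v \<xi> = (Y \<bullet> \<xi>) *\<^sub>R \<xi> - Y" and \<xi>: "\<xi> \<noteq> 0" and A: "A \<in> stab T"
  shows "A *v \<xi> = 0"
proof -
  define k where "k = A *v \<xi>"
  have skA: "skew A" using A by (simp add: stab_def)
  have "T \<xi> *v k = (\<xi> \<bullet> \<xi>) *\<^sub>R k - (\<xi> \<bullet> k) *\<^sub>R \<xi>"
  proof -
    have "A *v (T \<xi> *v \<xi>) - T \<xi> *v k = T k *v \<xi>"
      using A comm_apply[of A "T \<xi>" \<xi>] by (simp add: stab_def k_def)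
    then show ?thesis by (simp add: dir k_def algebra_simps inner_commute)
  qed
  moreover have "\<xi> \<bullet> k = 0" using skew_inner_self[OF skA, of \<xi>] by (simp add: k_def inner_commute)
  ultimately have "(\<xi> \<bullet> \<xi>) * (k \<bullet> k) = 0"
    using skew_inner_self[OF sk, of \<xi> k] by simp
  then show ?thesis using \<xi> by (simp add: k_def)
qed

lemma not_all_skew_kill:
  fixes m :: "real^'n::finite"
  assumes n: "CARD('n) > 1" and "\<And>Y Z. wedge Y Z *v m = 0"
  shows "m = 0"
proof -
  obtain a b :: 'n where ab: "a \<noteq> b" using n by (metis card_1_singletonE One_nat_def UNIV_I
    card_le_Suc0_iff_eq finite_class.finite_UNIV not_less)
  have *: "(m $ i) *\<^sub>R m = (m \<bullet> m) *\<^sub>R axis i 1" for i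
    using assms(2)[of m "axis i 1"] by (simp add: wedge_apply inner_axis' )
  have "m $ a * m $ b = 0" "m $ a * m $ a = m \<bullet> m" "m $ b * m $ b = m \<bullet> m"
    using arg_cong[OF *[of a], of "\<lambda>v. v $ b"] arg_cong[OF *[of a], of "\<lambda>v. v $ a"]
      arg_cong[OF *[of b], of "\<lambda>v. v $ b"] ab
    by (simp_all add: axis_def)
  then show ?thesis by auto
qed

context hyperbolic_model
begin

lemma trace_dichotomy:
  assumes n: "CARD('n) > 1"
  obtains (flat) "mtr T = 0" "\<And>A. skew A \<Longrightarrow> A \<in> stab T"
  | (parabolic) \<xi> where "norm \<xi> = 1" "mtr T = (real CARD('n) - 1) *\<^sub>R \<xi>"
      "\<And>Y. T Y *v \<xi> = (Y \<bullet> \<xi>) *\<^sub>R \<xi> - Y" "\<And>w. w \<bullet> \<xi> = 0 \<Longrightarrow> T w - wedge \<xi> w \<in> stab T"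
      "\<And>A. A \<in> stab T \<Longrightarrow> A *v \<xi> = 0"
proof -
  consider "\<forall>Y Z. wedge Y Z \<in> stab T" |
    \<xi> where "norm \<xi> = 1" "\<forall>Y. T Y *v \<xi> = (Y \<bullet> \<xi>) *\<^sub>R \<xi> - Y"
       "\<forall>w. w \<bullet> \<xi> = 0 \<longrightarrow> T w - wedge \<xi> w \<in> stab T"
    using dichotomy[OF n] by blast
  then show ?thesis
  proof cases
    case 1
    then have "mtr T = 0" using stab_mtr[OF linear_T] not_all_skew_kill[OF n] by blast
    then show ?thesis using flat 1 skew_mem_stab[OF linear_T] by blast
  next
    case 2
    have \<xi>\<xi>: "\<xi> \<bullet> \<xi> = 1" using 2(1) by (simp add: norm_eq_1)
    have kill: "A *v \<xi> = 0" if "A \<in> stab T" for A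
      using 2 skew_T that by (intro stab_kills_direction[of T]) auto
    define \<phi> where "\<phi> Y = T Y - wedge \<xi> Y" for Y
    have lin\<phi>: "linear \<phi>"
      using linear_T linear_wedge(1)[of \<xi>] by (auto simp: \<phi>_def[abs_def] intro: linear_compose_sub)
    have sk\<phi>: "skew (\<phi> Y)" for Y by (simp add: \<phi>_def skew_diff skew_T)
    have \<phi>\<xi>: "\<phi> Y *v \<xi> = 0" for Y
      using 2(2) by (simp add: \<phi>_def algebra_simps wedge_apply \<xi>\<xi> inner_commute)
    have "mtr (wedge \<xi>) = (real CARD('n) - 1) *\<^sub>R \<xi>"
      using inner_axis_sum[of \<xi>]
      by (simp add: mtr_def wedge_apply inner_axis_axis sum_subtractf algebra_simps scaleR_left.sum[symmetric] sum_constant_scaleR del: sum_constant)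
    moreover have "mtr T = mtr (wedge \<xi>) + mtr \<phi>"
      by (simp add: mtr_def \<phi>_def sum.distrib[symmetric] algebra_simps)
    \<comment> \<open>Stabilizer elements kill both \<open>mtr T\<close> and \<xi>, hence
      \<open>mtr \<phi>\<close>. As \<phi> maps vectors orthogonal to \<xi> into the stabilizer,
      only \<phi> \<xi> can contribute to the squared norm of \<open>mtr \<phi>\<close>, and it
      contributes nothing because it kills \<xi>.\<close>
    moreover have "mtr \<phi> = 0"
    proof -
      have kill': "A *v mtr \<phi> = 0" if "A \<in> stab T" for A
        using stab_mtr[OF linear_T that] kill[OF that] calculation
        by (simp add: algebra_simps)
      have "\<phi> (axis i 1) *v mtr \<phi> = (axis i 1 \<bullet> \<xi>) *\<^sub>R (\<phi> \<xi> *v mtr \<phi>)" for i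
      proof -
        define w where "w = axis i 1 - (axis i 1 \<bullet> \<xi>) *\<^sub>R \<xi>"
        have "w \<bullet> \<xi> = 0" by (simp add: w_def inner_simps \<xi>\<xi>)
        then have "\<phi> w *v mtr \<phi> = 0" using 2(3) kill' by (simp add: \<phi>_def)
        then show ?thesis
          using lin\<phi> by (simp add: w_def linear_diff linear_scale algebra_simps mat_simps)
      qed
      then have "mtr \<phi> \<bullet> mtr \<phi> = (\<Sum>i\<in>UNIV. - (axis i 1 \<bullet> ((axis i 1 \<bullet> \<xi>) *\<^sub>R (\<phi> \<xi> *v mtr \<phi>))))"
        by (subst (1) mtr_def) (simp add: inner_sum_left skew_inner[OF sk\<phi>])
      also have "\<dots> = - ((\<Sum>i\<in>UNIV. (\<xi> \<bullet> axis i 1) *\<^sub>R axis i 1) \<bullet> (\<phi> \<xi> *v mtr \<phi>))"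
        by (simp add: inner_sum_left sum_negf inner_commute[of _ \<xi>])
      also have "\<dots> = 0"
        unfolding inner_axis_sum using skew_inner[OF sk\<phi>, of \<xi> \<xi> "mtr \<phi>"] by (simp add: \<phi>\<xi>)
      finally show ?thesis by simp
    qed
    ultimately have "mtr T = (real CARD('n) - 1) *\<^sub>R \<xi>" by simp
    then show ?thesis using parabolic 2 kill by blast
  qed
qed

end

section \<open>Calculus on the ball: parallel fields and their two types\<close>

section \<open>Symmetry of second derivatives\<close>

text \<open>The mean value theorem, along \<open>u\<close>, is applied to the difference of
  \<open>F\<close> on two segments that are \<open>t w\<close> apart. It leaves a difference of
  first derivatives, which differentiability at the single point \<open>x\<close> controls.\<close>

lemma second_difference:
  fixes F :: "'a::real_normed_vector \<Rightarrow> real"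
  assumes S: "open S" "x \<in> S" and F: "\<And>y. y \<in> S \<Longrightarrow> (F has_derivative F' y) (at y)"
    and D: "((\<lambda>y. F' y u) has_derivative D) (at x)" and e: "e > 0"
  shows "\<exists>d>0. \<forall>t. 0 < t \<and> t < d \<longrightarrow>
    \<bar>F (x + t *\<^sub>R u + t *\<^sub>R w) - F (x + t *\<^sub>R u) - F (x + t *\<^sub>R w) + F x - t\<^sup>2 * D w\<bar> \<le> e * t\<^sup>2"
proof -
  define c where "c = norm u + norm w + 1"
  have c: "c > 0" by (simp add: c_def add_nonneg_pos)
  obtain r where r: "r > 0" "ball x r \<subseteq> S" using S openE by blast
  have "e / (2 * c) > 0" using e c by simp
  then obtain d where d: "d > 0"
    "\<And>y. norm (y - x) < d \<Longrightarrow> norm (F' y u - F' x u - D (y - x)) \<le> e / (2 * c) * norm (y - x)"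
    using D unfolding has_derivative_at_alt by blast
  have linD: "linear D" using D has_derivative_linear by blast
  have "\<bar>F (x + t *\<^sub>R u + t *\<^sub>R w) - F (x + t *\<^sub>R u) - F (x + t *\<^sub>R w) + F x - t\<^sup>2 * D w\<bar> \<le> e * t\<^sup>2"
    if t: "0 < t" "t < min r d / c" for t
  proof -
    have tc: "t * c < r" "t * c < d" using t c by (auto simp: field_simps)
    have nb: "norm (s *\<^sub>R u + t' *\<^sub>R w) \<le> t * c" if "0 \<le> s" "s \<le> t" "0 \<le> t'" "t' \<le> t" for s t'
    proof -
      have "norm (s *\<^sub>R u + t' *\<^sub>R w) \<le> s * norm u + t' * norm w"
        using norm_triangle_ineq[of "s *\<^sub>R u" "t' *\<^sub>R w"] that by simp
      also have "\<dots> \<le> t * norm u + t * norm w" using that by (intro add_mono mult_right_mono) auto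
      also have "\<dots> \<le> t * c" using t by (simp add: c_def algebra_simps)
      finally show ?thesis .
    qed
    define \<phi> where "\<phi> s = F (x + (s *\<^sub>R u + t *\<^sub>R w)) - F (x + (s *\<^sub>R u + 0 *\<^sub>R w))" for s
    have inS: "x + (s *\<^sub>R u + t' *\<^sub>R w) \<in> S" if "0 \<le> s" "s \<le> t" "0 \<le> t'" "t' \<le> t" for s t'
      using nb[OF that] tc r(2) dist_add_cancel[of x 0 "s *\<^sub>R u + t' *\<^sub>R w"] by (auto simp: subset_eq)
    have der: "((\<lambda>s. F (x + (s *\<^sub>R u + t' *\<^sub>R w))) has_real_derivative F' (x + (s *\<^sub>R u + t' *\<^sub>R w)) u) (at s)"
      if "0 \<le> s" "s \<le> t" "0 \<le> t'" "t' \<le> t" for s t'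
    proof -
      have 1: "((\<lambda>s. x + (s *\<^sub>R u + t' *\<^sub>R w)) has_derivative (\<lambda>h. h *\<^sub>R u)) (at s)"
        by (auto intro!: derivative_eq_intros)
      have 2: "linear (F' (x + (s *\<^sub>R u + t' *\<^sub>R w)))" using F[OF inS[OF that]] has_derivative_linear by blast
      have "((\<lambda>s. F (x + (s *\<^sub>R u + t' *\<^sub>R w))) has_derivative
          (\<lambda>h. F' (x + (s *\<^sub>R u + t' *\<^sub>R w)) (h *\<^sub>R u))) (at s)"
        using has_derivative_compose[OF 1 F[OF inS[OF that]]] by (simp add: o_def)
      then show ?thesis
        unfolding has_field_derivative_def
        by (rule has_derivative_eq_rhs) (simp add: fun_eq_iff linear_scale[OF 2] mult.commute)
    qed
    have "\<exists>z. 0 < z \<and> z < t \<and> \<phi> t - \<phi> 0 = (t - 0) *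
        (F' (x + (z *\<^sub>R u + t *\<^sub>R w)) u - F' (x + (z *\<^sub>R u + 0 *\<^sub>R w)) u)"
      unfolding \<phi>_def using t by (intro MVT2 DERIV_diff der) auto
    then obtain z where z: "0 < z" "z < t" "\<phi> t - \<phi> 0 = t *
        (F' (x + (z *\<^sub>R u + t *\<^sub>R w)) u - F' (x + (z *\<^sub>R u + 0 *\<^sub>R w)) u)" by auto
    let ?a = "z *\<^sub>R u + t *\<^sub>R w" and ?b = "z *\<^sub>R u + 0 *\<^sub>R w"
    have rem: "\<bar>F' (x + v) u - F' x u - D v\<bar> \<le> e * t / 2" if "norm v \<le> t * c" for v
    proof -
      have "\<bar>F' (x + v) u - F' x u - D v\<bar> \<le> e / (2 * c) * norm v"
        using d(2)[of "x + v"] that tc(2) by simp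
      also have "\<dots> \<le> e / (2 * c) * (t * c)" using that e c by (intro mult_left_mono) auto
      also have "\<dots> = e * t / 2" using c by simp
      finally show ?thesis .
    qed
    have "D ?a - D ?b = t * D w" using linD by (simp add: linear_add linear_scale)
    then have "\<bar>F' (x + ?a) u - F' (x + ?b) u - t * D w\<bar> \<le> e * t"
      using rem[OF nb[of z t]] rem[OF nb[of z 0]] z(1,2) t(1) by (simp add: abs_if split: if_splits)
    then have "t * \<bar>F' (x + ?a) u - F' (x + ?b) u - t * D w\<bar> \<le> t * (e * t)"
      using t by (intro mult_left_mono) auto
    moreover have "t * \<bar>F' (x + ?a) u - F' (x + ?b) u - t * D w\<bar> = \<bar>\<phi> t - \<phi> 0 - t\<^sup>2 * D w\<bar>"
    proof -
      have "\<phi> t - \<phi> 0 - t\<^sup>2 * D w = t * (F' (x + ?a) u - F' (x + ?b) u - t * D w)"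
        unfolding z(3) by (simp only: power2_eq_square right_diff_distrib mult.assoc)
      then show ?thesis using t by (simp only: abs_mult abs_of_pos)
    qed
    ultimately show ?thesis by (simp add: \<phi>_def power2_eq_square algebra_simps)
  qed
  moreover have "min r d / c > 0" using r d c by simp
  ultimately show ?thesis by blast
qed

lemma second_derivative_symmetric:
  fixes F :: "'a::real_normed_vector \<Rightarrow> real"
  assumes S: "open S" "x \<in> S" and F: "\<And>y. y \<in> S \<Longrightarrow> (F has_derivative F' y) (at y)"
    and D: "((\<lambda>y. F' y u) has_derivative D) (at x)" and E: "((\<lambda>y. F' y w) has_derivative E) (at x)"
  shows "D w = E u"
proof -
  have "\<bar>D w - E u\<bar> \<le> 0 + e" if e: "e > 0" for e
  proof -
    have e2: "e / 2 > 0" using e by simp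
    obtain d1 where d1: "d1 > 0" "\<And>t. 0 < t \<and> t < d1 \<Longrightarrow>
      \<bar>F (x + t *\<^sub>R u + t *\<^sub>R w) - F (x + t *\<^sub>R u) - F (x + t *\<^sub>R w) + F x - t\<^sup>2 * D w\<bar> \<le> e / 2 * t\<^sup>2"
      using second_difference[OF S F D e2, of w] by blast
    obtain d2 where d2: "d2 > 0" "\<And>t. 0 < t \<and> t < d2 \<Longrightarrow>
      \<bar>F (x + t *\<^sub>R w + t *\<^sub>R u) - F (x + t *\<^sub>R w) - F (x + t *\<^sub>R u) + F x - t\<^sup>2 * E u\<bar> \<le> e / 2 * t\<^sup>2"
      using second_difference[OF S F E e2, of u] by blast
    define t where "t = min d1 d2 / 2"
    have t: "0 < t" "t < d1" "t < d2" using d1 d2 by (auto simp: t_def)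
    have "F (x + t *\<^sub>R w + t *\<^sub>R u) = F (x + t *\<^sub>R u + t *\<^sub>R w)" by (simp add: add_ac)
    then have "\<bar>t\<^sup>2 * D w - t\<^sup>2 * E u\<bar> \<le> e * t\<^sup>2"
      using d1(2)[OF conjI[OF t(1,2)]] d2(2)[OF conjI[OF t(1,3)]] unfolding abs_le_iff by linarith
    moreover have "t\<^sup>2 * \<bar>D w - E u\<bar> = \<bar>t\<^sup>2 * D w - t\<^sup>2 * E u\<bar>"
      by (simp add: right_diff_distrib[symmetric] abs_mult)
    ultimately have "t\<^sup>2 * \<bar>D w - E u\<bar> \<le> t\<^sup>2 * e" by (simp add: mult.commute)
    then show ?thesis using t by simp
  qed
  then have "\<bar>D w - E u\<bar> \<le> 0" by (rule field_le_epsilon)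
  then show ?thesis by simp
qed

section \<open>Homogeneous tensors as parallel fields\<close>

text \<open>
  A homogeneous tensor \<open>S\<close> is rescaled to \<open>T = S / conf\<close>, which is its expression in the orthonormal
  frame (for sectional curvature \<open>-1\<close>) proportional to the coordinate frame. The connection
  \<open>\<nabla> - S\<close> then becomes \<open>D + Om T\<close> with skew-symmetric \<open>Om T\<close>.
\<close>

definition conf :: "real^'n::finite \<Rightarrow> real" where
  "conf x = 2 / (1 - x \<bullet> x)"

definition Om :: "(real^'n \<Rightarrow> real^'n \<Rightarrow> real^'n^'n) \<Rightarrow> real^'n::finite \<Rightarrow> real^'n \<Rightarrow> real^'n^'n" where
  "Om T x u = conf x *\<^sub>R (wedge u x - T x u)"

text \<open>The connection is an argument of its own, so that a deformed field can first be shown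
  parallel for the connection of the original one and then be transferred by
  \<open>hom_field_change\<close>.\<close>

definition parallel ::
    "(real^'n \<Rightarrow> real^'n \<Rightarrow> real^'n^'n) \<Rightarrow> (real^'n \<Rightarrow> real^'n::finite \<Rightarrow> real^'n^'n) \<Rightarrow> bool" where
  "parallel W T \<longleftrightarrow> (\<forall>x\<in>RH. linear (T x) \<and> (\<forall>v. skew (T x v)) \<and>
     (\<forall>v. ((\<lambda>y. T y v) has_derivative (\<lambda>u. - act (W x u) (T x) v)) (at x)))"

abbreviation hom_field :: "(real^'n \<Rightarrow> real^'n::finite \<Rightarrow> real^'n^'n) \<Rightarrow> bool" where
  "hom_field T \<equiv> parallel (Om T) T"

lemma parallelD:
  assumes "parallel W T" "x \<in> RH"
  shows "linear (T x)" "skew (T x v)"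
    "((\<lambda>y. T y v) has_derivative (\<lambda>u. - act (W x u) (T x) v)) (at x)"
  using assms by (auto simp: parallel_def)

lemma conf_pos: "x \<in> RH \<Longrightarrow> conf x > 0"
  using RH_pos[of x] by (simp add: conf_def)

lemma conf_identity: "x \<in> RH \<Longrightarrow> conf x * (x \<bullet> x) = conf x - 2"
  using RH_pos[of x] by (simp add: conf_def field_simps)

lemma conf_derivative:
  "x \<in> RH \<Longrightarrow> (conf has_derivative (\<lambda>h. (conf x)\<^sup>2 * (x \<bullet> h))) (at x)"
  using has_derivative_conformal_factor[of x] by (simp add: conf_def[abs_def])

lemma bounded_bilinear_comm: "bounded_bilinear (comm :: real^'n::finite^'n \<Rightarrow> _)"
  by (rule bilinear_conv_bounded_bilinear[THEN iffD1])
    (auto simp: bilinear_def comm_add_left comm_add_right comm_scaleR_left comm_scaleR_right intro!: linearI)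

lemma bounded_bilinear_mat_apply:
  "bounded_bilinear (\<lambda>(A :: real^'n::finite^'n) v. A *v v)"
  by (rule bilinear_conv_bounded_bilinear[THEN iffD1])
    (auto simp: bilinear_def algebra_simps mat_simps intro!: linearI)

lemma bounded_bilinear_wedge: "bounded_bilinear (wedge :: real^'n::finite \<Rightarrow> _)"
  by (rule bilinear_conv_bounded_bilinear[THEN iffD1]) (auto simp: bilinear_def linear_wedge)

lemma act_simps:
  fixes A B :: "real^'n::finite^'n"
  assumes "linear T"
  shows "act (A + B) T v = act A T v + act B T v" "act (A - B) T v = act A T v - act B T v"
    "act (c *\<^sub>R A) T v = c *\<^sub>R act A T v" "linear (act A T)"
  using assms
  by (auto simp: act_def[abs_def] comm_add_left comm_add_right comm_diff_left comm_scaleR_left comm_scaleR_right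
      matrix_vector_mult_add_rdistrib matrix_vector_mult_diff_rdistrib linear_add linear_diff linear_scale
      mat_simps algebra_simps intro!: linearI)

lemma act_comm:
  fixes A B :: "real^'n::finite^'n"
  assumes "linear T"
  shows "act (comm A B) T v = act A (act B T) v - act B (act A T) v"
  using assms by (simp add: act_def comm_jacobi comm_diff_right comm_apply linear_diff)

lemma act_add_field: "act A (\<lambda>v. T v + T' v) v = act A T v + act A T' v"
  and act_scale_field: "act A (\<lambda>v. c *\<^sub>R T v) v = c *\<^sub>R act A T v"
  for A :: "real^'n::finite^'n"
  by (simp_all add: act_def comm_add_right comm_scaleR_right scaleR_diff_right)

text \<open>Product rule for a field applied to a moving vector. Expansion in the coordinate basis
  reduces it to derivatives at fixed vectors, the only ones that \<open>parallel\<close>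
  supplies.\<close>

lemma has_derivative_apply_field:
  fixes T :: "real^'n::finite \<Rightarrow> real^'n \<Rightarrow> real^'n^'n"
  assumes x: "x \<in> RH" and lin: "\<And>y. y \<in> RH \<Longrightarrow> linear (T y)"
    and D: "\<And>v. ((\<lambda>y. T y v) has_derivative (\<lambda>h. D h v)) (at x)" and linD: "\<And>h. linear (D h)"
    and w: "(w has_derivative w') (at x)"
  shows "((\<lambda>y. T y (w y)) has_derivative (\<lambda>h. D h (w x) + T x (w' h))) (at x)"
proof -
  have wi: "((\<lambda>y. w y $ i) has_derivative (\<lambda>h. w' h $ i)) (at x)" for i
    by (rule bounded_linear.has_derivative[OF bounded_linear_vec_nth w])
  have "((\<lambda>y. \<Sum>i\<in>UNIV. w y $ i *\<^sub>R T y (axis i 1)) has_derivative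
      (\<lambda>h. \<Sum>i\<in>UNIV. w x $ i *\<^sub>R D h (axis i 1) + w' h $ i *\<^sub>R T x (axis i 1))) (at x)"
    by (intro has_derivative_sum has_derivative_scaleR wi D)
  then have "((\<lambda>y. T y (w y)) has_derivative
      (\<lambda>h. \<Sum>i\<in>UNIV. w x $ i *\<^sub>R D h (axis i 1) + w' h $ i *\<^sub>R T x (axis i 1))) (at x)"
    by (rule has_derivative_transform_within_open[OF _ open_RH x])
      (simp add: linear_axis_expansion[OF lin, symmetric])
  then show ?thesis
    by (rule has_derivative_eq_rhs)
      (simp add: fun_eq_iff sum.distrib linear_axis_expansion[OF lin[OF x], symmetric]
        linear_axis_expansion[OF linD, symmetric])
qed

lemma Om_derivative:
  fixes T :: "real^'n::finite \<Rightarrow> real^'n \<Rightarrow> real^'n^'n"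
  assumes T: "hom_field T" and x: "x \<in> RH"
  shows "((\<lambda>y. Om T y u) has_derivative (\<lambda>h. ((conf x)\<^sup>2 * (x \<bullet> h)) *\<^sub>R (wedge u x - T x u)
    + conf x *\<^sub>R (wedge u h + act (Om T x h) (T x) u))) (at x)"
proof -
  have "((\<lambda>y. wedge u y - T y u) has_derivative (\<lambda>h. wedge u h - (- act (Om T x h) (T x) u))) (at x)"
    by (intro has_derivative_diff parallelD(3)[OF T x] bounded_linear_imp_has_derivative
        bounded_bilinear.bounded_linear_right[OF bounded_bilinear_wedge])
  from has_derivative_scaleR[OF conf_derivative[OF x] this]
  show ?thesis unfolding Om_def by (simp add: algebra_simps)
qed

lemma ricci_identity:
  fixes T :: "real^'n::finite \<Rightarrow> real^'n \<Rightarrow> real^'n^'n"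
  assumes T: "hom_field T" and x: "x \<in> RH"
  shows "rt (T x) u w \<in> stab (T x)"
proof -
  note lin = parallelD(1)[OF T]
  define W where "W = Om T x"
  define W' where "W' u h = ((conf x)\<^sup>2 * (x \<bullet> h)) *\<^sub>R (wedge u x - T x u)
    + conf x *\<^sub>R (wedge u h + act (W h) (T x) u)" for u h
  have dW: "((\<lambda>y. Om T y u) has_derivative (\<lambda>h. W' u h)) (at x)" for u
    using Om_derivative[OF T x, of u] by (simp add: W'_def W_def)
  have D2: "((\<lambda>y. - act (Om T y u) (T y) v) has_derivative
      (\<lambda>h. act (W u) (act (W h) (T x)) v - act (W' u h) (T x) v)) (at x)" for u v
  proof -
    have "((\<lambda>y. comm (Om T y u) (T y v)) has_derivative
        (\<lambda>h. comm (W u) (- act (W h) (T x) v) + comm (W' u h) (T x v))) (at x)"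
      using bounded_bilinear.FDERIV[OF bounded_bilinear_comm dW parallelD(3)[OF T x]]
      by (simp add: W_def)
    moreover have "((\<lambda>y. T y (Om T y u *v v)) has_derivative
        (\<lambda>h. - act (W h) (T x) (W u *v v) + T x (W' u h *v v))) (at x)"
      unfolding W_def
      by (rule has_derivative_apply_field[OF x lin parallelD(3)[OF T x]])
        (auto intro!: linear_compose_neg act_simps(4) lin x
          bounded_linear.has_derivative[OF bounded_bilinear.bounded_linear_left[OF bounded_bilinear_mat_apply] dW])
    ultimately show ?thesis
      unfolding act_def[of "Om T _ u"]
      by (rule has_derivative_eq_rhs[OF has_derivative_minus[OF has_derivative_diff]])
        (simp add: fun_eq_iff act_def comm_diff_right comm_uminus_right)
  qed
  have sym: "act (W u) (act (W w) (T x)) v - act (W' u w) (T x) v =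
      act (W w) (act (W u) (T x)) v - act (W' w u) (T x) v" for v
  proof -
    have "(act (W u) (act (W w) (T x)) v - act (W' u w) (T x) v) \<bullet> B =
      (act (W w) (act (W u) (T x)) v - act (W' w u) (T x) v) \<bullet> B" for B
      by (rule second_derivative_symmetric[OF open_RH x, of "\<lambda>y. T y v \<bullet> B" "\<lambda>y u. - act (Om T y u) (T y) v \<bullet> B"])
        (intro has_derivative_inner_left D2 parallelD(3)[OF T]; assumption)+
    then show ?thesis using vector_eq_rdot by blast
  qed
  \<comment> \<open>The left side is minus the curvature of D + Om T. By \<open>sym\<close> it acts
    trivially on \<open>T x\<close>.\<close>
  have "W' u w - W' w u - comm (W u) (W w) = (conf x)\<^sup>2 *\<^sub>R rt (T x) u w"
  proof -
    define l where "l = conf x"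
    define t where "t = T x"
    have t: "linear t" using lin[OF x] by (simp add: t_def)
    have W: "W u = l *\<^sub>R (wedge u x - t u)" for u by (simp add: W_def Om_def l_def t_def)
    have e: "act (W w) t u = l *\<^sub>R (comm (wedge w x) (t u) - comm (t w) (t u)
        - (x \<bullet> u) *\<^sub>R t w + (w \<bullet> u) *\<^sub>R t x + t (t w *v u))" for u w
      by (simp add: W act_simps[OF t])
        (simp add: act_def mat_simps linear_diff[OF t] linear_scale[OF t] algebra_simps)
    have "wedge u' v' = - wedge v' u'" for u' v' :: "real^'n"
      by (simp add: wedge_def vec_eq_iff)
    note w_swap = this
    have "wedge x x = 0" by (simp add: wedge_def vec_eq_iff)
    then have ww: "comm (wedge u x) (wedge w x) =
        (x \<bullet> w) *\<^sub>R wedge u x - (x \<bullet> x) *\<^sub>R wedge u w - (u \<bullet> x) *\<^sub>R wedge w x"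
      unfolding comm_wedge[OF skew_wedge] wedge_apply
      by (simp add: linear_diff[OF linear_wedge(1)] linear_diff[OF linear_wedge(2)]
          linear_scale[OF linear_wedge(1)] linear_scale[OF linear_wedge(2)] w_swap[of w u])
    have cWW: "comm (W u) (W w) = l\<^sup>2 *\<^sub>R ((x \<bullet> w) *\<^sub>R wedge u x - (u \<bullet> x) *\<^sub>R wedge w x
        - comm (wedge u x) (t w) + comm (wedge w x) (t u) + comm (t u) (t w))
        - (l\<^sup>2 * (x \<bullet> x)) *\<^sub>R wedge u w"
      using comm_swap[of "t u" "wedge w x"]
      by (simp add: W comm_scaleR_left comm_scaleR_right comm_diff_left comm_diff_right ww
          power2_eq_square algebra_simps)
    \<comment> \<open>The term - 2 l cancels the two wedges that come from differentiating the point
      in \<open>Om\<close>; the remaining l^2 yields the \<open>wedge u w\<close> of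
      \<open>rt\<close>.\<close>
    have l2: "l\<^sup>2 * (x \<bullet> x) = l\<^sup>2 - 2 * l"
      using conf_identity[OF x] by (simp add: l_def power2_eq_square mult.assoc right_diff_distrib)
    show ?thesis
      unfolding W'_def l_def[symmetric] t_def[symmetric] e cWW l2 rt_def linear_diff[OF t]
      using comm_swap[of "t w" "t u"] w_swap[of w u]
      by (simp add: power2_eq_square algebra_simps inner_commute[of u]) (simp add: vec_eq_iff)
  qed
  moreover have "act (W' u w - W' w u - comm (W u) (W w)) (T x) v = 0" for v
    using sym[of v]
    by (simp add: act_simps[OF lin[OF x]] act_comm[OF lin[OF x]] diff_eq_eq)
  ultimately have "(conf x)\<^sup>2 *\<^sub>R act (rt (T x) u w) (T x) v = 0" for v
    by (simp add: act_simps(3)[OF lin[OF x]])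
  then show ?thesis
    using conf_pos[OF x] parallelD(2)[OF T x]
    by (auto simp: stab_iff_act rt_def intro!: skew_add skew_diff skew_comm)
qed

lemma hyperbolic_model_hom_field:
  "hom_field T \<Longrightarrow> x \<in> RH \<Longrightarrow> hyperbolic_model (T x)"
  by (rule hyperbolic_model.intro) (auto intro: parallelD ricci_identity)

lemma skew_Om: "hom_field T \<Longrightarrow> x \<in> RH \<Longrightarrow> skew (Om T x u)"
  by (auto simp: Om_def parallelD(2) intro!: skew_scaleR skew_diff)

lemma mtr_derivative:
  assumes T: "parallel W T" and x: "x \<in> RH" and W: "\<And>u. skew (W x u)"
  shows "((\<lambda>y. mtr (T y)) has_derivative (\<lambda>u. - (W x u *v mtr (T x)))) (at x)"
proof -
  have "((\<lambda>y. mtr (T y)) has_derivative (\<lambda>u. mtr (\<lambda>v. - act (W x u) (T x) v))) (at x)"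
    unfolding mtr_def
    by (intro has_derivative_sum bounded_linear.has_derivative[OF bounded_bilinear.bounded_linear_left[OF bounded_bilinear_mat_apply]]
        parallelD(3)[OF T x])
  moreover have "mtr (\<lambda>v. - act (W x u) (T x) v) = - mtr (act (W x u) (T x))" for u
    by (simp add: mtr_def mat_uminus_apply sum_negf)
  ultimately show ?thesis using mtr_act[OF parallelD(1)[OF T x] W] by simp
qed

lemma parallel_combination:
  fixes T T' :: "real^'n::finite \<Rightarrow> real^'n \<Rightarrow> real^'n^'n"
  assumes "parallel W T" "parallel W T'"
  shows "parallel W (\<lambda>x v. a *\<^sub>R T x v + b *\<^sub>R T' x v)"
  unfolding parallel_def
proof (intro ballI conjI allI)
  fix x v :: "real^'n" assume x: "x \<in> RH"
  note P = parallelD[OF assms(1) x] and P' = parallelD[OF assms(2) x]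
  show "linear (\<lambda>v. a *\<^sub>R T x v + b *\<^sub>R T' x v)"
    by (intro linear_compose_add linear_compose_scale_right P P')
  show "skew (a *\<^sub>R T x v + b *\<^sub>R T' x v)"
    by (intro skew_add skew_scaleR P P')
  have "((\<lambda>y. a *\<^sub>R T y v + b *\<^sub>R T' y v) has_derivative
      (\<lambda>u. a *\<^sub>R (- act (W x u) (T x) v) + b *\<^sub>R (- act (W x u) (T' x) v))) (at x)"
    by (intro has_derivative_add has_derivative_scaleR_right P P')
  then show "((\<lambda>y. a *\<^sub>R T y v + b *\<^sub>R T' y v) has_derivative
      (\<lambda>u. - act (W x u) (\<lambda>v. a *\<^sub>R T x v + b *\<^sub>R T' x v) v)) (at x)"
    by (rule has_derivative_eq_rhs) (simp add: fun_eq_iff act_add_field act_scale_field)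
qed

lemma act_wedge:
  fixes A :: "real^'n::finite^'n"
  assumes "skew A" shows "act A (wedge \<xi>) v = wedge (A *v \<xi>) v"
  by (simp add: act_def comm_wedge[OF assms])

lemma parallel_wedge:
  fixes W :: "real^'n::finite \<Rightarrow> real^'n \<Rightarrow> real^'n^'n"
  assumes "\<And>x. x \<in> RH \<Longrightarrow> (\<xi> has_derivative (\<lambda>u. - (W x u *v \<xi> x))) (at x)"
    and W: "\<And>x u. x \<in> RH \<Longrightarrow> skew (W x u)"
  shows "parallel W (\<lambda>x. wedge (\<xi> x))"
  unfolding parallel_def
proof (intro ballI conjI allI)
  fix x v :: "real^'n" assume x: "x \<in> RH"
  have "((\<lambda>y. wedge (\<xi> y) v) has_derivative (\<lambda>u. wedge (- (W x u *v \<xi> x)) v)) (at x)"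
    by (rule bounded_linear.has_derivative[OF bounded_bilinear.bounded_linear_left[OF bounded_bilinear_wedge] assms(1)[OF x]])
  then show "((\<lambda>y. wedge (\<xi> y) v) has_derivative (\<lambda>u. - act (W x u) (wedge (\<xi> x)) v)) (at x)"
    by (rule has_derivative_eq_rhs)
      (simp add: fun_eq_iff act_wedge[OF W[OF x]] linear_neg[OF linear_wedge(2)])
qed (simp_all add: linear_wedge)

text \<open>For unit \<xi> this is \<open>T\<close> composed with the projection to the line of
  \<xi>.\<close>

definition beta :: "real^'n::finite \<Rightarrow> (real^'n \<Rightarrow> real^'n^'n) \<Rightarrow> real^'n \<Rightarrow> real^'n^'n" where
  "beta \<xi> T v = (\<xi> \<bullet> v) *\<^sub>R T \<xi>"

lemma act_beta:
  assumes T: "linear T" and A: "skew A"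
  shows "act A (beta \<xi> T) v = (\<xi> \<bullet> v) *\<^sub>R (act A T \<xi> + T (A *v \<xi>)) + ((A *v \<xi>) \<bullet> v) *\<^sub>R T \<xi>"
  using skew_inner[OF A, of \<xi> v]
  by (simp add: act_def beta_def comm_scaleR_right)

lemma parallel_beta:
  fixes T :: "real^'n::finite \<Rightarrow> real^'n \<Rightarrow> real^'n^'n"
  assumes \<xi>: "\<And>x. x \<in> RH \<Longrightarrow> (\<xi> has_derivative (\<lambda>u. - (W x u *v \<xi> x))) (at x)"
    and W: "\<And>x u. x \<in> RH \<Longrightarrow> skew (W x u)" and T: "parallel W T"
  shows "parallel W (\<lambda>x. beta (\<xi> x) (T x))"
  unfolding parallel_def
proof (intro ballI conjI allI)
  fix x v :: "real^'n" assume x: "x \<in> RH"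
  note P = parallelD[OF T x]
  show "linear (beta (\<xi> x) (T x))"
    by (intro linearI) (simp_all add: beta_def inner_add_right algebra_simps)
  show "skew (beta (\<xi> x) (T x) v)"
    by (auto simp: beta_def intro!: skew_scaleR P)
  have "((\<lambda>y. T y (\<xi> y)) has_derivative (\<lambda>u. - act (W x u) (T x) (\<xi> x) + T x (- (W x u *v \<xi> x)))) (at x)"
    by (rule has_derivative_apply_field[OF x parallelD(1)[OF T] P(3) _ \<xi>[OF x]])
      (auto intro!: linear_compose_neg act_simps(4) P)
  from has_derivative_scaleR[OF has_derivative_inner_left[OF \<xi>[OF x], of v] this]
  show "((\<lambda>y. beta (\<xi> y) (T y) v) has_derivative (\<lambda>u. - act (W x u) (beta (\<xi> x) (T x)) v)) (at x)"
    unfolding beta_def[of "\<xi> _" "T _" v]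
    by (rule has_derivative_eq_rhs)
      (simp add: fun_eq_iff act_beta[OF P(1) W[OF x]] linear_neg[OF P(1)] algebra_simps)
qed

text \<open>The connection forms of \<open>T\<close> and \<open>T'\<close> differ by a multiple of
  \<open>T x u - T' x u\<close>, which acts trivially on \<open>T'\<close>.\<close>

lemma hom_field_change:
  fixes T T' :: "real^'n::finite \<Rightarrow> real^'n \<Rightarrow> real^'n^'n"
  assumes "parallel (Om T) T'" and "\<And>x u. x \<in> RH \<Longrightarrow> T x u - T' x u \<in> stab (T' x)"
  shows "hom_field T'"
  unfolding parallel_def
proof (intro ballI conjI allI)
  fix x v :: "real^'n" assume x: "x \<in> RH"
  note P = parallelD[OF assms(1) x]
  show "linear (T' x)" "skew (T' x v)" by (fact P)+
  have "act (Om T x u) (T' x) v = act (Om T' x u) (T' x) v" for u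
  proof -
    have "Om T' x u = Om T x u + conf x *\<^sub>R (T x u - T' x u)"
      by (simp add: Om_def algebra_simps)
    then show ?thesis
      using assms(2)[OF x, of u] by (simp add: act_simps[OF P(1)] stab_iff_act)
  qed
  then show "((\<lambda>y. T' y v) has_derivative (\<lambda>u. - act (Om T' x u) (T' x) v)) (at x)"
    using P(3)[of v] by simp
qed

section \<open>The two types of homogeneous tensors\<close>

text \<open>The trace is a parallel vector field for a skew connection, so its length is
  constant.\<close>

lemma mtr_norm_constant:
  assumes T: "hom_field T" and xy: "x \<in> RH" "y \<in> RH"
  shows "mtr (T x) \<bullet> mtr (T x) = mtr (T y) \<bullet> mtr (T y)"
proof (rule has_derivative_zero_unique[of RH "\<lambda>z. mtr (T z) \<bullet> mtr (T z)", OF _ _ xy])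
  show "convex (RH :: (real^'a) set)" by (simp add: RH_def)
  fix z :: "real^'a" assume z: "z \<in> RH"
  note D = mtr_derivative[OF T z skew_Om[OF T z]]
  have "((\<lambda>z. mtr (T z) \<bullet> mtr (T z)) has_derivative (\<lambda>u. 0)) (at z)"
    by (rule has_derivative_eq_rhs[OF has_derivative_inner[OF D D]])
      (simp add: fun_eq_iff skew_inner_self[OF skew_Om[OF T z]]
        inner_commute[of "mtr (T z)" "Om T z _ *v _"])
  then show "((\<lambda>z. mtr (T z) \<bullet> mtr (T z)) has_derivative (\<lambda>u. 0)) (at z within RH)"
    by (rule has_derivative_at_withinI)
qed

lemma flat_at:
  fixes T :: "real^'n::finite \<Rightarrow> real^'n \<Rightarrow> real^'n^'n"
  assumes n: "CARD('n) > 1" and T: "hom_field T" and x: "x \<in> RH" and "mtr (T x) = 0" and "skew A"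
  shows "A \<in> stab (T x)"
proof (rule hyperbolic_model.trace_dichotomy[OF hyperbolic_model_hom_field[OF T x] n])
  fix \<xi> assume "norm \<xi> = 1" "mtr (T x) = (real CARD('n) - 1) *\<^sub>R \<xi>"
  then have False using assms(4) n by auto
  then show ?thesis by simp
qed (use assms(5) in blast)

lemma horospherical_at:
  fixes T :: "real^'n::finite \<Rightarrow> real^'n \<Rightarrow> real^'n^'n"
  assumes n: "CARD('n) > 1" and T: "hom_field T" and x: "x \<in> RH" and "mtr (T x) \<noteq> 0"
    and \<xi>_def: "\<xi> = (1 / (real CARD('n) - 1)) *\<^sub>R mtr (T x)"
  shows "norm \<xi> = 1" "T x Y *v \<xi> = (Y \<bullet> \<xi>) *\<^sub>R \<xi> - Y" "w \<bullet> \<xi> = 0 \<Longrightarrow> T x w - wedge \<xi> w \<in> stab (T x)"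
    "A \<in> stab (T x) \<Longrightarrow> A *v \<xi> = 0"
proof -
  obtain \<zeta> where \<zeta>: "norm \<zeta> = 1" "mtr (T x) = (real CARD('n) - 1) *\<^sub>R \<zeta>"
      "\<And>Y. T x Y *v \<zeta> = (Y \<bullet> \<zeta>) *\<^sub>R \<zeta> - Y" "\<And>w. w \<bullet> \<zeta> = 0 \<Longrightarrow> T x w - wedge \<zeta> w \<in> stab (T x)"
      "\<And>A. A \<in> stab (T x) \<Longrightarrow> A *v \<zeta> = 0"
    using hyperbolic_model.trace_dichotomy[OF hyperbolic_model_hom_field[OF T x] n] assms(4) by blast
  have "\<xi> = \<zeta>" using \<zeta>(2) n by (simp add: \<xi>_def)
  then show "norm \<xi> = 1" "T x Y *v \<xi> = (Y \<bullet> \<xi>) *\<^sub>R \<xi> - Y" "w \<bullet> \<xi> = 0 \<Longrightarrow> T x w - wedge \<xi> w \<in> stab (T x)"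
    "A \<in> stab (T x) \<Longrightarrow> A *v \<xi> = 0"
    using \<zeta> by auto
qed

text \<open>Restates the type as the solvability of an equation that an isometry carries over
  directly, see \<open>isometry_horospherical\<close>.\<close>

lemma mtr_eq_0_iff:
  fixes T :: "real^'n::finite \<Rightarrow> real^'n \<Rightarrow> real^'n^'n"
  assumes n: "CARD('n) > 1" and T: "hom_field T" and x: "x \<in> RH"
  shows "mtr (T x) = 0 \<longleftrightarrow> \<not> (\<exists>\<xi>. \<forall>Y. T x Y *v \<xi> = (Y \<bullet> \<xi>) *\<^sub>R \<xi> - Y)"
proof
  assume m: "mtr (T x) = 0"
  show "\<not> (\<exists>\<xi>. \<forall>Y. T x Y *v \<xi> = (Y \<bullet> \<xi>) *\<^sub>R \<xi> - Y)"
  proof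
    assume "\<exists>\<xi>. \<forall>Y. T x Y *v \<xi> = (Y \<bullet> \<xi>) *\<^sub>R \<xi> - Y"
    then obtain \<xi> where \<xi>: "\<And>Y. T x Y *v \<xi> = (Y \<bullet> \<xi>) *\<^sub>R \<xi> - Y" by blast
    have "\<xi> \<noteq> 0"
    proof
      assume "\<xi> = 0"
      then have "axis undefined 1 = (0 :: real^'n)" using \<xi>[of "axis undefined 1"] by simp
      then show False by (simp add: axis_eq_0_iff)
    qed
    then have "wedge Y Z *v \<xi> = 0" for Y Z
      by (intro stab_kills_direction[OF parallelD(2)[OF T x] \<xi>] flat_at[OF n T x m] skew_wedge)
    then show False using not_all_skew_kill[OF n] \<open>\<xi> \<noteq> 0\<close> by blast
  qed
next
  assume no: "\<not> (\<exists>\<xi>. \<forall>Y. T x Y *v \<xi> = (Y \<bullet> \<xi>) *\<^sub>R \<xi> - Y)"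
  show "mtr (T x) = 0"
    using horospherical_at(2)[OF n T x _ refl] no by blast
qed

lemma mtr_zero_propagates:
  assumes "hom_field T" "x \<in> RH" "y \<in> RH"
  shows "mtr (T x) = 0 \<longleftrightarrow> mtr (T y) = 0"
  using mtr_norm_constant[OF assms] by (metis inner_eq_zero_iff)

section \<open>Deformation paths and the models attached to boundary points\<close>

section \<open>Deformations\<close>

lemma hom_field_scale:
  fixes T :: "real^'n::finite \<Rightarrow> real^'n \<Rightarrow> real^'n^'n"
  assumes n: "CARD('n) > 1" and T: "hom_field T" and p: "p \<in> RH" "mtr (T p) = 0"
  shows "hom_field (\<lambda>x v. t *\<^sub>R T x v)"
proof (rule hom_field_change[of T])
  show "parallel (Om T) (\<lambda>x v. t *\<^sub>R T x v)"
    using parallel_combination[OF T T, of t 0] by simp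
  fix x u :: "real^'n" assume x: "x \<in> RH"
  have "T x u - t *\<^sub>R T x u \<in> stab (T x)"
    using flat_at[OF n T x] mtr_zero_propagates[OF T p(1) x] p(2) parallelD(2)[OF T x]
    by (simp add: skew_diff skew_scaleR)
  then show "T x u - t *\<^sub>R T x u \<in> stab (\<lambda>v. t *\<^sub>R T x v)"
    by (simp add: stab_iff_act act_scale_field)
qed

definition direction :: "(real^'n \<Rightarrow> real^'n \<Rightarrow> real^'n^'n) \<Rightarrow> real^'n::finite \<Rightarrow> real^'n" where
  "direction T x = (1 / (real CARD('n) - 1)) *\<^sub>R mtr (T x)"

text \<open>For a unit direction \<xi> this is \<open>wedge \<xi>\<close> on vectors orthogonal to
  \<xi>, and t T \<xi> at \<xi> itself. So t = 1 changes only the transverse part of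
  \<open>T\<close>, and t = 0 is the model \<open>wedge \<xi>\<close>.\<close>

definition axial :: "real \<Rightarrow> (real^'n \<Rightarrow> real^'n \<Rightarrow> real^'n^'n) \<Rightarrow> real^'n::finite \<Rightarrow> real^'n \<Rightarrow> real^'n^'n" where
  "axial t T x v = wedge (direction T x) v + t *\<^sub>R beta (direction T x) (T x) v"

lemma direction_derivative:
  assumes T: "hom_field T" and x: "x \<in> RH"
  shows "(direction T has_derivative (\<lambda>u. - (Om T x u *v direction T x))) (at x)"
  unfolding direction_def[abs_def]
  by (rule has_derivative_eq_rhs[OF has_derivative_scaleR_right[OF mtr_derivative[OF T x skew_Om[OF T x]]]])
    (simp add: fun_eq_iff algebra_simps)

lemma parallel_axial:
  assumes T: "hom_field T"
  shows "parallel (Om T) (axial t T)"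
proof -
  note D = direction_derivative[OF T] and W = skew_Om[OF T]
  show ?thesis
    using parallel_combination[OF parallel_wedge[OF D W] parallel_beta[OF D W T], of 1 t]
    by (simp add: axial_def[abs_def])
qed

context
  fixes T :: "real^'n::finite \<Rightarrow> real^'n \<Rightarrow> real^'n^'n" and p :: "real^'n"
  assumes n: "CARD('n) > 1" and T: "hom_field T" and p: "p \<in> RH" "mtr (T p) \<noteq> 0"
begin

lemma stab_axial:
  assumes x: "x \<in> RH" and A: "A \<in> stab (T x)"
  shows "A \<in> stab (axial t T x)"
proof -
  have m: "mtr (T x) \<noteq> 0" using mtr_zero_propagates[OF T p(1) x] p(2) by simp
  have "A *v direction T x = 0"
    by (rule horospherical_at(4)[OF n T x m direction_def[of T x] A])
  moreover have "skew A" "act A (T x) v = 0" for v using A by (auto simp: stab_iff_act)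
  ultimately show ?thesis
    using parallelD(1)[OF T x]
    by (simp add: stab_iff_act axial_def[abs_def] act_add_field act_scale_field act_wedge act_beta
        linear_0 linear_0[OF linear_wedge(2)])
qed

text \<open>Both fields agree at \<xi>, so only the component of \<open>u\<close> orthogonal to
  \<xi> matters; there \<open>horospherical_at\<close> applies.\<close>

lemma transverse_mem_stab:
  assumes x: "x \<in> RH"
  shows "T x u - axial 1 T x u \<in> stab (T x)"
proof -
  have m: "mtr (T x) \<noteq> 0" using mtr_zero_propagates[OF T p(1) x] p(2) by simp
  let ?\<xi> = "direction T x"
  note H = horospherical_at[OF n T x m direction_def[of T x]]
  have \<xi>\<xi>: "?\<xi> \<bullet> ?\<xi> = 1" using H(1) by (simp add: norm_eq_1)
  have "wedge ?\<xi> ?\<xi> = 0" by (simp add: wedge_def vec_eq_iff)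
  then have "T x (u - (?\<xi> \<bullet> u) *\<^sub>R ?\<xi>) - wedge ?\<xi> (u - (?\<xi> \<bullet> u) *\<^sub>R ?\<xi>) = T x u - axial 1 T x u"
    by (simp add: axial_def beta_def linear_diff[OF parallelD(1)[OF T x]] linear_scale[OF parallelD(1)[OF T x]]
        linear_diff[OF linear_wedge(1)] linear_scale[OF linear_wedge(1)])
  moreover have "(u - (?\<xi> \<bullet> u) *\<^sub>R ?\<xi>) \<bullet> ?\<xi> = 0" by (simp add: inner_simps \<xi>\<xi> inner_commute)
  ultimately show ?thesis using H(3) by metis
qed

lemma hom_field_towards_axial: "hom_field (\<lambda>x v. s *\<^sub>R T x v + (1 - s) *\<^sub>R axial 1 T x v)"
proof (rule hom_field_change[of T])
  show "parallel (Om T) (\<lambda>x v. s *\<^sub>R T x v + (1 - s) *\<^sub>R axial 1 T x v)"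
    by (rule parallel_combination[OF T parallel_axial[OF T]])
  fix x u :: "real^'n" assume x: "x \<in> RH"
  let ?A = "T x u - (s *\<^sub>R T x u + (1 - s) *\<^sub>R axial 1 T x u)"
  have "?A = (1 - s) *\<^sub>R (T x u - axial 1 T x u)" by (simp add: algebra_simps)
  then have "?A \<in> stab (T x)"
    using transverse_mem_stab[OF x] subspace_stab[OF parallelD(1)[OF T x]] by (simp add: subspace_scale)
  then show "?A \<in> stab (\<lambda>v. s *\<^sub>R T x v + (1 - s) *\<^sub>R axial 1 T x v)"
    using stab_axial[OF x, of ?A 1] by (simp add: stab_iff_act act_add_field act_scale_field)
qed

text \<open>T \<xi> kills \<xi> and commutes with itself, hence stabilizes both summands of
  \<open>axial t T\<close>. The difference from \<open>T\<close> is a transverse element plus a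
  multiple of T \<xi>.\<close>

lemma hom_field_axial: "hom_field (axial t T)"
proof (rule hom_field_change[of T, OF parallel_axial[OF T]])
  fix x u :: "real^'n" assume x: "x \<in> RH"
  let ?\<xi> = "direction T x"
  have m: "mtr (T x) \<noteq> 0" using mtr_zero_propagates[OF T p(1) x] p(2) by simp
  note H = horospherical_at[OF n T x m direction_def[of T x]]
  have "?\<xi> \<bullet> ?\<xi> = 1" using H(1) by (simp add: norm_eq_1)
  then have T\<xi>: "T x ?\<xi> *v ?\<xi> = 0" using H(2)[of ?\<xi>] by simp
  note P = parallelD[OF T x] and PA = parallelD(1)[OF parallel_axial[OF T] x, of t]
  have "comm (T x ?\<xi>) (T x ?\<xi>) = 0" by (simp add: comm_def)
  then have "T x ?\<xi> \<in> stab (axial t T x)"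
    using P T\<xi>
    by (simp add: stab_iff_act axial_def[abs_def] act_add_field act_scale_field act_wedge act_beta
        linear_0 linear_0[OF linear_wedge(2)] act_def[of _ "T x"])
  moreover have "T x u - axial t T x u = (T x u - axial 1 T x u) + ((1 - t) * (?\<xi> \<bullet> u)) *\<^sub>R T x ?\<xi>"
    by (simp add: axial_def beta_def algebra_simps)
  ultimately show "T x u - axial t T x u \<in> stab (axial t T x)"
    using stab_axial[OF x transverse_mem_stab[OF x]] subspace_stab[OF PA]
    by (simp only: subspace_add subspace_scale)
qed

end

section \<open>Horospherical fields\<close>

text \<open>
  The unit field pointing towards the boundary point \<open>b\<close>, with the Poisson kernel as a factor.
\<close>

definition towards :: "real^'n::finite \<Rightarrow> real^'n \<Rightarrow> real^'n" where
  "towards b x = ((1 - x \<bullet> x) / ((b - x) \<bullet> (b - x))) *\<^sub>R (b - x) - x"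

lemma towards_aux:
  assumes "norm b = 1" "x \<in> RH"
  shows "(b - x) \<bullet> (b - x) > 0" "1 - x \<bullet> x = (b - x) \<bullet> (b - x) + 2 * ((b - x) \<bullet> x)"
proof -
  have "b \<noteq> x" using assms by (auto simp: RH_def)
  then show "(b - x) \<bullet> (b - x) > 0" by simp
  have "b \<bullet> b = 1" using assms(1) by (simp add: norm_eq_1)
  then show "1 - x \<bullet> x = (b - x) \<bullet> (b - x) + 2 * ((b - x) \<bullet> x)"
    by (simp add: inner_simps inner_commute)
qed

lemma norm_towards:
  assumes b: "norm b = 1" and x: "x \<in> RH"
  shows "norm (towards b x) = 1"
proof -
  define r where "r = b - x"
  define R where "R = r \<bullet> r"
  define q where "q = 1 - x \<bullet> x"
  have R: "R > 0" and qr: "r \<bullet> x = (q - R) / 2"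
    using towards_aux[OF assms] by (simp_all add: r_def R_def q_def)
  have xx: "x \<bullet> x = 1 - q" by (simp add: q_def)
  have "towards b x \<bullet> towards b x = (q / R) * (q / R) * R - 2 * (q / R) * (r \<bullet> x) + x \<bullet> x"
    unfolding towards_def q_def[symmetric] r_def[symmetric] R_def[symmetric]
    by (simp add: inner_diff_left inner_diff_right inner_commute R_def[symmetric])
  also have "\<dots> = 1" using R unfolding qr xx by (simp add: field_simps)
  finally show ?thesis by (simp add: norm_eq_1)
qed

lemma hom_field_towards:
  fixes b :: "real^'n::finite"
  assumes b: "norm b = 1"
  shows "hom_field (\<lambda>x. wedge (towards b x))"
proof (rule parallel_wedge)
  fix x :: "real^'n" and u assume x: "x \<in> RH"
  show "skew (Om (\<lambda>x. wedge (towards b x)) x u)" by (auto simp: Om_def intro!: skew_scaleR skew_diff)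
next
  fix x :: "real^'n" assume x: "x \<in> RH"
  define r where "r = b - x"
  define R where "R = r \<bullet> r"
  define q where "q = 1 - x \<bullet> x"
  define \<xi> where "\<xi> = towards b x"
  have R: "R > 0" and qr: "x \<bullet> r = (q - R) / 2"
    using towards_aux[OF b x] by (simp_all add: r_def R_def q_def inner_commute)
  have q: "q > 0" using RH_pos[OF x] by (simp add: q_def)
  have \<xi>_eq: "\<xi> = (q / R) *\<^sub>R r - x" by (simp add: \<xi>_def towards_def r_def R_def q_def)
  have xx: "x \<bullet> x = 1 - q" by (simp add: q_def)
  have dq: "((\<lambda>y. 1 - y \<bullet> y) has_derivative (\<lambda>h. - 2 * (x \<bullet> h))) (at x)"
    by (auto intro!: derivative_eq_intros simp: inner_commute)
  have dr: "((\<lambda>y. b - y) has_derivative (\<lambda>h. - h)) (at x)"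
    by (auto intro!: derivative_eq_intros)
  have dR: "((\<lambda>y. (b - y) \<bullet> (b - y)) has_derivative (\<lambda>h. - 2 * (r \<bullet> h))) (at x)"
    by (rule has_derivative_eq_rhs[OF has_derivative_inner[OF dr dr]])
      (simp add: fun_eq_iff r_def inner_commute)
  have "(b - x) \<bullet> (b - x) \<noteq> 0" using R by (simp add: R_def r_def)
  note dP = has_derivative_divide[OF dq dR this]
  have d\<xi>: "(towards b has_derivative (\<lambda>h. (q / R) *\<^sub>R (- h) +
      (- q * (inverse R * (- 2 * (r \<bullet> h)) * inverse R) + (- 2 * (x \<bullet> h)) / R) *\<^sub>R r - h)) (at x)"
    unfolding towards_def[abs_def]
    using has_derivative_diff[OF has_derivative_scaleR[OF dP dr] has_derivative_ident]
    by (simp only: q_def r_def R_def)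
  \<comment> \<open>Both sides of the parallelism equation are combinations of \<open>h\<close> and
    \<open>r\<close>. This matches the coefficients of \<open>h\<close>; \<open>c2\<close> matches
    those of \<open>r\<close>, where the derivative of the Poisson factor q / R appears.\<close>
  have c1: "conf x * (x \<bullet> \<xi> + \<xi> \<bullet> \<xi>) = q / R + 1"
  proof -
    have "x \<bullet> \<xi> + \<xi> \<bullet> \<xi> = (q / R) * (q / R) * R - (q / R) * (x \<bullet> r)"
      by (simp add: \<xi>_eq inner_diff_left inner_diff_right inner_commute[of r x] R_def[symmetric]
          right_diff_distrib diff_divide_distrib)
    then show ?thesis using q R by (simp add: conf_def q_def[symmetric] qr field_simps)
  qed
  have c2: "conf x * (h \<bullet> \<xi>) * (q / R) = - q * (inverse R * (- 2 * (r \<bullet> h)) * inverse R) + (- 2 * (x \<bullet> h)) / R" for h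
    using q R by (simp add: conf_def q_def[symmetric] \<xi>_eq inner_diff_right inner_commute[of h] field_simps)
  have "- (Om (\<lambda>x. wedge (towards b x)) x h *v towards b x) =
      (q / R) *\<^sub>R (- h) +
      (- q * (inverse R * (- 2 * (r \<bullet> h)) * inverse R) + (- 2 * (x \<bullet> h)) / R) *\<^sub>R r - h" for h
  proof -
    have "- (Om (\<lambda>x. wedge (towards b x)) x h *v towards b x) =
        (conf x * (h \<bullet> \<xi>)) *\<^sub>R (\<xi> + x) - (conf x * (x \<bullet> \<xi> + \<xi> \<bullet> \<xi>)) *\<^sub>R h"
      by (simp add: Om_def mat_simps \<xi>_def[symmetric] inner_commute[of \<xi> h] algebra_simps)
    also have "(conf x * (h \<bullet> \<xi>)) *\<^sub>R (\<xi> + x) = (conf x * (h \<bullet> \<xi>) * (q / R)) *\<^sub>R r"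
      by (simp add: \<xi>_eq)
    finally show ?thesis unfolding c1 c2 by (simp add: scaleR_add_left)
  qed
  then show "(towards b has_derivative (\<lambda>h. - (Om (\<lambda>x. wedge (towards b x)) x h *v towards b x))) (at x)"
    using d\<xi> by presburger
qed

lemma towards_surj:
  assumes p: "p \<in> RH" and \<xi>: "norm \<xi> = 1"
  obtains b where "norm b = 1" "towards b p = \<xi>"
proof -
  define v where "v = \<xi> + p"
  define q where "q = 1 - p \<bullet> p"
  \<comment> \<open>By definition \<open>towards b p + p\<close> is the image of b - p under the
    inversion r -> (q / (r \<bullet> r)) r. An inversion is its own inverse, so b - p is the image
    of v.\<close>
  define b where "b = p + (q / (v \<bullet> v)) *\<^sub>R v"
  have q: "q > 0" using RH_pos[OF p] by (simp add: q_def)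
  have "\<xi> \<noteq> - p" using p \<xi> by (auto simp: RH_def)
  then have v: "v \<bullet> v > 0" by (simp add: v_def add_eq_0_iff2)
  have "\<xi> \<bullet> \<xi> = 1" using \<xi> by (simp add: norm_eq_1)
  then have vv: "v \<bullet> v = 2 * (p \<bullet> v) + q"
    by (simp add: v_def q_def inner_simps inner_commute)
  have pp: "p \<bullet> p = 1 - q" by (simp add: q_def)
  have pv: "p \<bullet> v = (v \<bullet> v - q) / 2" using vv by simp
  have "b \<bullet> b = p \<bullet> p + 2 * (q / (v \<bullet> v)) * (p \<bullet> v) + (q / (v \<bullet> v)) * (q / (v \<bullet> v)) * (v \<bullet> v)"
    by (simp add: b_def inner_add_left inner_add_right inner_commute)
  also have "\<dots> = 1" unfolding pv pp using v by (simp add: field_simps)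
  finally have "norm b = 1" by (simp add: norm_eq_1)
  moreover have "towards b p = \<xi>"
  proof -
    have R: "(b - p) \<bullet> (b - p) = q * q / (v \<bullet> v)" using v by (simp add: b_def)
    have "(1 - p \<bullet> p) / ((b - p) \<bullet> (b - p)) = v \<bullet> v / q"
      unfolding q_def[symmetric] R using q v by simp
    then have "towards b p = (v \<bullet> v / q * (q / (v \<bullet> v))) *\<^sub>R v - p"
      by (simp add: towards_def b_def)
    also have "\<dots> = v - p" using q v by simp
    finally show ?thesis by (simp add: v_def)
  qed
  ultimately show ?thesis using that by blast
qed

section \<open>Smoothness, and the dictionary between tensors and parallel fields\<close>

section \<open>Smooth maps\<close>

lemma Ck_on_cong:
  assumes M: "open M" and eq: "\<And>x. x \<in> M \<Longrightarrow> f x = g x" and f: "Ck_on k M f"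
  shows "Ck_on k M g"
  using eq f
proof (induction k arbitrary: f g)
  case 0
  then show ?case by (simp cong: continuous_on_cong)
next
  case (Suc k)
  have D: "(g has_derivative frechet_derivative f (at x)) (at x)" if x: "x \<in> M" for x
    using Suc.prems x
    by (intro has_derivative_transform_within_open[OF frechet_derivative_works[THEN iffD1] M x]) auto
  then have eq: "frechet_derivative f (at x) = frechet_derivative g (at x)" if "x \<in> M" for x
    using frechet_derivative_at that by blast
  have "Ck_on k M (\<lambda>x. frechet_derivative g (at x) v)" for v
  proof (rule Suc.IH)
    show "frechet_derivative f (at x) v = frechet_derivative g (at x) v" if "x \<in> M" for x
      by (simp only: eq[OF that])
    show "Ck_on k M (\<lambda>x. frechet_derivative f (at x) v)" using Suc.prems(2) by simp
  qed
  then show ?case using D by (auto simp: differentiable_def)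
qed

lemma Ck_on_SucI:
  assumes M: "open M" and D: "\<And>x. x \<in> M \<Longrightarrow> (f has_derivative f' x) (at x)"
    and C: "\<And>v. Ck_on k M (\<lambda>x. f' x v)"
  shows "Ck_on (Suc k) M f"
proof -
  have "Ck_on k M (\<lambda>x. frechet_derivative f (at x) v)" for v
    using frechet_derivative_at[OF D] by (intro Ck_on_cong[OF M _ C[of v]]) metis
  then show ?thesis using D by (auto simp: differentiable_def)
qed

lemma Ck_on_SucD:
  assumes "Ck_on (Suc k) M f"
  shows "x \<in> M \<Longrightarrow> (f has_derivative frechet_derivative f (at x)) (at x)"
    "Ck_on k M (\<lambda>x. frechet_derivative f (at x) v)"
  using assms by (auto simp: frechet_derivative_works)

lemma Ck_on_Suc_imp: "Ck_on (Suc k) M f \<Longrightarrow> Ck_on k M f"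
proof (induction k arbitrary: f)
  case 0
  then show ?case
    by (auto intro!: differentiable_imp_continuous_on simp: differentiable_on_def differentiable_at_withinI)
next
  case (Suc k)
  then show ?case by (simp del: Ck_on.simps(2) add: Ck_on.simps(2)[of "Suc k"] Ck_on.simps(2)[of k])
qed

lemma has_derivative_imp_continuous_on:
  "(\<And>x. x \<in> M \<Longrightarrow> (f has_derivative f' x) (at x)) \<Longrightarrow> continuous_on M f"
  by (meson continuous_at_imp_continuous_on has_derivative_continuous)

lemma Ck_on_const: "Ck_on k M (\<lambda>x. c)"
  by (induction k arbitrary: c) auto

lemma Ck_on_bounded_linear:
  assumes L: "bounded_linear L" and M: "open M" and "Ck_on k M f"
  shows "Ck_on k M (\<lambda>x. L (f x))"
  using assms(3)
proof (induction k arbitrary: f)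
  case 0
  then show ?case by (simp add: bounded_linear.continuous_on[OF L])
next
  case (Suc k)
  show ?case
    by (rule Ck_on_SucI[OF M bounded_linear.has_derivative[OF L Ck_on_SucD(1)[OF Suc.prems]]])
      (auto intro!: Suc.IH Ck_on_SucD(2)[OF Suc.prems])
qed

lemma Ck_on_add:
  assumes M: "open M" and "Ck_on k M f" "Ck_on k M g"
  shows "Ck_on k M (\<lambda>x. f x + g x)"
  using assms(2,3)
proof (induction k arbitrary: f g)
  case 0
  then show ?case by (simp add: continuous_on_add)
next
  case (Suc k)
  show ?case
    by (rule Ck_on_SucI[OF M has_derivative_add[OF Ck_on_SucD(1)[OF Suc.prems(1)] Ck_on_SucD(1)[OF Suc.prems(2)]]])
      (auto intro!: Suc.IH Ck_on_SucD(2)[OF Suc.prems(1)] Ck_on_SucD(2)[OF Suc.prems(2)])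
qed

lemma Ck_on_sum:
  assumes M: "open M" and "\<And>i. i \<in> I \<Longrightarrow> Ck_on k M (f i)"
  shows "Ck_on k M (\<lambda>x. \<Sum>i\<in>I. f i x)"
  using assms(2)
  by (induction I rule: infinite_finite_induct) (auto intro!: Ck_on_add[OF M] Ck_on_const)

lemma Ck_on_bilinear:
  assumes B: "bounded_bilinear B" and M: "open M" and "Ck_on k M f" "Ck_on k M g"
  shows "Ck_on k M (\<lambda>x. B (f x) (g x))"
  using assms(3,4)
proof (induction k arbitrary: f g)
  case 0
  then show ?case by (simp add: bounded_bilinear.continuous_on[OF B])
next
  case (Suc k)
  note fg = Ck_on_Suc_imp[OF Suc.prems(1)] Ck_on_Suc_imp[OF Suc.prems(2)]
  show ?case
    by (rule Ck_on_SucI[OF M bounded_bilinear.FDERIV[OF B Ck_on_SucD(1)[OF Suc.prems(1)] Ck_on_SucD(1)[OF Suc.prems(2)]]])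
      (auto intro!: Ck_on_add[OF M] Suc.IH fg Ck_on_SucD(2)[OF Suc.prems(1)] Ck_on_SucD(2)[OF Suc.prems(2)])
qed

lemma Ck_on_ident: "open M \<Longrightarrow> Ck_on k M (\<lambda>x. x)"
proof (cases k)
  case (Suc j)
  assume "open M"
  then show ?thesis unfolding Suc by (rule Ck_on_SucI[where f' = "\<lambda>x h. h"]) (auto intro: Ck_on_const)
qed simp

lemma Ck_on_conf: "Ck_on k RH conf"
proof (induction k)
  case 0
  show ?case using has_derivative_imp_continuous_on[OF conf_derivative] by simp
next
  case (Suc k)
  have "Ck_on k RH (\<lambda>x. (conf x * conf x) * (x \<bullet> v))" for v :: "real^'a"
    by (intro Ck_on_bilinear[OF bounded_bilinear_mult open_RH] Suc
        Ck_on_bounded_linear[OF bounded_linear_inner_left open_RH] Ck_on_ident open_RH)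
  then show ?case
    by (intro Ck_on_SucI[OF open_RH conf_derivative]) (simp_all add: power2_eq_square)
qed

text \<open>
  The parallelism equation expresses the derivatives of \<open>T\<close> polynomially in \<open>T\<close> itself.
\<close>

lemma Ck_on_hom_field:
  assumes T: "hom_field T"
  shows "Ck_on k RH (\<lambda>x. T x v)"
proof (induction k arbitrary: v)
  case 0
  show ?case using has_derivative_imp_continuous_on[OF parallelD(3)[OF T]] by simp
next
  case (Suc k)
  have Om: "Ck_on k RH (\<lambda>x. Om T x u)" for u
  proof -
    have "Ck_on k RH (\<lambda>x. conf x *\<^sub>R (wedge u x + (-1) *\<^sub>R T x u))"
      by (intro Ck_on_bilinear[OF bounded_bilinear_scaleR open_RH] Ck_on_conf Ck_on_add open_RH Suc Ck_on_const
          Ck_on_bounded_linear[OF bounded_bilinear.bounded_linear_right[OF bounded_bilinear_wedge] open_RH] Ck_on_ident)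
    then show ?thesis by (simp add: Om_def)
  qed
  \<comment> \<open>Minus the action of \<open>Om\<close>, with \<open>T\<close> of a moving vector
    expanded in the basis, so that only products of maps known to be of class C^k occur.\<close>
  have "Ck_on k RH (\<lambda>x. (-1) *\<^sub>R comm (Om T x u) (T x v) + (\<Sum>i\<in>UNIV. (Om T x u *v v) $ i *\<^sub>R T x (axis i 1)))" for u
    by (intro Ck_on_add open_RH Ck_on_sum Ck_on_bilinear[OF bounded_bilinear_scaleR open_RH] Ck_on_const Suc
        Ck_on_bilinear[OF bounded_bilinear_comm open_RH] Om
        Ck_on_bounded_linear[OF bounded_linear_vec_nth open_RH]
        Ck_on_bounded_linear[OF bounded_bilinear.bounded_linear_left[OF bounded_bilinear_mat_apply] open_RH])
  then have "Ck_on k RH (\<lambda>x. - act (Om T x u) (T x) v)" for u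
    by (rule Ck_on_cong[OF open_RH, rotated])
      (simp add: act_def linear_axis_expansion[OF parallelD(1)[OF T], symmetric])
  then show ?case by (intro Ck_on_SucI[OF open_RH parallelD(3)[OF T]])
qed

section \<open>The correspondence between tensors and fields\<close>

definition tens :: "'a::real_inner \<Rightarrow> 'b::real_normed_vector \<Rightarrow> 'a \<Rightarrow>\<^sub>L 'b" where
  "tens a B = blinfun_scaleR_left B o\<^sub>L blinfun_inner_right a"

lemma tens_apply [simp]: "blinfun_apply (tens a B) u = (a \<bullet> u) *\<^sub>R B"
  by (simp add: tens_def)

lemma bounded_linear_tens: "bounded_linear (tens a)"
  unfolding tens_def[abs_def]
  by (rule bounded_linear_compose[OF bounded_bilinear.bounded_linear_left[OF bounded_bilinear_blinfun_compose]
        bounded_linear_blinfun_scaleR_left])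

text \<open>A finite sum of rank one maps, so smoothness in the point and continuity in a parameter
  reduce to the components.\<close>

definition of_components :: "(real^'n \<Rightarrow> real^'n \<Rightarrow> real^'n) \<Rightarrow> (real^'n::finite) \<Rightarrow>\<^sub>L (real^'n) \<Rightarrow>\<^sub>L (real^'n)" where
  "of_components f = (\<Sum>i\<in>UNIV. \<Sum>j\<in>UNIV. tens (axis i 1) (tens (axis j 1) (f (axis i 1) (axis j 1))))"

lemma of_components_apply:
  assumes "bilinear f"
  shows "blinfun_apply (blinfun_apply (of_components f) u) v = f u v"
proof -
  have l: "linear (\<lambda>u. f u v)" "linear (f u)" for u v using assms by (auto simp: bilinear_def)
  have "blinfun_apply (blinfun_apply (of_components f) u) v =
      (\<Sum>i\<in>UNIV. \<Sum>j\<in>UNIV. (u $ i) *\<^sub>R (v $ j) *\<^sub>R f (axis i 1) (axis j 1))"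
    by (simp add: of_components_def blinfun.sum_left blinfun.scaleR_left inner_axis')
  also have "\<dots> = (\<Sum>i\<in>UNIV. (u $ i) *\<^sub>R f (axis i 1) v)"
    by (subst linear_axis_expansion[OF l(2), of _ v]) (simp add: scaleR_sum_right)
  also have "\<dots> = f u v" by (rule linear_axis_expansion[OF l(1), symmetric])
  finally show ?thesis .
qed

definition tensor_of :: "(real^'n \<Rightarrow> real^'n \<Rightarrow> real^'n^'n) \<Rightarrow> 'n::finite bilinear_field" where
  "tensor_of T x = (if x \<in> RH then of_components (\<lambda>u v. conf x *\<^sub>R (T x u *v v)) else 0)"

definition field_of :: "'n::finite bilinear_field \<Rightarrow> real^'n \<Rightarrow> real^'n \<Rightarrow> real^'n^'n" where
  "field_of S x u = (\<chi> i j. (inverse (conf x) *\<^sub>R bil S x u (axis j 1)) $ i)"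

lemma bil_tensor_of:
  assumes "x \<in> RH" "linear (T x)"
  shows "bil (tensor_of T) x u v = conf x *\<^sub>R (T x u *v v)"
proof -
  have "bilinear (\<lambda>u v. conf x *\<^sub>R (T x u *v v))"
    using assms(2) by (auto simp: bilinear_def linear_add linear_scale mat_simps algebra_simps intro!: linearI)
  then show ?thesis using assms(1) by (simp add: tensor_of_def of_components_apply)
qed

lemma field_of_apply: "field_of S x u *v v = inverse (conf x) *\<^sub>R bil S x u v"
proof -
  have l: "linear (blinfun_apply (blinfun_apply (S x) u))"
    by (simp add: blinfun.bounded_linear_right bounded_linear.linear)
  show ?thesis
    by (subst linear_axis_expansion[OF l]) (simp add: field_of_def vec_eq_iff matrix_vector_mult_def sum_distrib_left mult_ac)
qed

lemma linear_field_of: "linear (field_of S x)"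
  by (intro linearI mat_eqI) (simp_all add: field_of_apply mat_simps blinfun.add_right blinfun.add_left
      blinfun.scaleR_right blinfun.scaleR_left algebra_simps)

lemma field_of_tensor_of:
  assumes "x \<in> RH" "linear (T x)" shows "field_of (tensor_of T) x = T x"
  using conf_pos[OF assms(1)] by (intro ext mat_eqI) (simp add: field_of_apply bil_tensor_of assms)

lemma tensor_of_field_of:
  assumes "\<And>x. x \<notin> RH \<Longrightarrow> S x = 0" shows "tensor_of (field_of S) = S"
proof
  fix x show "tensor_of (field_of S) x = S x"
  proof (cases "x \<in> RH")
    case True
    then show ?thesis using conf_pos[OF True]
      by (intro blinfun_eqI) (simp add: bil_tensor_of linear_field_of field_of_apply)
  qed (simp add: assms tensor_of_def)
qed

lemma has_derivative_matrixI:
  fixes F :: "'a::real_normed_vector \<Rightarrow> real^'n::finite^'n"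
  assumes "\<And>w. ((\<lambda>y. F y *v w) has_derivative (\<lambda>u. D u *v w)) (at x)"
  shows "(F has_derivative D) (at x)"
proof -
  define col :: "'n \<Rightarrow> real^'n \<Rightarrow> real^'n^'n" where "col j c = (\<chi> i k. c $ i * axis j 1 $ k)" for j c
  have colv: "col j c *v v = (v $ j) *\<^sub>R c" for j c v
    using inner_axis'[of j 1 v]
    by (simp add: col_def vec_eq_iff matrix_vector_mult_def inner_vec_def mult.assoc sum_distrib_left[symmetric])
  have "linear (col j)" for j by (intro linearI mat_eqI) (simp_all add: colv mat_simps algebra_simps)
  then have bl: "bounded_linear (col j)" for j by (simp add: linear_conv_bounded_linear)
  have exp: "A = (\<Sum>j\<in>UNIV. col j (A *v axis j 1))" for A
    by (rule mat_eqI) (simp add: mat_sum_apply colv linear_axis_expansion[OF matrix_vector_mul_linear, symmetric])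
  have "((\<lambda>y. \<Sum>j\<in>UNIV. col j (F y *v axis j 1)) has_derivative (\<lambda>u. \<Sum>j\<in>UNIV. col j (D u *v axis j 1))) (at x)"
    by (intro has_derivative_sum bounded_linear.has_derivative[OF bl] assms)
  then show ?thesis by (simp add: exp[symmetric])
qed

lemma conf_alt: "4 / (1 - (norm x)\<^sup>2)\<^sup>2 = (conf x)\<^sup>2" "4 / (1 - x \<bullet> x)\<^sup>2 = (conf x)\<^sup>2"
  by (simp_all add: conf_def power2_norm_eq_inner power_divide)

lemma ball_christoffel_conf:
  "ball_christoffel x u v = (conf x * (x \<bullet> u)) *\<^sub>R v + (conf x *\<^sub>R wedge u x) *v v"
  by (simp add: ball_christoffel_def conf_def mat_simps algebra_simps)

context
  fixes s :: real
  assumes s: "s < 0"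
begin

lemma hyperbolic_metric_conf:
  assumes n: "CARD('n::finite) > 1"
  shows "\<exists>c\<noteq>0. \<forall>x u v. hyperbolic_metric s x u v = c * (conf x)\<^sup>2 * (u \<bullet> (v :: real^'n))"
  using n s by (intro exI[of _ "- (real CARD('n) * (real CARD('n) - 1) / s)"])
    (simp add: hyperbolic_metric_def conf_alt)

lemma homogeneous_tensor_field_of:
  assumes n: "CARD('n::finite) > 1" and S: "homogeneous_tensor RH (hyperbolic_metric s) (S :: 'n bilinear_field)"
  shows "hom_field (field_of S)"
  unfolding parallel_def
proof (intro ballI conjI allI)
  fix x v :: "real^'n" assume x: "x \<in> RH"
  obtain c where c: "c \<noteq> 0" "\<And>x u v. hyperbolic_metric s x u v = c * (conf x)\<^sup>2 * (u \<bullet> (v :: real^'n))"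
    using hyperbolic_metric_conf[OF n] by blast
  note cx = conf_pos[OF x]
  have sm: "Ck_on (Suc 0) RH S" using S by (auto simp: homogeneous_tensor_def smooth_on_def simp del: Ck_on.simps)
  have nm: "nabla_metric (\<lambda>x. ball_connection x - S x) (hyperbolic_metric s) x u v w = 0"
    and nb: "nabla_bilinear (\<lambda>x. ball_connection x - S x) S x u v w = 0" for u v w
    using S x by (auto simp: homogeneous_tensor_def levi_civita_RH[OF n s] Let_def)
  have nm0: "nabla_metric ball_connection (hyperbolic_metric s) x u v w = 0" for u v w :: "real^'n"
    using is_levi_civita_ball_connection[of s] x by (auto simp: is_levi_civita_def)
  show "linear (field_of S x)" by (rule linear_field_of)
  show sk: "skew (field_of S x u)" for u
  proof (rule skewI)
    fix v w
    \<comment> \<open>The difference of the metric equations for the two connections is algebraic in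
      \<open>S\<close>.\<close>
    have "c * (conf x)\<^sup>2 * (bil S x u v \<bullet> w + v \<bullet> bil S x u w) = 0"
      using nm[of u v w] nm0[of u v w] unfolding nabla_metric_def c(2)
      by (simp add: blinfun.diff_left inner_diff_left inner_diff_right algebra_simps)
    then have "bil S x u v \<bullet> w + v \<bullet> bil S x u w = 0" using c cx by simp
    then have "bil S x u v \<bullet> w = - (v \<bullet> bil S x u w)" by simp
    then show "(field_of S x u *v v) \<bullet> w = - (v \<bullet> (field_of S x u *v w))"
      by (simp add: field_of_apply)
  qed
  show "((\<lambda>y. field_of S y v) has_derivative (\<lambda>u. - act (Om (field_of S) x u) (field_of S x) v)) (at x)"
  proof (rule has_derivative_matrixI)
    fix w
    define D where "D u = dir_deriv u (\<lambda>y. bil S y v w) x" for u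
    have dS: "((\<lambda>y. bil S y v w) has_derivative D) (at x)"
    proof -
      have "(\<lambda>y. bil S y v w) differentiable (at x)"
        using has_derivative_compose[OF has_derivative_compose[OF Ck_on_SucD(1)[OF sm x]
              bounded_linear_imp_has_derivative[OF blinfun.bounded_linear_left[of v]]]
              bounded_linear_imp_has_derivative[OF blinfun.bounded_linear_left[of w]]]
        by (auto simp: differentiable_def)
      then show ?thesis unfolding D_def dir_deriv_def by (simp add: frechet_derivative_works)
    qed
    have di: "((\<lambda>y. inverse (conf y)) has_derivative (\<lambda>h. - (x \<bullet> h))) (at x)"
      by (rule has_derivative_eq_rhs[OF Deriv.has_derivative_inverse[OF _ conf_derivative[OF x]]])
        (use cx in \<open>simp_all add: fun_eq_iff power2_eq_square\<close>)
    have lS: "bil S x u v = conf x *\<^sub>R (field_of S x u *v v)" for u v using cx by (simp add: field_of_apply)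
    \<comment> \<open>The scalar part is the logarithmic derivative of \<open>conf\<close>; division
      by \<open>conf\<close> absorbs it, and the skew part remains.\<close>
    have G: "bil ball_connection x u v - bil S x u v = (conf x * (x \<bullet> u)) *\<^sub>R v + Om (field_of S) x u *v v" for u v
      by (simp add: bil_ball_connection[OF x] ball_christoffel_conf Om_def lS mat_simps algebra_simps)
    have D: "D u = conf x *\<^sub>R ((conf x * (x \<bullet> u)) *\<^sub>R (field_of S x v *v w) - act (Om (field_of S) x u) (field_of S x) v *v w)" for u
    proof -
      have "D u + ((conf x * (x \<bullet> u)) *\<^sub>R bil S x v w + Om (field_of S) x u *v bil S x v w)
          - bil S x ((conf x * (x \<bullet> u)) *\<^sub>R v + Om (field_of S) x u *v v) w
          - bil S x v ((conf x * (x \<bullet> u)) *\<^sub>R w + Om (field_of S) x u *v w) = 0"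
        using nb[of u v w] unfolding nabla_bilinear_def D_def[symmetric]
        by (simp add: blinfun.diff_left G)
      then show ?thesis
        unfolding lS
        by (simp add: act_def mat_simps linear_add[OF linear_field_of] linear_scale[OF linear_field_of] algebra_simps)
    qed
    have "((\<lambda>y. inverse (conf y) *\<^sub>R bil S y v w) has_derivative
        (\<lambda>h. inverse (conf x) *\<^sub>R D h + (- (x \<bullet> h)) *\<^sub>R bil S x v w)) (at x)"
      by (rule has_derivative_scaleR[OF di dS])
    then show "((\<lambda>y. field_of S y v *v w) has_derivative (\<lambda>u. (- act (Om (field_of S) x u) (field_of S x) v) *v w)) (at x)"
      unfolding field_of_apply[of S _ v w]
      by (rule has_derivative_eq_rhs) (use cx in \<open>simp add: fun_eq_iff D lS mat_simps algebra_simps\<close>)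
  qed
qed

lemma homogeneous_tensor_tensor_of:
  fixes T :: "real^'n \<Rightarrow> real^'n \<Rightarrow> real^'n::finite^'n"
  assumes n: "CARD('n) > 1" and T: "hom_field T"
  shows "homogeneous_tensor RH (hyperbolic_metric s) (tensor_of T)"
proof -
  have "smooth_on RH (tensor_of T)"
    unfolding smooth_on_def
  proof
    fix k
    have "Ck_on k RH (\<lambda>x. \<Sum>i\<in>UNIV. \<Sum>j\<in>UNIV. tens (axis i 1) (tens (axis j 1)
        (conf x *\<^sub>R (T x (axis i 1) *v axis j 1))))"
      by (intro Ck_on_sum open_RH Ck_on_bounded_linear[OF bounded_linear_tens open_RH]
          Ck_on_bilinear[OF bounded_bilinear_scaleR open_RH] Ck_on_conf
          Ck_on_bounded_linear[OF bounded_bilinear.bounded_linear_left[OF bounded_bilinear_mat_apply] open_RH]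
          Ck_on_hom_field[OF T])
    then show "Ck_on k RH (tensor_of T)"
      by (rule Ck_on_cong[OF open_RH, rotated]) (simp add: tensor_of_def of_components_def)
  qed
  moreover have "nabla_metric (\<lambda>x. ball_connection x - tensor_of T x) (hyperbolic_metric s) x u v w = 0 \<and>
      nabla_curvature (\<lambda>x. ball_connection x - tensor_of T x) (curvature ball_connection) x u v w z = 0 \<and>
      nabla_bilinear (\<lambda>x. ball_connection x - tensor_of T x) (tensor_of T) x u v w = 0"
    if x: "x \<in> RH" for x u v w z
  proof (intro conjI)
    note P = parallelD[OF T x]
    obtain c where c: "\<And>x u v. hyperbolic_metric s x u v = c * (conf x)\<^sup>2 * (u \<bullet> (v :: real^'n))"
      using hyperbolic_metric_conf[OF n] by blast
    note lS = bil_tensor_of[where T = T, OF x P(1)]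
    have G: "bil ball_connection x u v - bil (tensor_of T) x u v = (conf x * (x \<bullet> u)) *\<^sub>R v + Om T x u *v v" for u v
      by (simp add: bil_ball_connection[OF x] ball_christoffel_conf Om_def lS mat_simps algebra_simps)
    have "nabla_metric ball_connection (hyperbolic_metric s) x u v w = 0"
      using is_levi_civita_ball_connection[of s] x by (auto simp: is_levi_civita_def)
    moreover have "(T x u *v v) \<bullet> w + v \<bullet> (T x u *v w) = 0" using skew_inner[OF P(2)] by simp
    ultimately show "nabla_metric (\<lambda>x. ball_connection x - tensor_of T x) (hyperbolic_metric s) x u v w = 0"
      unfolding nabla_metric_def c
      by (simp add: blinfun.diff_left inner_diff_left inner_diff_right lS algebra_simps)
        (simp add: distrib_left[symmetric])
    have "((\<lambda>y. conf y *\<^sub>R (T y v *v w)) has_derivative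
        (\<lambda>u. conf x *\<^sub>R ((- act (Om T x u) (T x) v) *v w) + ((conf x)\<^sup>2 * (x \<bullet> u)) *\<^sub>R (T x v *v w))) (at x)"
      by (intro has_derivative_scaleR conf_derivative x
          bounded_linear.has_derivative[OF bounded_bilinear.bounded_linear_left[OF bounded_bilinear_mat_apply]] P(3))
    then have "((\<lambda>y. bil (tensor_of T) y v w) has_derivative
        (\<lambda>u. conf x *\<^sub>R ((- act (Om T x u) (T x) v) *v w) + ((conf x)\<^sup>2 * (x \<bullet> u)) *\<^sub>R (T x v *v w))) (at x)"
      by (rule has_derivative_transform_within_open[OF _ open_RH x]) (simp add: bil_tensor_of parallelD(1)[OF T])
    from dir_deriv_eqI[OF this]
    show "nabla_bilinear (\<lambda>x. ball_connection x - tensor_of T x) (tensor_of T) x u v w = 0"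
      unfolding nabla_bilinear_def
      by (simp add: blinfun.diff_left G)
        (simp add: lS act_def mat_simps linear_add[OF P(1)] linear_scale[OF P(1)] algebra_simps power2_eq_square)
    \<comment> \<open>The curvature is - conf^2 \<open>K\<close>, and \<open>K\<close> uses only the
      inner product, so a skew matrix acts on it as a derivation. This makes the curvature equation
      automatic.\<close>
    define K where "K v w z = (w \<bullet> z) *\<^sub>R v - (v \<bullet> z) *\<^sub>R w" for v w z :: "real^'n"
    have R: "curvature ball_connection y v w z = - ((conf y)\<^sup>2 *\<^sub>R K v w z)" if "y \<in> RH" for y v w z
      by (simp add: curvature_ball_connection[OF that] conf_alt K_def)
    have "((\<lambda>y. (conf y)\<^sup>2) has_derivative (\<lambda>u. 2 * conf x * ((conf x)\<^sup>2 * (x \<bullet> u)))) (at x)"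
      by (rule has_derivative_eq_rhs[OF has_derivative_power[OF conf_derivative[OF x], of 2]])
        (simp add: fun_eq_iff)
    then have "((\<lambda>y. - ((conf y)\<^sup>2 *\<^sub>R K v w z)) has_derivative
        (\<lambda>u. - ((2 * conf x * ((conf x)\<^sup>2 * (x \<bullet> u))) *\<^sub>R K v w z))) (at x)"
      by (intro has_derivative_minus has_derivative_scaleR_left)
    then have "((\<lambda>y. curvature ball_connection y v w z) has_derivative
        (\<lambda>u. - ((2 * conf x * ((conf x)\<^sup>2 * (x \<bullet> u))) *\<^sub>R K v w z))) (at x)"
      by (rule has_derivative_transform_within_open[OF _ open_RH x]) (simp add: R)
    note dR = dir_deriv_eqI[OF this]
    define A where "A = Om T x u"
    have skA: "skew A" unfolding A_def by (rule skew_Om[OF T x])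
    have AK: "A *v K v w z = K (A *v v) w z + K v (A *v w) z + K v w (A *v z)"
      by (simp add: K_def mat_simps skew_inner[OF skA] algebra_simps)
    have KL: "K (a *\<^sub>R v + v') w z = a *\<^sub>R K v w z + K v' w z"
      "K v (a *\<^sub>R w + w') z = a *\<^sub>R K v w z + K v w' z"
      "K v w (a *\<^sub>R z + z') = a *\<^sub>R K v w z + K v w z'" for a v v' w w' z z'
      by (simp_all add: K_def inner_simps algebra_simps)
    \<comment> \<open>The scalar parts balance: -2 from the derivative of conf^2, -1 from the value
      and +3 from the three arguments.\<close>
    have "- ((2 * conf x * ((conf x)\<^sup>2 * (x \<bullet> u))) *\<^sub>R K v w z)
        + ((conf x * (x \<bullet> u)) *\<^sub>R (- ((conf x)\<^sup>2 *\<^sub>R K v w z)) + A *v (- ((conf x)\<^sup>2 *\<^sub>R K v w z)))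
        - (- ((conf x)\<^sup>2 *\<^sub>R K ((conf x * (x \<bullet> u)) *\<^sub>R v + A *v v) w z))
        - (- ((conf x)\<^sup>2 *\<^sub>R K v ((conf x * (x \<bullet> u)) *\<^sub>R w + A *v w) z))
        - (- ((conf x)\<^sup>2 *\<^sub>R K v w ((conf x * (x \<bullet> u)) *\<^sub>R z + A *v z))) = 0"
      unfolding KL mat_apply_uminus matrix_vector_mult_scaleR AK
      by (simp add: vec_eq_iff algebra_simps)
    then show "nabla_curvature (\<lambda>x. ball_connection x - tensor_of T x) (curvature ball_connection) x u v w z = 0"
      unfolding nabla_curvature_def dR minus_blinfun.rep_eq G R[OF x] A_def[symmetric] .
  qed
  ultimately show ?thesis
    by (simp add: homogeneous_tensor_def levi_civita_RH[OF n s] Let_def tensor_of_def)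
qed

end

section \<open>Topology: invariance of the type, connectedness, the quotient\<close>

section \<open>Isomorphic tensors have the same type\<close>

lemma isometry_horospherical:
  fixes S S' :: "'n::finite bilinear_field"
  assumes n: "CARD('n) > 1" and s: "s < 0" and f: "riemannian_isometry RH (hyperbolic_metric s) f"
    and c: "carries RH f S S'" and x: "x \<in> RH"
  shows "(\<exists>\<xi>. \<forall>Y. field_of S x Y *v \<xi> = (Y \<bullet> \<xi>) *\<^sub>R \<xi> - Y) \<longleftrightarrow>
    (\<exists>\<xi>. \<forall>Y. field_of S' (f x) Y *v \<xi> = (Y \<bullet> \<xi>) *\<^sub>R \<xi> - Y)"
proof -
  define L where "L u = dir_deriv u f x" for u
  have fx: "f x \<in> RH" using f x by (auto simp: riemannian_isometry_def bij_betw_def)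
  have "Ck_on (Suc 0) RH f" using f by (auto simp: riemannian_isometry_def smooth_on_def simp del: Ck_on.simps)
  from has_derivative_linear[OF Ck_on_SucD(1)[OF this x]]
  have lin: "linear L" by (simp add: L_def[abs_def] dir_deriv_def)
  \<comment> \<open>With this factor r L is orthogonal: it is the differential in the two
    orthonormal frames. It takes a solution \<xi> at \<open>x\<close> to the solution r L \<xi> at
    \<open>f x\<close>.\<close>
  define r where "r = conf (f x) / conf x"
  have r: "r > 0" using conf_pos[OF x] conf_pos[OF fx] by (simp add: r_def)
  have iso: "r * r * (L u \<bullet> L v) = u \<bullet> v" for u v
  proof -
    obtain k where k: "k \<noteq> 0" "\<And>x u v. hyperbolic_metric s x u v = k * (conf x)\<^sup>2 * (u \<bullet> (v :: real^'n))"
      using hyperbolic_metric_conf[OF s n] by blast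
    have "hyperbolic_metric s (f x) (L u) (L v) = hyperbolic_metric s x u v"
      using f x by (auto simp: riemannian_isometry_def L_def)
    then have "(conf (f x))\<^sup>2 * (L u \<bullet> L v) = (conf x)\<^sup>2 * (u \<bullet> v)" unfolding k(2) using k(1) by simp
    then show ?thesis using conf_pos[OF x] by (simp add: r_def field_simps power2_eq_square)
  qed
  have inj: "inj L"
  proof (rule linear_injective_0[OF lin, THEN iffD2], intro allI impI)
    fix u assume "L u = 0"
    then have "u \<bullet> u = 0" using iso[of u u] by simp
    then show "u = 0" by simp
  qed
  have surj: "surj L" by (rule linear_injective_imp_surjective[OF lin inj refl])
  have TT: "r *\<^sub>R (field_of S' (f x) (L u) *v L v) = L (field_of S x u *v v)" for u v
  proof -
    have "bil S' (f x) (L u) (L v) = L (bil S x u v)"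
      using c x by (auto simp: carries_def L_def)
    then show ?thesis
      using conf_pos[OF x] conf_pos[OF fx] by (simp add: field_of_apply linear_scale[OF lin] r_def field_simps)
  qed
  show ?thesis
  proof
    assume "\<exists>\<xi>. \<forall>Y. field_of S x Y *v \<xi> = (Y \<bullet> \<xi>) *\<^sub>R \<xi> - Y"
    then obtain \<xi> where \<xi>: "\<And>Y. field_of S x Y *v \<xi> = (Y \<bullet> \<xi>) *\<^sub>R \<xi> - Y" by blast
    have "field_of S' (f x) (L Y) *v (r *\<^sub>R L \<xi>) = (L Y \<bullet> (r *\<^sub>R L \<xi>)) *\<^sub>R (r *\<^sub>R L \<xi>) - L Y" for Y
      using TT[of Y \<xi>] iso[of Y \<xi>]
      by (simp add: matrix_vector_mult_scaleR \<xi> linear_diff[OF lin] linear_scale[OF lin] mult_ac)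
    then have "\<forall>Y. field_of S' (f x) Y *v (r *\<^sub>R L \<xi>) = (Y \<bullet> (r *\<^sub>R L \<xi>)) *\<^sub>R (r *\<^sub>R L \<xi>) - Y"
      using surj by (metis surjD)
    then show "\<exists>\<xi>. \<forall>Y. field_of S' (f x) Y *v \<xi> = (Y \<bullet> \<xi>) *\<^sub>R \<xi> - Y" by blast
  next
    assume "\<exists>\<xi>. \<forall>Y. field_of S' (f x) Y *v \<xi> = (Y \<bullet> \<xi>) *\<^sub>R \<xi> - Y"
    then obtain \<zeta> where \<zeta>: "\<And>Y. field_of S' (f x) Y *v L \<zeta> = (Y \<bullet> L \<zeta>) *\<^sub>R L \<zeta> - Y" using surj by (metis surjD)
    have "L (field_of S x Y *v (inverse r *\<^sub>R \<zeta>)) = L ((Y \<bullet> (inverse r *\<^sub>R \<zeta>)) *\<^sub>R (inverse r *\<^sub>R \<zeta>) - Y)" for Y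
    proof -
      have "L (field_of S x Y *v (inverse r *\<^sub>R \<zeta>)) = field_of S' (f x) (L Y) *v L \<zeta>"
        using TT[of Y \<zeta>, symmetric] r by (simp add: matrix_vector_mult_scaleR linear_scale[OF lin])
      also have "\<dots> = (L Y \<bullet> L \<zeta>) *\<^sub>R L \<zeta> - L Y" by (rule \<zeta>)
      also have "L Y \<bullet> L \<zeta> = inverse r * inverse r * (Y \<bullet> \<zeta>)"
        using iso[of Y \<zeta>, symmetric] r by (simp add: field_simps)
      finally show ?thesis by (simp add: linear_diff[OF lin] linear_scale[OF lin] mult_ac)
    qed
    then have "field_of S x Y *v (inverse r *\<^sub>R \<zeta>) = (Y \<bullet> (inverse r *\<^sub>R \<zeta>)) *\<^sub>R (inverse r *\<^sub>R \<zeta>) - Y" for Y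
      using inj by (metis injD)
    then show "\<exists>\<xi>. \<forall>Y. field_of S x Y *v \<xi> = (Y \<bullet> \<xi>) *\<^sub>R \<xi> - Y" by blast
  qed
qed

lemma isomorphic_mtr:
  fixes S S' :: "'n::finite bilinear_field"
  assumes n: "CARD('n) > 1" and s: "s < 0" and p: "p \<in> RH"
    and SS': "(S, S') \<in> isomorphism_rel RH (hyperbolic_metric s)"
  shows "mtr (field_of S p) = 0 \<longleftrightarrow> mtr (field_of S' p) = 0"
proof -
  obtain f where f: "riemannian_isometry RH (hyperbolic_metric s) f" "carries RH f S S'"
    and S: "homogeneous_tensor RH (hyperbolic_metric s) S" "homogeneous_tensor RH (hyperbolic_metric s) S'"
    using SS' by (auto simp: isomorphism_rel_def)
  note T = homogeneous_tensor_field_of[OF s n S(1)] and T' = homogeneous_tensor_field_of[OF s n S(2)]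
  have fp: "f p \<in> RH" using f p by (auto simp: riemannian_isometry_def bij_betw_def)
  show ?thesis
    using mtr_eq_0_iff[OF n T p] mtr_eq_0_iff[OF n T' fp] isometry_horospherical[OF n s f p]
      mtr_zero_propagates[OF T' fp p]
    by simp
qed

lemma isomorphism_rel_refl:
  fixes S :: "'n::finite bilinear_field"
  assumes "homogeneous_tensor RH (hyperbolic_metric s) S"
  shows "(S, S) \<in> isomorphism_rel RH (hyperbolic_metric s)"
proof -
  have d: "dir_deriv u (\<lambda>x. x) x = u" for u x :: "real^'n"
    by (rule dir_deriv_eqI) (rule has_derivative_ident)
  have "Ck_on k RH (inv_into RH (\<lambda>x :: real^'n. x))" for k
    by (rule Ck_on_cong[OF open_RH _ Ck_on_ident[OF open_RH]]) (simp add: inv_into_f_f)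
  then have "riemannian_isometry RH (hyperbolic_metric s) (\<lambda>x :: real^'n. x)"
    by (auto simp: riemannian_isometry_def d smooth_on_def Ck_on_ident open_RH bij_betw_def)
  moreover have "carries RH (\<lambda>x. x) S S" by (simp add: carries_def d)
  ultimately show ?thesis using assms by (auto simp: isomorphism_rel_def)
qed

section \<open>The two components\<close>

lemma connected_components_of_clopen_partition:
  assumes A: "connectedin Y A" "openin Y A" "A \<noteq> {}" and B: "connectedin Y B" "openin Y B" "B \<noteq> {}"
    and AB: "A \<inter> B = {}" "topspace Y = A \<union> B"
  shows "connected_components_of Y = {A, B}"
proof -
  have comp: "connected_component_of_set Y a = A"
    if A: "connectedin Y A" "openin Y A" "a \<in> A" and B: "openin Y B" and AB: "A \<inter> B = {}" "topspace Y = A \<union> B"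
    for a A B
  proof
    have "topspace Y - B = A" using AB by blast
    then have "closedin Y A" using B by (metis closedin_diff closedin_topspace)
    then have "connected_component_of_set Y a \<subseteq> A \<or> disjnt (connected_component_of_set Y a) A"
      using connectedin_clopen_cases[OF connectedin_connected_component_of _ A(2)] by blast
    moreover show "A \<subseteq> connected_component_of_set Y a"
      using connected_component_of_maximal[OF A(1,3)] .
    ultimately show "connected_component_of_set Y a \<subseteq> A" using A(3) by (auto simp: disjnt_def)
  qed
  have "connected_component_of_set Y a = A" if "a \<in> A" for a
    using comp[OF A(1,2) that B(2) AB] .
  moreover have "connected_component_of_set Y b = B" if "b \<in> B" for b
    using comp[OF B(1,2) that A(2)] AB by (simp add: Int_commute Un_commute)
  ultimately show ?thesis
    using A(3) B(3) AB(2) unfolding connected_components_of_def by (auto simp: image_Un)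
qed

lemma topspace_homogeneous_tensor_topology:
  "topspace (homogeneous_tensor_topology M g p) = {S. homogeneous_tensor M g S}"
  by (simp add: homogeneous_tensor_topology_def topspace_pullback_topology)

lemma openin_homogeneous_tensor_topology:
  "open U \<Longrightarrow> openin (homogeneous_tensor_topology M g p) {S. homogeneous_tensor M g S \<and> S p \<in> U}"
  unfolding homogeneous_tensor_topology_def openin_pullback_topology open_openin[symmetric]
  by (intro exI[of _ U]) auto

lemma mtr_field_of: "mtr (field_of S p) = inverse (conf p) *\<^sub>R (\<Sum>i\<in>UNIV. bil S p (axis i 1) (axis i 1))"
  by (simp add: mtr_def field_of_apply scaleR_sum_right)

context
  fixes s :: real and p :: "real^'n::finite"
  assumes n: "CARD('n) > 1" and s: "s < 0" and p: "p \<in> RH"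
begin

abbreviation "hom_tensors \<equiv> homogeneous_tensor_topology RH (hyperbolic_metric s) p"

definition flat_tensors :: "'n bilinear_field set" where
  "flat_tensors = {S. homogeneous_tensor RH (hyperbolic_metric s) S \<and> mtr (field_of S p) = 0}"

definition horospherical_tensors :: "'n bilinear_field set" where
  "horospherical_tensors = {S. homogeneous_tensor RH (hyperbolic_metric s) S \<and> mtr (field_of S p) \<noteq> 0}"

lemma tensor_of_mem:
  assumes "hom_field T"
  shows "tensor_of T \<in> flat_tensors \<longleftrightarrow> mtr (T p) = 0" "tensor_of T \<in> horospherical_tensors \<longleftrightarrow> mtr (T p) \<noteq> 0"
  using homogeneous_tensor_tensor_of[OF s n assms] field_of_tensor_of[where T = T, OF p parallelD(1)[OF assms p]]
  by (simp_all add: flat_tensors_def horospherical_tensors_def)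

lemma openin_flat_tensors: "openin hom_tensors flat_tensors"
  and openin_horospherical_tensors: "openin hom_tensors horospherical_tensors"
proof -
  define m where "m B = inverse (conf p) *\<^sub>R (\<Sum>i\<in>UNIV. blinfun_apply (blinfun_apply B (axis i 1)) (axis i 1))"
    for B :: "(real^'n) \<Rightarrow>\<^sub>L (real^'n) \<Rightarrow>\<^sub>L (real^'n)"
  have m: "mtr (field_of S p) = m (S p)" for S by (simp add: m_def mtr_field_of)
  have cont: "continuous_on UNIV m" unfolding m_def[abs_def] by (intro continuous_intros)
  \<comment> \<open>The trace has norm 0 or n - 1 > 0, so the strict bound singles out trace 0 by an
    open condition.\<close>
  have "open {B. m B \<noteq> 0}" "open {B. norm (m B) < real CARD('n) - 1}"
    by (intro open_Collect_neq open_Collect_less continuous_intros cont)+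
  note this[THEN openin_homogeneous_tensor_topology[where M = RH and g = "hyperbolic_metric s" and p = p]]
  moreover have "norm (mtr (field_of S p)) = real CARD('n) - 1"
    if "homogeneous_tensor RH (hyperbolic_metric s) S" "mtr (field_of S p) \<noteq> 0" for S
    using horospherical_at(1)[OF n homogeneous_tensor_field_of[OF s n that(1)] p that(2) refl] n
    by (simp add: field_simps)
  then have "{S. homogeneous_tensor RH (hyperbolic_metric s) S \<and> S p \<in> {B. norm (m B) < real CARD('n) - 1}} = flat_tensors"
    using n by (force simp: flat_tensors_def m)
  moreover have "{S. homogeneous_tensor RH (hyperbolic_metric s) S \<and> S p \<in> {B. m B \<noteq> 0}} = horospherical_tensors"
    by (auto simp: horospherical_tensors_def m)
  ultimately show "openin hom_tensors flat_tensors" "openin hom_tensors horospherical_tensors" by simp_all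
qed

text \<open>The topology sees only the value at \<open>p\<close>, so continuity there is enough. The
  parameter ranges over a general connected set because intervals and the sphere at infinity both
  occur.\<close>

lemma joined:
  fixes c :: "'b::topological_space \<Rightarrow> real^'n \<Rightarrow> real^'n \<Rightarrow> real^'n^'n"
  assumes D: "connected D" "a \<in> D" "b \<in> D" and c: "\<And>t. t \<in> D \<Longrightarrow> hom_field (c t)" "\<And>t. t \<in> D \<Longrightarrow> tensor_of (c t) \<in> V"
    and cont: "\<And>u v. continuous_on D (\<lambda>t. c t p u *v v)"
  shows "connected_component_of (subtopology hom_tensors V) (tensor_of (c a)) (tensor_of (c b))"
proof -
  have "continuous_on D (\<lambda>t. tensor_of (c t) p)"
    using p unfolding tensor_of_def of_components_def
    by (auto intro!: continuous_intros cont bounded_linear.continuous_on[OF bounded_linear_tens])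
  then have "continuous_map (top_of_set D) euclidean ((\<lambda>S. S p) \<circ> (\<lambda>t. tensor_of (c t)))" by (simp add: o_def)
  then have "continuous_map (top_of_set D) hom_tensors (\<lambda>t. tensor_of (c t))"
    unfolding homogeneous_tensor_topology_def
    by (rule continuous_map_pullback') (use homogeneous_tensor_tensor_of[OF s n c(1)] in auto)
  then have "continuous_map (top_of_set D) (subtopology hom_tensors V) (\<lambda>t. tensor_of (c t))"
    by (rule continuous_map_into_subtopology) (use c(2) in auto)
  then have "connectedin (subtopology hom_tensors V) ((\<lambda>t. tensor_of (c t)) ` D)"
    by (rule connectedin_continuous_map_image) (simp add: connectedin_subtopology D)
  then show ?thesis using D(2,3) unfolding connected_component_of_def by blast
qed

lemma connectedin_if_joined:
  assumes V: "V \<subseteq> topspace hom_tensors" and "\<And>S. S \<in> V \<Longrightarrow> connected_component_of (subtopology hom_tensors V) S Z"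
  shows "connectedin hom_tensors V"
proof -
  have "connected_space (subtopology hom_tensors V)"
    unfolding connected_space_iff_connected_component
  proof (intro ballI)
    fix S S'
    assume "S \<in> topspace (subtopology hom_tensors V)" "S' \<in> topspace (subtopology hom_tensors V)"
    then have "S \<in> V" "S' \<in> V" by simp_all
    then show "connected_component_of (subtopology hom_tensors V) S S'"
      by (meson assms(2) connected_component_of_trans connected_component_of_sym)
  qed
  then show ?thesis using V by (simp add: connectedin_def)
qed

lemma tensor_of_field_of_homogeneous:
  "homogeneous_tensor RH (hyperbolic_metric s) S \<Longrightarrow> tensor_of (field_of S) = S"
  by (rule tensor_of_field_of) (simp add: homogeneous_tensor_def)

lemma connectedin_flat_tensors: "connectedin hom_tensors flat_tensors"
proof (rule connectedin_if_joined)
  show "flat_tensors \<subseteq> topspace hom_tensors"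
    by (auto simp: flat_tensors_def topspace_homogeneous_tensor_topology)
  fix S assume "S \<in> flat_tensors"
  then have S: "homogeneous_tensor RH (hyperbolic_metric s) S" "mtr (field_of S p) = 0" by (auto simp: flat_tensors_def)
  let ?c = "\<lambda>t x v. t *\<^sub>R field_of S x v"
  have hom: "hom_field (?c t)" for t
    by (rule hom_field_scale[OF n homogeneous_tensor_field_of[OF s n S(1)] p S(2)])
  have "mtr (?c t p) = 0" for t
    using S(2) by (simp add: mtr_def mat_simps scaleR_sum_right[symmetric])
  then have "tensor_of (?c t) \<in> flat_tensors" for t using tensor_of_mem(1)[OF hom] by simp
  then have "connected_component_of (subtopology hom_tensors flat_tensors) (tensor_of (?c 1)) (tensor_of (?c 0))"
    by (intro joined[where D = "{0..1::real}"] hom) (auto simp: mat_simps intro!: continuous_intros)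
  then show "connected_component_of (subtopology hom_tensors flat_tensors) S (tensor_of (\<lambda>x v. 0))"
    using tensor_of_field_of_homogeneous[OF S(1)] by simp
qed

lemma horospherical_direction:
  assumes T: "hom_field T" and m: "mtr (T p) \<noteq> 0"
  shows "norm (direction T p) = 1" "T p Y *v direction T p = (Y \<bullet> direction T p) *\<^sub>R direction T p - Y"
    "axial t T p Y *v direction T p = (Y \<bullet> direction T p) *\<^sub>R direction T p - Y"
proof -
  note H = horospherical_at[OF n T p m direction_def[of T p]]
  show 1: "norm (direction T p) = 1" "T p Y *v direction T p = (Y \<bullet> direction T p) *\<^sub>R direction T p - Y" for Y
    by (fact H)+
  have "direction T p \<bullet> direction T p = 1" using 1(1) by (simp add: norm_eq_1)
  then show "axial t T p Y *v direction T p = (Y \<bullet> direction T p) *\<^sub>R direction T p - Y"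
    by (simp add: axial_def beta_def mat_simps 1(2) algebra_simps inner_commute)
qed

lemma tensor_of_mem_horospherical:
  assumes "hom_field T" "\<And>Y. T p Y *v \<xi> = (Y \<bullet> \<xi>) *\<^sub>R \<xi> - Y"
  shows "tensor_of T \<in> horospherical_tensors"
  using tensor_of_mem(2)[OF assms(1)] mtr_eq_0_iff[OF n assms(1) p] assms(2) by blast

lemma tensor_of_towards_mem:
  assumes b: "norm b = 1"
  shows "tensor_of (\<lambda>x. wedge (towards b x)) \<in> horospherical_tensors"
proof (rule tensor_of_mem_horospherical[OF hom_field_towards[OF b]])
  have "towards b p \<bullet> towards b p = 1" using norm_towards[OF b p] by (simp add: norm_eq_1)
  then show "wedge (towards b p) Y *v towards b p = (Y \<bullet> towards b p) *\<^sub>R towards b p - Y" for Y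
    by (simp add: mat_simps)
qed

lemma connectedin_horospherical_tensors: "connectedin hom_tensors horospherical_tensors"
proof (rule connectedin_if_joined)
  show "horospherical_tensors \<subseteq> topspace hom_tensors"
    by (auto simp: horospherical_tensors_def topspace_homogeneous_tensor_topology)
  fix S assume "S \<in> horospherical_tensors"
  then have S: "homogeneous_tensor RH (hyperbolic_metric s) S" "mtr (field_of S p) \<noteq> 0"
    by (auto simp: horospherical_tensors_def)
  let ?J = "connected_component_of (subtopology hom_tensors horospherical_tensors)"
  define T where "T = field_of S"
  define \<xi> where "\<xi> = direction T p"
  have T: "hom_field T" and m: "mtr (T p) \<noteq> 0"
    using homogeneous_tensor_field_of[OF s n S(1)] S(2) by (simp_all add: T_def)
  note dir = horospherical_direction[OF T m]
  let ?c1 = "\<lambda>r x v. r *\<^sub>R T x v + (1 - r) *\<^sub>R axial 1 T x v"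
  have hom1: "hom_field (?c1 r)" for r by (rule hom_field_towards_axial[OF n T p m])
  have "?c1 r p Y *v \<xi> = (Y \<bullet> \<xi>) *\<^sub>R \<xi> - Y" for r Y
    by (simp add: matrix_vector_mult_add_rdistrib mat_simps dir \<xi>_def algebra_simps)
  then have "tensor_of (?c1 r) \<in> horospherical_tensors" for r by (rule tensor_of_mem_horospherical[OF hom1])
  then have "?J (tensor_of (?c1 1)) (tensor_of (?c1 0))"
    by (intro joined[where D = "{0..1::real}"] hom1)
      (auto simp: matrix_vector_mult_add_rdistrib mat_simps intro!: continuous_intros)
  then have 1: "?J S (tensor_of (axial 1 T))"
    using tensor_of_field_of_homogeneous[OF S(1)] by (simp add: T_def)
  have hom2: "hom_field (axial t T)" for t by (rule hom_field_axial[OF n T p m])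
  have mem2: "tensor_of (axial t T) \<in> horospherical_tensors" for t
    by (rule tensor_of_mem_horospherical[OF hom2 dir(3)])
  then have 2: "?J (tensor_of (axial 1 T)) (tensor_of (axial 0 T))"
    by (intro joined[where D = "{0..1::real}"] hom2 mem2)
      (auto simp: axial_def matrix_vector_mult_add_rdistrib mat_simps intro!: continuous_intros)
  obtain b where b: "norm b = 1" "towards b p = \<xi>"
    using towards_surj[OF p dir(1)] by (auto simp: \<xi>_def)
  text \<open>The next two tensors have the same value at \<open>p\<close>, so the topology does not separate them.\<close>
  define c3 where "c3 t = (if t = (0::real) then axial 0 T else (\<lambda>x. wedge (towards b x)))" for t
  have "c3 t p v = wedge \<xi> v" for t v by (simp add: c3_def axial_def b(2) \<xi>_def)
  then have "?J (tensor_of (c3 0)) (tensor_of (c3 1))"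
    using hom2 mem2 hom_field_towards[OF b(1)] tensor_of_towards_mem[OF b(1)]
    by (intro joined[where D = "{0..1::real}"]) (auto simp: c3_def)
  then have 3: "?J (tensor_of (axial 0 T)) (tensor_of (\<lambda>x. wedge (towards b x)))" by (simp add: c3_def)
  \<comment> \<open>The boundary sphere is connected only from dimension 2 on.\<close>
  have "DIM(real^'n) \<ge> 2" using n by simp
  then have conn: "connected (sphere (0 :: real^'n) 1)" by (rule connected_sphere)
  have "b' \<noteq> p" if "norm b' = 1" for b' using that p by (auto simp: RH_def)
  then have cont: "continuous_on (sphere 0 1) (\<lambda>b. wedge (towards b p) u *v v)" for u v
    unfolding wedge_apply towards_def by (intro continuous_intros) auto
  \<comment> \<open>Here \<open>axis undefined 1\<close> is a fixed unit vector, the boundary point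
    of the common base tensor.\<close>
  have "?J (tensor_of (\<lambda>x. wedge (towards b x))) (tensor_of (\<lambda>x. wedge (towards (axis undefined 1) x)))"
    by (rule joined[OF conn, where c = "\<lambda>b x. wedge (towards b x)"])
      (auto simp: b(1) tensor_of_towards_mem hom_field_towards cont)
  then show "?J S (tensor_of (\<lambda>x. wedge (towards (axis undefined 1) x)))"
    by (rule connected_component_of_trans[OF connected_component_of_trans[OF connected_component_of_trans[OF 1 2] 3]])
qed

end

theorem theorem6p1:
  fixes s :: real and p :: "real^'n::finite"
  assumes "CARD('n) > 1" and "s < 0" and "p \<in> RH"
  shows "card (connected_components_of (moduli_space RH (hyperbolic_metric s) p)) = 2"
proof -
  note a = assms
  let ?rel = "isomorphism_rel RH (hyperbolic_metric s) :: ('n bilinear_field \<times> 'n bilinear_field) set"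
  let ?H = "{S :: 'n bilinear_field. homogeneous_tensor RH (hyperbolic_metric s) S}"
  define q where "q S = ?rel `` {S}" for S
  define X where "X = homogeneous_tensor_topology RH (hyperbolic_metric s) p"
  define Y where "Y = moduli_space RH (hyperbolic_metric s) p"
  have Y: "Y = quotient_topology X q" by (simp add: Y_def moduli_space_def X_def q_def[abs_def])
  have qm: "quotient_map X Y q" unfolding Y by (rule quotient_map_quotient_topology)
  let ?A = "flat_tensors s p" and ?B = "horospherical_tensors s p"
  have AB: "?A \<inter> ?B = {}" "topspace X = ?A \<union> ?B"
    by (auto simp: flat_tensors_def[OF a] horospherical_tensors_def[OF a] X_def topspace_homogeneous_tensor_topology)
  \<comment> \<open>Reflexivity puts \<open>S'\<close> into its own class, which is that of
    \<open>S\<close>; so \<open>S\<close> and \<open>S'\<close> are related.\<close>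
  have type: "mtr (field_of S p) = 0 \<longleftrightarrow> mtr (field_of S' p) = 0" if "q S = q S'" "S' \<in> ?H" for S S'
    using that isomorphism_rel_refl[of s S'] isomorphic_mtr[OF a, of S S'] by (auto simp: q_def)
  \<comment> \<open>Both sets are unions of isomorphism classes, so their images are open in the
    quotient and disjoint.\<close>
  have sat: "{S \<in> topspace X. q S \<in> q ` ?A} = ?A" "{S \<in> topspace X. q S \<in> q ` ?B} = ?B"
    using type
    by (auto simp: flat_tensors_def[OF a] horospherical_tensors_def[OF a] X_def topspace_homogeneous_tensor_topology)
  have open_q: "openin Y (q ` ?A)" "openin Y (q ` ?B)"
    using sat AB openin_flat_tensors[OF a] openin_horospherical_tensors[OF a]
    unfolding Y openin_quotient_topology X_def[symmetric] by auto
  have conn: "connectedin Y (q ` ?A)" "connectedin Y (q ` ?B)"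
    using connectedin_flat_tensors[OF a] connectedin_horospherical_tensors[OF a]
      connectedin_continuous_map_image[OF quotient_imp_continuous_map[OF qm]]
    unfolding X_def by blast+
  have disj: "q ` ?A \<inter> q ` ?B = {}" using sat AB by auto
  have "tensor_of (\<lambda>x. wedge (towards (axis undefined 1) x)) \<in> ?B" by (rule tensor_of_towards_mem[OF a]) simp
  then have B: "?B \<noteq> {}" by blast
  have "parallel (Om (\<lambda>x v. 0)) (\<lambda>(x :: real^'n) v. 0)"
    by (simp add: parallel_def act_def linear_iff)
  then have "tensor_of (\<lambda>x v. 0) \<in> ?A" by (subst tensor_of_mem[OF a]) (simp_all add: mtr_def)
  then have A: "?A \<noteq> {}" by blast
  have "topspace Y = q ` ?A \<union> q ` ?B"
    using quotient_imp_surjective_map[OF qm] AB(2) by (simp add: image_Un)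
  then have "connected_components_of Y = {q ` ?A, q ` ?B}"
    using conn open_q A B disj by (intro connected_components_of_clopen_partition) auto
  moreover have "q ` ?A \<noteq> q ` ?B" using disj A by blast
  ultimately show ?thesis by (simp add: Y_def)
qed

end
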